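(* Fix integers $1\le k\le n$. The sum over $i\in C_{n,k}$ of the normalized volumes of the polytopes $P^{n,k}_i$ is $$\sum_{i\in C_{n,k}}\operatorname{vol}(P^{n,k}_i)=N(n,k)\cdot\prod_{i=1}^{n-1}C_i,$$ where $N(n,k)=\frac1n\binom nk\binom n{k-1}$ is the Narayana number and $C_i=\frac1{i+1}\binom{2i}{i}$ is the $i$-th Catalan number.
   Context: Graphs are loopless and may have multiple edges (distinct parallel edges are different elements of the edge multiset); vertex sets are totally ordered; an edge is written $(i,j)$ with $i<j$, $i$ being its initial and $j$ its final vertex. $[N]=\{1,\dots,N\}$. For $G=([n+1],E)$, $\tilde G$ is the graph on $[n+1]\cup\{s,t\}$, with $s$ smaller and $t$ larger than all of $[n+1]$, and edge multiset $E\cup\{(s,i),(i,t): i\in[n+1]\}$. The flow polytope $\mathcal{F}_H$ of a graph $H$ with smallest vertex $s$ and largest vertex $t$ is the set of functions $f:E(H)\to\mathbb{R}_{\ge0}$ such that the total $f$-value of edges with initial vertex $s$ is $1$, the total $f$-value of edges with final vertex $t$ is $1$, and at every other vertex the total incoming $f$-value equals the total outgoing $f$-value. $\operatorname{vol}$ is normalized volume (with respect to the integer lattice in the affine hull, a unimodular simplex having volume $1$). For $1\le k\le n$, $\{G^{n,k}_i\}_{i\in C_{n,k}}$ is the collection of all graphs on the vertex set $[n+1]$ with $\binom{n+1}{2}$ edges (counted with multiplicity) such that: the edge $(1,n+1)$ has multiplicity $n$; all edges other than $(1,n+1)$ have multiplicity zero or one; if $(1,l)$ with $2\le l\le n$ is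 in the graph, then $(l,n+1)$ is not; there are exactly $k-1$ edges of the form $(1,l)$, $2\le l\le n$, in the graph. Here $C_{n,k}$ is just an index set. Define $P^{n,k}_i=\mathcal{F}_{\tilde G^{n,k}_i}$. *)

theory Defs
  imports "HOL-Analysis.Analysis" "HOL-Library.Multiset"
begin

type_synonym 'v multigraph = "'v set \<times> ('v \<times> 'v) multiset"

definition ordered_multigraph :: "'v::linorder multigraph \<Rightarrow> bool" where
  "ordered_multigraph G \<longleftrightarrow>
     finite (fst G) \<and> (\<forall>(i, j) \<in># snd G. i \<in> fst G \<and> j \<in> fst G \<and> i < j)"

text \<open>Parallel edges are told apart by a second component: an edge of multiplicity \<open>m\<close>
  contributes the \<open>m\<close> distinct elements \<open>((i, j), 0), \<dots>, ((i, j), m - 1)\<close>.\<close>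

type_synonym 'v edge = "('v \<times> 'v) \<times> nat"

definition edges :: "'v multigraph \<Rightarrow> 'v edge set" where
  "edges G = (SIGMA e : set_mset (snd G). {..<count (snd G) e})"

definition initial :: "'v edge \<Rightarrow> 'v" where
  "initial e = fst (fst e)"

definition final :: "'v edge \<Rightarrow> 'v" where
  "final e = snd (fst e)"

text \<open>Elements of \<open>\<real>\<^sup>E\<close> are represented by functions on all potential edges that vanish
  outside \<open>E\<close>.\<close>

definition flow_polytope :: "'v::linorder multigraph \<Rightarrow> ('v edge \<Rightarrow> real) set" where
  "flow_polytope G = {f.
     (\<forall>e \<in> edges G. 0 \<le> f e) \<and> (\<forall>e. e \<notin> edges G \<longrightarrow> f e = 0) \<and>
     (\<Sum>e | e \<in> edges G \<and> initial e = Min (fst G). f e) = 1 \<and>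
     (\<Sum>e | e \<in> edges G \<and> final e = Max (fst G). f e) = 1 \<and>
     (\<forall>v \<in> fst G - {Min (fst G), Max (fst G)}.
        (\<Sum>e | e \<in> edges G \<and> final e = v. f e) = (\<Sum>e | e \<in> edges G \<and> initial e = v. f e))}"

text \<open>For a graph on \<open>{1..n + 1}\<close>, the new vertices are \<open>s = 0\<close> and \<open>t = n + 2\<close>.\<close>

definition augment :: "nat \<Rightarrow> nat multigraph \<Rightarrow> nat multigraph" where
  "augment n G =
     ({0..n + 2},
      snd G + mset_set ((\<lambda>i. (0, i)) ` {1..n + 1}) + mset_set ((\<lambda>i. (i, n + 2)) ` {1..n + 1}))"

text \<open>The library's \<open>affine\<close> needs a real vector space type, which \<open>'e \<Rightarrow> real\<close> is not.\<close>

definition affine_fun :: "('e \<Rightarrow> real) set \<Rightarrow> bool" where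
  "affine_fun S \<longleftrightarrow>
     (\<forall>f \<in> S. \<forall>g \<in> S. \<forall>u v. u + v = 1 \<longrightarrow> (\<lambda>e. u * f e + v * g e) \<in> S)"

definition integer_points :: "('e \<Rightarrow> real) set" where
  "integer_points = {f. \<forall>e. f e \<in> \<int>}"

definition affine_chart ::
  "nat \<Rightarrow> ('e \<Rightarrow> real) \<Rightarrow> (nat \<Rightarrow> 'e \<Rightarrow> real) \<Rightarrow> (nat \<Rightarrow> real) \<Rightarrow> ('e \<Rightarrow> real)" where
  "affine_chart d p b x = (\<lambda>e. p e + (\<Sum>i<d. x i * b i e))"

text \<open>The two conditions say that \<open>p\<close> is a lattice point of the affine hull of \<open>P\<close>, that \<open>d\<close>
  is the dimension of the hull and that \<open>b 0, \<dots>, b (d - 1)\<close> is a \<open>\<int>\<close>-basis of the lattice of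
  integer vectors parallel to it.\<close>

definition lattice_chart ::
  "('e \<Rightarrow> real) set \<Rightarrow> nat \<Rightarrow> ('e \<Rightarrow> real) \<Rightarrow> (nat \<Rightarrow> 'e \<Rightarrow> real) \<Rightarrow> bool" where
  "lattice_chart P d p b \<longleftrightarrow>
     bij_betw (affine_chart d p b) ({..<d} \<rightarrow>\<^sub>E UNIV) (affine_fun hull P) \<and>
     bij_betw (affine_chart d p b) ({..<d} \<rightarrow>\<^sub>E \<int>) ((affine_fun hull P) \<inter> integer_points)"

text \<open>The factor \<open>fact d\<close> gives the simplex with vertices \<open>p, p + b 0, \<dots>, p + b (d - 1)\<close> volume
  \<open>1\<close>. A change of chart is an integer translation composed with a matrix in \<open>GL\<^sub>d(\<int>)\<close>, so the
  value does not depend on the chart. If the affine hull has no lattice point, there is no chart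
  and the value is unspecified; this does not occur for nonempty lattice polytopes.\<close>

definition normalized_volume :: "('e \<Rightarrow> real) set \<Rightarrow> real" where
  "normalized_volume P = (THE vol. \<exists>d p b. lattice_chart P d p b \<and>
     vol = fact d * measure (\<Pi>\<^sub>M i\<in>{..<d}. lborel)
                      {x \<in> {..<d} \<rightarrow>\<^sub>E UNIV. affine_chart d p b x \<in> P})"

definition graph_family :: "nat \<Rightarrow> nat \<Rightarrow> nat multigraph set" where
  "graph_family n k = {G. ordered_multigraph G \<and> fst G = {1..n + 1} \<and>
     size (snd G) = (n + 1) choose 2 \<and>
     count (snd G) (1, n + 1) = n \<and>
     (\<forall>e. e \<noteq> (1, n + 1) \<longrightarrow> count (snd G) e \<le> 1) \<and>
     (\<forall>l \<in> {2..n}. (1, l) \<in># snd G \<longrightarrow> (l, n + 1) \<notin># snd G) \<and>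
     size {#e \<in># snd G. \<exists>l \<in> {2..n}. e = (1, l)#} = k - 1}"

definition narayana :: "nat \<Rightarrow> nat \<Rightarrow> real" where
  "narayana n k = 1 / real n * real (n choose k) * real (n choose (k - 1))"

definition catalan :: "nat \<Rightarrow> real" where
  "catalan i = 1 / real (i + 1) * real ((2 * i) choose i)"

end

theory Submission
  imports Defs
begin

text \<open>
  The number of lattice points in a certain set turns up as a volume, and a discrete analogue of
  the method by which Aomoto evaluated Selberg's integral computes the sum of these numbers.

  A graph of the family is given by a set \<open>S \<subseteq> {2..n}\<close> with \<open>k - 1\<close> elements. Since the number of
  edges is the largest one that the conditions permit, the graph contains every edge inside
  \<open>{2..n}\<close>, the edge \<open>(1, l)\<close> for \<open>l \<in> S\<close>, the edge \<open>(l, n + 1)\<close> for the other \<open>l\<close>, and \<open>n\<close> copies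
  of \<open>(1, n + 1)\<close> (lemma \<open>graph_family_eq\<close>).

  The volume of \<open>\<F>\<close> of the augmented graph of any \<open>G\<close> is the number of functions
  \<open>a : E(G) \<rightarrow> \<nat>\<close> whose inflow at each vertex is at most the outflow plus the outdegree (theorem
  \<open>normalized_volume_flow_polytope\<close>). To see this, keep one outgoing edge of every vertex in
  reserve and take the values on the remaining edges as coordinates; they form a lattice chart,
  and the polytope becomes the region where the coordinates and the amounts left over at the
  vertices are nonnegative. Integrate one coordinate after the other, the edges that leave the
  last vertices innermost. At each stage the volume is a polynomial in the amounts \<open>c\<^sub>v\<close> that are
  present at the vertices. Integration over the value \<open>y \<in> [0, c\<^sub>v]\<close> of an edge \<open>(v, w)\<close> replaces
  \<open>c\<^sub>w\<close> by \<open>c\<^sub>w + y\<close> and \<open>c\<^sub>v\<close> by \<open>c\<^sub>v - y\<close>, and it turns a product of divided powers of degrees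
  \<open>q\<^sub>w, q\<^sub>v\<close> into the sum over \<open>s \<le> q\<^sub>w\<close> of those of degrees \<open>q\<^sub>w - s, q\<^sub>v + s + 1\<close>. The numbers \<open>s\<close>
  chosen for the edges are the function \<open>a\<close>, and the polynomial is finally evaluated at a unit of
  flow in the source. That normalized volume may be computed in any chart (theorem
  \<open>normalized_volume_eq\<close>) follows from uniqueness of translation invariant measures, because the
  unit cubes of two charts are fundamental domains of the same lattice.

  For the graph of \<open>S\<close> the conditions force \<open>a = 0\<close> on the edges into \<open>n + 1\<close>. Let \<open>p\<close> be the
  restriction of \<open>a\<close> to the edges inside \<open>{2..n}\<close> and let
  \<open>u\<^sub>l = n + 1 - l + out\<^sub>p(l) - in\<^sub>p(l)\<close>. All \<open>u\<^sub>l\<close> are nonnegative, and for \<open>l \<in> S\<close> the value on \<open>(1, l)\<close>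
  is any of \<open>0, \<dots>, u\<^sub>l - 1\<close>. Hence the volume is the sum over \<open>p\<close> of the product of the \<open>u\<^sub>l\<close>,
  \<open>l \<in> S\<close>, and the sum over \<open>S\<close> is the sum \<open>E\<^sub>k\<^sub>-\<^sub>1\<close> over \<open>p\<close> of the elementary symmetric polynomial
  \<open>e\<^sub>k\<^sub>-\<^sub>1(u)\<close>.

  Two recursions determine these sums. Expanding one factor \<open>u\<^sub>l\<close> by its definition and summing by
  parts over each \<open>p\<^sub>i\<^sub>j\<close> gives
  \<open>(j + 1) (j + 2) E\<^sub>j\<^sub>+\<^sub>1 = (n - 1 - j) (n - j) E\<^sub>j\<close> (lemma \<open>esum_Suc\<close>); this is the relation between
  consecutive Narayana numbers. Moreover \<open>u\<^sub>n \<le> 1\<close>, and if \<open>u\<^sub>n = 1\<close> then no flow enters \<open>n\<close>; deleting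
  this vertex diminishes the other \<open>u\<^sub>l\<close> by one, so the top sum for \<open>n + 1\<close> is the sum of all \<open>E\<^sub>j\<close>
  for \<open>n\<close> (lemma \<open>esum_Suc_top\<close>), and the Narayana numbers add up to a Catalan number.
\<close>

section \<open>Elementary symmetric polynomials\<close>

definition esym :: "nat set \<Rightarrow> (nat \<Rightarrow> int) \<Rightarrow> nat \<Rightarrow> int" where
  "esym V u k = (\<Sum>T | T \<subseteq> V \<and> card T = k. \<Prod>v\<in>T. u v)"

text \<open>The value \<open>e\<^sub>k\<^sub>-\<^sub>1\<close>, with \<open>e\<^sub>-\<^sub>1 = 0\<close>, so that the recursion for \<open>e\<^sub>k\<close> needs no case distinction.\<close>

definition esym_pred :: "nat set \<Rightarrow> (nat \<Rightarrow> int) \<Rightarrow> nat \<Rightarrow> int" where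
  "esym_pred V u k = (if k = 0 then 0 else esym V u (k - 1))"

lemma esym_0 [simp]: "finite V \<Longrightarrow> esym V u 0 = 1"
proof -
  assume "finite V"
  then have "{T. T \<subseteq> V \<and> card T = 0} = {{}}"
    by (auto dest: finite_subset)
  then show ?thesis by (simp add: esym_def)
qed

lemma esym_remove:
  assumes V: "finite V" "v \<in> V"
  shows "esym V u k = u v * esym_pred (V - {v}) u k + esym (V - {v}) u k"
proof (cases k)
  case 0 then show ?thesis using V by (simp add: esym_pred_def)
next
  case (Suc l)
  let ?A = "{T. T \<subseteq> V - {v} \<and> card T = l}" and ?B = "{T. T \<subseteq> V - {v} \<and> card T = k}"
  have split: "{T. T \<subseteq> V \<and> card T = k} = insert v ` ?A \<union> ?B"
  proof (intro equalityI subsetI)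
    fix T assume T: "T \<in> {T. T \<subseteq> V \<and> card T = k}"
    show "T \<in> insert v ` ?A \<union> ?B"
    proof (cases "v \<in> T")
      case True
      then have "T = insert v (T - {v})" "T - {v} \<in> ?A"
        using T Suc by (auto simp: card_Diff_singleton)
      then show ?thesis by blast
    qed (use T in auto)
  next
    fix T assume T: "T \<in> insert v ` ?A \<union> ?B"
    then show "T \<in> {T. T \<subseteq> V \<and> card T = k}"
    proof
      assume "T \<in> insert v ` ?A"
      then obtain T' where "T = insert v T'" "T' \<subseteq> V - {v}" "card T' = l" by auto
      moreover have "finite T'" using calculation V finite_subset[of T' "V - {v}"] by auto
      moreover have "v \<notin> T'" using calculation by auto
      ultimately show ?thesis using V Suc by auto
    qed auto
  qed
  have fin: "finite ?A" "finite ?B" using V by auto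
  have inj: "inj_on (insert v) ?A" by (auto simp: inj_on_def)
  have "(\<Sum>T\<in>insert v ` ?A. \<Prod>w\<in>T. u w) = (\<Sum>T\<in>?A. u v * (\<Prod>w\<in>T. u w))"
    unfolding sum.reindex[OF inj] o_def
  proof (rule sum.cong[OF refl])
    fix T assume "T \<in> ?A"
    then have "finite T" "v \<notin> T" using V finite_subset[of T "V - {v}"] by auto
    then show "prod u (insert v T) = u v * prod u T" by simp
  qed
  moreover have "insert v ` ?A \<inter> ?B = {}" by auto
  ultimately show ?thesis
    unfolding esym_def split using Suc fin
    by (simp add: sum.union_disjoint sum_distrib_left esym_pred_def esym_def)
qed

text \<open>A monomial of degree \<open>k\<close> arises once from each of its \<open>k\<close> variables.\<close>

lemma sum_esym_remove_mult:
  assumes "finite V"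
  shows "(\<Sum>v\<in>V. u v * esym_pred (V - {v}) u k) = int k * esym V u k"
  using assms
proof -
  have "u v * esym_pred (V - {v}) u k = (\<Sum>T | T \<subseteq> V \<and> card T = k. if v \<in> T then prod u T else 0)"
    if "v \<in> V" for v
  proof -
    have "(\<Sum>T | T \<subseteq> V \<and> card T = k. if v \<in> T then prod u T else 0) =
          esym V u k - (\<Sum>T | T \<subseteq> V \<and> card T = k. if v \<notin> T then prod u T else 0)"
      unfolding esym_def sum_subtractf[symmetric] by (rule sum.cong) auto
    also have "(\<Sum>T | T \<subseteq> V \<and> card T = k. if v \<notin> T then prod u T else 0) = esym (V - {v}) u k"
      unfolding esym_def using assms by (intro sum.mono_neutral_cong_right) auto
    finally show ?thesis using esym_remove[OF assms that, of u k] by simp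
  qed
  then have "(\<Sum>v\<in>V. u v * esym_pred (V - {v}) u k) =
        (\<Sum>v\<in>V. \<Sum>T | T \<subseteq> V \<and> card T = k. if v \<in> T then prod u T else 0)"
    by (rule sum.cong[OF refl])
  also have "\<dots> = (\<Sum>T | T \<subseteq> V \<and> card T = k. \<Sum>v\<in>V. if v \<in> T then prod u T else 0)"
    by (rule sum.swap)
  also have "\<dots> = (\<Sum>T | T \<subseteq> V \<and> card T = k. int k * prod u T)"
  proof (rule sum.cong[OF refl])
    fix T assume "T \<in> {T. T \<subseteq> V \<and> card T = k}"
    then have "V \<inter> T = T" "card T = k" by auto
    then show "(\<Sum>v\<in>V. if v \<in> T then prod u T else 0) = int k * prod u T"
      using assms by (simp add: sum.inter_restrict[symmetric])
  qed
  finally show ?thesis by (simp add: esym_def sum_distrib_left)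
qed

text \<open>A monomial of degree \<open>k\<close> survives the removal of each variable that it does not contain.\<close>

lemma sum_esym_remove:
  assumes "finite V"
  shows "(\<Sum>v\<in>V. esym (V - {v}) u k) = (int (card V) - int k) * esym V u k"
proof -
  have "(\<Sum>v\<in>V. esym (V - {v}) u k) = (\<Sum>v\<in>V. esym V u k - u v * esym_pred (V - {v}) u k)"
    by (rule sum.cong[OF refl]) (simp add: esym_remove[OF assms])
  also have "\<dots> = int (card V) * esym V u k - int k * esym V u k"
    by (simp add: sum_subtractf sum_esym_remove_mult[OF assms])
  finally show ?thesis by (simp add: algebra_simps)
qed

lemma sum_esym_all:
  assumes "finite V"
  shows "(\<Sum>k\<le>card V. esym V u k) = (\<Prod>v\<in>V. 1 + u v)"
proof -
  have "(\<Prod>v\<in>V. u v + 1) = (\<Sum>T\<in>Pow V. prod u T)"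
    using prod_add[OF assms, of u "\<lambda>_. 1"] by simp
  also have "\<dots> = (\<Sum>k\<le>card V. \<Sum>T\<in>{T\<in>Pow V. card T = k}. prod u T)"
    using assms by (intro sum.group[symmetric]) (auto intro: card_mono)
  finally show ?thesis by (simp add: esym_def add.commute)
qed

lemma esym_full: "finite V \<Longrightarrow> esym V u (card V) = prod u V"
proof -
  assume "finite V"
  then have "{T. T \<subseteq> V \<and> card T = card V} = {V}" using card_subset_eq by blast
  then show ?thesis by (simp add: esym_def)
qed

section \<open>A sum over feasible flows\<close>

definition pairs :: "nat \<Rightarrow> (nat \<times> nat) set" where
  "pairs n = {(i, j). 2 \<le> i \<and> i < j \<and> j \<le> n}"

text \<open>What remains at vertex \<open>v\<close> of a supply of \<open>n + 1 - v\<close> units when \<open>p\<close> is run against the direction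
  of the edges, from large vertices to small ones.\<close>

definition excess :: "nat \<Rightarrow> (nat \<times> nat \<Rightarrow> nat) \<Rightarrow> nat \<Rightarrow> int" where
  "excess n p v = int n + 1 - int v + (\<Sum>e | e \<in> pairs n \<and> fst e = v. int (p e))
                   - (\<Sum>e | e \<in> pairs n \<and> snd e = v. int (p e))"

definition feasible :: "nat \<Rightarrow> (nat \<times> nat \<Rightarrow> nat) set" where
  "feasible n = {p \<in> pairs n \<rightarrow>\<^sub>E UNIV. \<forall>v\<in>{2..n}. 0 \<le> excess n p v}"

lemma finite_pairs [simp]: "finite (pairs n)"
  by (rule finite_subset[of _ "{..n} \<times> {..n}"]) (auto simp: pairs_def)

text \<open>Double counting: an edge contributes to the excess of its two ends with opposite signs.\<close>

lemma sum_excess_mult: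
  "(\<Sum>v\<in>{2..n}. w v * excess n p v) =
   (\<Sum>v\<in>{2..n}. w v * (int n + 1 - int v)) + (\<Sum>e\<in>pairs n. (w (fst e) - w (snd e)) * int (p e))"
proof -
  have *: "(\<Sum>v\<in>{2..n}. w v * (\<Sum>e | e \<in> pairs n \<and> f e = v. int (p e))) = (\<Sum>e\<in>pairs n. w (f e) * int (p e))"
    if "\<And>e. e \<in> pairs n \<Longrightarrow> f e \<in> {2..n}" for f
  proof -
    have "(\<Sum>v\<in>{2..n}. w v * (\<Sum>e | e \<in> pairs n \<and> f e = v. int (p e))) =
          (\<Sum>v\<in>{2..n}. \<Sum>e\<in>{e\<in>pairs n. f e = v}. w (f e) * int (p e))"
      by (auto simp: sum_distrib_left intro!: sum.cong)
    also have "\<dots> = (\<Sum>e\<in>pairs n. w (f e) * int (p e))"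
      using that by (intro sum.group) auto
    finally show ?thesis .
  qed
  have 1: "(\<Sum>v\<in>{2..n}. w v * (\<Sum>e | e \<in> pairs n \<and> fst e = v. int (p e))) = (\<Sum>e\<in>pairs n. w (fst e) * int (p e))"
    by (rule *) (auto simp: pairs_def)
  have 2: "(\<Sum>v\<in>{2..n}. w v * (\<Sum>e | e \<in> pairs n \<and> snd e = v. int (p e))) = (\<Sum>e\<in>pairs n. w (snd e) * int (p e))"
    by (rule *) (auto simp: pairs_def)
  show ?thesis
    unfolding left_diff_distrib sum_subtractf 1[symmetric] 2[symmetric] excess_def
    by (simp add: sum.distrib sum_subtractf algebra_simps)
qed

text \<open>The weights \<open>v\<close> in the sum of the excesses make every edge contribute at least its own flow, with
  negative sign, so a nonnegative sum bounds the flow.\<close>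

lemma finite_feasible [simp]: "finite (feasible n)"
proof -
  define B where "B = (\<Sum>v\<in>{2..n}. int v * (int n + 1 - int v))"
  \<comment> \<open>The constant \<open>B\<close> is the weighted sum of the excesses of the zero flow.\<close>
  have bound: "p e \<le> nat B" if p: "p \<in> feasible n" and e: "e \<in> pairs n" for p e
  proof -
    have "0 \<le> (\<Sum>v\<in>{2..n}. int v * excess n p v)"
      using p by (intro sum_nonneg) (auto simp: feasible_def)
    also have "\<dots> = B - (\<Sum>e\<in>pairs n. (int (snd e) - int (fst e)) * int (p e))"
      unfolding sum_excess_mult B_def by (simp add: sum_negf[symmetric] algebra_simps sum_subtractf)
    finally have "(\<Sum>e\<in>pairs n. (int (snd e) - int (fst e)) * int (p e)) \<le> B"
      by simp
    moreover have "(int (snd e) - int (fst e)) * int (p e) \<le> (\<Sum>e\<in>pairs n. (int (snd e) - int (fst e)) * int (p e))"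
      using e by (intro member_le_sum finite_pairs) (auto simp: pairs_def)
    moreover have "1 * int (p e) \<le> (int (snd e) - int (fst e)) * int (p e)"
      using e by (intro mult_right_mono) (auto simp: pairs_def)
    ultimately show ?thesis by linarith
  qed
  have "feasible n \<subseteq> pairs n \<rightarrow>\<^sub>E {..nat B}"
    using bound by (auto simp: feasible_def PiE_iff extensional_def)
  then show ?thesis by (rule finite_subset) (auto intro: finite_PiE)
qed

lemma excess_fun_upd:
  assumes e: "e \<in> pairs n"
  shows "excess n (p(e := t)) v =
    excess n p v + (if v = fst e then int t - int (p e) else 0) - (if v = snd e then int t - int (p e) else 0)"
proof -
  have *: "(\<Sum>d | d \<in> pairs n \<and> f d = v. int ((p(e := t)) d)) =
    (\<Sum>d | d \<in> pairs n \<and> f d = v. int (p d)) + (if v = f e then int t - int (p e) else 0)" for f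
  proof -
    have "(\<Sum>d | d \<in> pairs n \<and> f d = v. int ((p(e := t)) d)) =
      (\<Sum>d | d \<in> pairs n \<and> f d = v. int (p d) + (if d = e then int t - int (p e) else 0))"
      by (rule sum.cong) auto
    then show ?thesis using e by (simp add: sum.distrib sum.delta)
  qed
  show ?thesis unfolding excess_def * by simp
qed

text \<open>Summation by parts in the variable \<open>t = p (i, j)\<close>. Raising \<open>t\<close> by one raises \<open>u\<^sub>i\<close> and lowers \<open>u\<^sub>j\<close>,
  so \<open>u\<^sub>j - u\<^sub>i\<close> is the forward difference of \<open>(u\<^sub>j + 1) u\<^sub>i\<close>. There are no boundary terms, since
  \<open>t (u\<^sub>j + 1) u\<^sub>i\<close> vanishes at both ends of the feasible range. This is the discrete counterpart of
  the fact that a total derivative integrates to zero.\<close>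

lemma sum_feasible_by_parts:
  assumes e: "(i, j) \<in> pairs n"
    and h: "\<And>p t. h (p((i, j) := t)) = (h p :: int)"
  shows "(\<Sum>p\<in>feasible n. int (p (i, j)) * (excess n p j - excess n p i) * h p) =
       - (\<Sum>p\<in>feasible n. excess n p j * (excess n p i + 1) * h p)"
proof -
  define up where "up p = p((i, j) := p (i, j) + 1)" for p :: "nat \<times> nat \<Rightarrow> nat"
  define \<Psi> where "\<Psi> p = int (p (i, j)) * (excess n p j + 1) * excess n p i * h p" for p
  have ij: "i \<in> {2..n}" "j \<in> {2..n}" "i \<noteq> j" using e by (auto simp: pairs_def)
  have up_excess: "excess n (up p) v = excess n p v + (if v = i then 1 else 0) - (if v = j then 1 else 0)" for p v
    unfolding up_def excess_fun_upd[OF e] by simp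
  have up_ij: "up p (i, j) = p (i, j) + 1" and up_h: "h (up p) = h p" for p
    unfolding up_def by (simp_all add: h)
  have inj: "inj_on up (feasible n)"
  proof (rule inj_onI)
    fix p q assume eq: "up p = up q"
    show "p = q"
    proof
      fix d show "p d = q d" using fun_cong[OF eq, of d] by (auto simp: up_def split: if_splits)
    qed
  qed
  have ext: "up p \<in> pairs n \<rightarrow>\<^sub>E UNIV \<longleftrightarrow> p \<in> pairs n \<rightarrow>\<^sub>E UNIV" for p
    using e by (auto simp: up_def PiE_iff extensional_def)
  \<comment> \<open>The lower end of the range: \<open>t = 0\<close>, or \<open>u\<^sub>i = 0\<close> and \<open>t\<close> cannot be lowered.\<close>
  have zero1: "\<Psi> q = 0" if q: "q \<in> feasible n - up ` feasible n" for q
  proof (cases "q (i, j) = 0")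
    case False
    define p where "p = q((i, j) := q (i, j) - 1)"
    have qp: "q = up p" using False by (auto simp: up_def p_def)
    then have "p \<notin> feasible n" using q by auto
    moreover have "p \<in> pairs n \<rightarrow>\<^sub>E UNIV" using q ext[of p] qp by (auto simp: feasible_def)
    ultimately obtain v where v: "v \<in> {2..n}" "excess n p v < 0" by (auto simp: feasible_def)
    then have "excess n q v \<ge> 0" using q by (auto simp: feasible_def)
    then have "v = i \<and> excess n q i = 0"
      using v up_excess[of p v] ij unfolding qp by (auto split: if_splits)
    then show ?thesis by (simp add: \<Psi>_def)
  qed (simp add: \<Psi>_def)
  \<comment> \<open>Just beyond the upper end of the range, where \<open>u\<^sub>j\<close> has dropped to \<open>-1\<close>.\<close>
  have zero2: "\<Psi> q = 0" if q: "q \<in> up ` feasible n - feasible n" for q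
  proof -
    obtain p where p: "p \<in> feasible n" "q = up p" using q by auto
    have "q \<in> pairs n \<rightarrow>\<^sub>E UNIV" using p ext by (auto simp: feasible_def)
    then obtain v where v: "v \<in> {2..n}" "excess n q v < 0" using q by (auto simp: feasible_def)
    have "excess n p v \<ge> 0" using p v by (auto simp: feasible_def)
    then have "v = j \<and> excess n q j = -1"
      using v up_excess[of p v] ij unfolding p by (auto split: if_splits)
    then show ?thesis by (simp add: \<Psi>_def)
  qed
  have "(\<Sum>p\<in>feasible n. \<Psi> (up p)) = (\<Sum>q\<in>up ` feasible n. \<Psi> q)"
    using inj by (simp add: sum.reindex)
  also have "\<dots> = (\<Sum>q\<in>up ` feasible n \<inter> feasible n. \<Psi> q)"
    using zero2 by (intro sum.mono_neutral_right) auto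
  also have "\<dots> = (\<Sum>q\<in>feasible n. \<Psi> q)"
    using zero1 by (intro sum.mono_neutral_left) auto
  finally have "(\<Sum>p\<in>feasible n. \<Psi> (up p) - \<Psi> p) = 0" by (simp add: sum_subtractf)
  also have "(\<Sum>p\<in>feasible n. \<Psi> (up p) - \<Psi> p) =
    (\<Sum>p\<in>feasible n. int (p (i, j)) * (excess n p j - excess n p i) * h p + excess n p j * (excess n p i + 1) * h p)"
    using ij by (intro sum.cong refl) (simp add: \<Psi>_def up_excess up_ij up_h algebra_simps)
  finally show ?thesis by (simp add: sum.distrib)
qed

definition esum :: "nat \<Rightarrow> nat \<Rightarrow> int" where
  "esum n k = (\<Sum>p\<in>feasible n. esym {2..n} (excess n p) k)"

lemma esym_cong: "(\<And>v. v \<in> V \<Longrightarrow> u v = w v) \<Longrightarrow> esym V u k = esym V w k"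
  unfolding esym_def by (intro sum.cong prod.cong) auto

lemma esym_pred_cong: "(\<And>v. v \<in> V \<Longrightarrow> u v = w v) \<Longrightarrow> esym_pred V u k = esym_pred V w k"
  unfolding esym_pred_def using esym_cong by metis

lemma sum_pairs_symmetric:
  fixes s :: "nat \<Rightarrow> nat \<Rightarrow> int"
  assumes "\<And>i j. s i j = s j i"
  shows "2 * (\<Sum>(i, j)\<in>pairs n. s i j) = (\<Sum>i\<in>{2..n}. \<Sum>j\<in>{2..n} - {i}. s i j)"
proof -
  have "(\<Sum>i\<in>{2..n}. \<Sum>j\<in>{2..n} - {i}. s i j) = (\<Sum>(i, j)\<in>Sigma {2..n} (\<lambda>i. {2..n} - {i}). s i j)"
    by (intro sum.Sigma) auto
  also have "Sigma {2..n} (\<lambda>i. {2..n} - {i}) = pairs n \<union> prod.swap ` pairs n"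
    by (auto simp: pairs_def image_iff)
  also have "(\<Sum>(i, j)\<in>pairs n \<union> prod.swap ` pairs n. s i j) =
             (\<Sum>(i, j)\<in>pairs n. s i j) + (\<Sum>(i, j)\<in>prod.swap ` pairs n. s i j)"
    by (intro sum.union_disjoint finite_imageI finite_pairs) (auto simp: pairs_def)
  also have "(\<Sum>(i, j)\<in>prod.swap ` pairs n. s i j) = (\<Sum>(i, j)\<in>pairs n. s j i)"
    by (subst sum.reindex) (auto simp: case_prod_unfold)
  also have "\<dots> = (\<Sum>(i, j)\<in>pairs n. s i j)" using assms by (intro sum.cong) auto
  finally show ?thesis by simp
qed

lemma sum_pairs_fst:
  "(\<Sum>(i, j)\<in>pairs n. (f i :: int)) = (\<Sum>i\<in>{2..n}. (int n - int i) * f i)"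
proof -
  have "(\<Sum>(i, j)\<in>pairs n. f i) = (\<Sum>(i, j)\<in>Sigma {2..n} (\<lambda>i. {i<..n}). f i)"
    by (intro sum.cong) (auto simp: pairs_def)
  also have "\<dots> = (\<Sum>i\<in>{2..n}. \<Sum>j\<in>{i<..n}. f i)" by (intro sum.Sigma[symmetric]) auto
  also have "\<dots> = (\<Sum>i\<in>{2..n}. (int n - int i) * f i)"
    by (intro sum.cong) (auto simp: of_nat_diff)
  finally show ?thesis .
qed

text \<open>The discrete Aomoto recursion. Write \<open>(k + 1) e\<^sub>k\<^sub>+\<^sub>1\<close> as the sum of \<open>u\<^sub>v e\<^sub>k(u without v)\<close> and expand the
  factor \<open>u\<^sub>v\<close> by definition. The flow \<open>p (i, j)\<close> then occurs with the coefficient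
  \<open>e\<^sub>k(u without i) - e\<^sub>k(u without j) = (u\<^sub>j - u\<^sub>i) e\<^sub>k\<^sub>-\<^sub>1(u without i, j)\<close>, to which summation by parts
  applies. Afterwards all terms are symmetric in \<open>u\<close> and can be collected as multiples of \<open>e\<^sub>k\<close> and
  \<open>e\<^sub>k\<^sub>+\<^sub>1\<close>.\<close>

lemma esum_Suc:
  assumes "1 \<le> n"
  shows "(int k + 1) * (int k + 2) * esum n (Suc k) = (int n - 1 - int k) * (int n - int k) * esum n k"
proof -
  let ?V = "{2..n}" and ?F = "feasible n"
  let ?u = "\<lambda>p. excess n p"
  \<comment> \<open>The two symmetric sums over pairs into which summation by parts turns the flow terms.\<close>
  define M where "M p = (\<Sum>(i, j)\<in>pairs n. esym (?V - {i} - {j}) (?u p) k)" for p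
  define N where "N p = (\<Sum>(i, j)\<in>pairs n. ?u p i * ?u p j * esym_pred (?V - {i} - {j}) (?u p) k)" for p
  have fin: "finite ?V" and card: "int (card ?V) = int n - 1" using assms by auto
  have comm: "?V - {i} - {j} = ?V - {j} - {i}" for i j by auto
  have M: "2 * M p = (int n - 1 - int k) * (int n - 2 - int k) * esym ?V (?u p) k" for p
  proof -
    have "2 * M p = (\<Sum>i\<in>?V. \<Sum>j\<in>?V - {i}. esym (?V - {i} - {j}) (?u p) k)"
      unfolding M_def by (rule sum_pairs_symmetric) (simp add: comm)
    also have "\<dots> = (\<Sum>i\<in>?V. (int n - 2 - int k) * esym (?V - {i}) (?u p) k)"
      by (intro sum.cong refl, subst sum_esym_remove) (auto simp: of_nat_diff)
    also have "\<dots> = (int n - 2 - int k) * ((int n - 1 - int k) * esym ?V (?u p) k)"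
      unfolding sum_distrib_left[symmetric] using sum_esym_remove[OF fin] assms by simp
    finally show ?thesis by simp
  qed
  have N: "2 * N p = int k * (int k + 1) * esym ?V (?u p) (Suc k)" for p
  proof -
    have "2 * N p = (\<Sum>i\<in>?V. \<Sum>j\<in>?V - {i}. ?u p i * ?u p j * esym_pred (?V - {i} - {j}) (?u p) k)"
      unfolding N_def by (rule sum_pairs_symmetric) (simp add: comm)
    also have "\<dots> = (\<Sum>i\<in>?V. ?u p i * (int k * esym (?V - {i}) (?u p) k))"
      using fin by (simp add: mult.assoc sum_distrib_left[symmetric] sum_esym_remove_mult)
    also have "\<dots> = int k * (\<Sum>i\<in>?V. ?u p i * esym_pred (?V - {i}) (?u p) (Suc k))"
      by (simp add: sum_distrib_left esym_pred_def algebra_simps)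
    also have "\<dots> = int k * ((int k + 1) * esym ?V (?u p) (Suc k))"
      unfolding sum_esym_remove_mult[OF fin] by simp
    finally show ?thesis by simp
  qed
  have expand: "(int k + 1) * esym ?V (?u p) (Suc k) =
      (\<Sum>v\<in>?V. (int n + 1 - int v) * esym (?V - {v}) (?u p) k) +
      (\<Sum>(i, j)\<in>pairs n. int (p (i, j)) * (?u p j - ?u p i) * esym_pred (?V - {i} - {j}) (?u p) k)" for p
  proof -
    have "(int k + 1) * esym ?V (?u p) (Suc k) = (\<Sum>v\<in>?V. esym (?V - {v}) (?u p) k * ?u p v)"
      using sum_esym_remove_mult[OF fin, of "?u p" "Suc k"] by (simp add: esym_pred_def algebra_simps)
    also have "\<dots> = (\<Sum>v\<in>?V. esym (?V - {v}) (?u p) k * (int n + 1 - int v)) +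
      (\<Sum>e\<in>pairs n. (esym (?V - {fst e}) (?u p) k - esym (?V - {snd e}) (?u p) k) * int (p e))"
      by (rule sum_excess_mult)
    also have "(\<Sum>e\<in>pairs n. (esym (?V - {fst e}) (?u p) k - esym (?V - {snd e}) (?u p) k) * int (p e)) =
      (\<Sum>(i, j)\<in>pairs n. int (p (i, j)) * (?u p j - ?u p i) * esym_pred (?V - {i} - {j}) (?u p) k)"
    proof (rule sum.cong[OF refl], clarify)
      fix i j assume "(i, j) \<in> pairs n"
      then have ij: "j \<in> ?V - {i}" "i \<in> ?V - {j}" by (auto simp: pairs_def)
      show "(esym (?V - {fst (i, j)}) (?u p) k - esym (?V - {snd (i, j)}) (?u p) k) * int (p (i, j)) =
        int (p (i, j)) * (?u p j - ?u p i) * esym_pred (?V - {i} - {j}) (?u p) k"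
        using esym_remove[OF _ ij(1), of "?u p" k] esym_remove[OF _ ij(2), of "?u p" k] comm[of i j]
        by (simp add: algebra_simps)
    qed
    finally show ?thesis by (simp add: mult.commute)
  qed
  have parts: "(\<Sum>p\<in>?F. \<Sum>(i, j)\<in>pairs n. int (p (i, j)) * (?u p j - ?u p i) * esym_pred (?V - {i} - {j}) (?u p) k)
     = - (\<Sum>p\<in>?F. \<Sum>(i, j)\<in>pairs n. ?u p j * (?u p i + 1) * esym_pred (?V - {i} - {j}) (?u p) k)"
  proof -
    have "(\<Sum>p\<in>?F. \<Sum>(i, j)\<in>pairs n. int (p (i, j)) * (?u p j - ?u p i) * esym_pred (?V - {i} - {j}) (?u p) k)
      = (\<Sum>(i, j)\<in>pairs n. \<Sum>p\<in>?F. int (p (i, j)) * (?u p j - ?u p i) * esym_pred (?V - {i} - {j}) (?u p) k)"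
      by (subst sum.swap) (simp add: case_prod_unfold)
    also have "\<dots> = (\<Sum>(i, j)\<in>pairs n. - (\<Sum>p\<in>?F. ?u p j * (?u p i + 1) * esym_pred (?V - {i} - {j}) (?u p) k))"
    proof (rule sum.cong[OF refl], clarify)
      fix i j assume e: "(i, j) \<in> pairs n"
      show "(\<Sum>p\<in>?F. int (p (i, j)) * (?u p j - ?u p i) * esym_pred (?V - {i} - {j}) (?u p) k) =
        - (\<Sum>p\<in>?F. ?u p j * (?u p i + 1) * esym_pred (?V - {i} - {j}) (?u p) k)"
        by (rule sum_feasible_by_parts[OF e], rule esym_pred_cong) (simp add: excess_fun_upd[OF e])
    qed
    also have "\<dots> = - (\<Sum>p\<in>?F. \<Sum>(i, j)\<in>pairs n. ?u p j * (?u p i + 1) * esym_pred (?V - {i} - {j}) (?u p) k)"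
      by (subst sum.swap) (simp add: case_prod_unfold sum_negf)
    finally show ?thesis .
  qed
  have collect: "(\<Sum>(i, j)\<in>pairs n. ?u p j * (?u p i + 1) * esym_pred (?V - {i} - {j}) (?u p) k) =
      N p + (\<Sum>i\<in>?V. (int n - int i) * esym (?V - {i}) (?u p) k) - M p" for p
  proof -
    have "(\<Sum>(i, j)\<in>pairs n. ?u p j * (?u p i + 1) * esym_pred (?V - {i} - {j}) (?u p) k) =
      (\<Sum>(i, j)\<in>pairs n. ?u p i * ?u p j * esym_pred (?V - {i} - {j}) (?u p) k +
         (esym (?V - {i}) (?u p) k - esym (?V - {i} - {j}) (?u p) k))"
    proof (rule sum.cong[OF refl], clarify)
      fix i j assume "(i, j) \<in> pairs n"
      then have "j \<in> ?V - {i}" by (auto simp: pairs_def)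
      from esym_remove[OF _ this, of "?u p" k]
      show "?u p j * (?u p i + 1) * esym_pred (?V - {i} - {j}) (?u p) k =
        ?u p i * ?u p j * esym_pred (?V - {i} - {j}) (?u p) k +
         (esym (?V - {i}) (?u p) k - esym (?V - {i} - {j}) (?u p) k)" by (simp add: algebra_simps)
    qed
    also have "\<dots> = N p + ((\<Sum>(i, j)\<in>pairs n. esym (?V - {i}) (?u p) k) - M p)"
      unfolding N_def M_def by (simp add: case_prod_unfold sum.distrib sum_subtractf)
    finally show ?thesis by (simp add: sum_pairs_fst)
  qed
  have "(int k + 1) * esum n (Suc k) = (\<Sum>p\<in>?F. (int k + 1) * esym ?V (?u p) (Suc k))"
    by (simp add: esum_def sum_distrib_left)
  also have "\<dots> = (\<Sum>p\<in>?F. (\<Sum>v\<in>?V. (int n + 1 - int v) * esym (?V - {v}) (?u p) k) -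
       (N p + (\<Sum>i\<in>?V. (int n - int i) * esym (?V - {i}) (?u p) k) - M p))"
    unfolding expand sum.distrib parts collect by (simp add: sum_subtractf)
  also have "\<dots> = (\<Sum>p\<in>?F. (int n - 1 - int k) * esym ?V (?u p) k + M p - N p)"
  proof (rule sum.cong[OF refl])
    fix p
    have "(\<Sum>v\<in>?V. (int n + 1 - int v) * esym (?V - {v}) (?u p) k) =
      (\<Sum>v\<in>?V. (int n - int v) * esym (?V - {v}) (?u p) k) + (int n - 1 - int k) * esym ?V (?u p) k"
      using sum_esym_remove[OF fin, of "?u p" k] unfolding card
      by (simp add: algebra_simps sum.distrib sum_subtractf)
    then show "(\<Sum>v\<in>?V. (int n + 1 - int v) * esym (?V - {v}) (?u p) k) -
       (N p + (\<Sum>i\<in>?V. (int n - int i) * esym (?V - {i}) (?u p) k) - M p) =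
       (int n - 1 - int k) * esym ?V (?u p) k + M p - N p" by simp
  qed
  finally have "2 * ((int k + 1) * esum n (Suc k)) =
    (\<Sum>p\<in>?F. 2 * (int n - 1 - int k) * esym ?V (?u p) k + 2 * M p - 2 * N p)"
    by (simp add: sum_distrib_left algebra_simps)
  also have "\<dots> = 2 * (int n - 1 - int k) * esum n k + (int n - 1 - int k) * (int n - 2 - int k) * esum n k
       - int k * (int k + 1) * esum n (Suc k)"
    unfolding M N esum_def by (simp add: sum.distrib sum_subtractf sum_distrib_left)
  finally show ?thesis by algebra
qed

text \<open>The last vertex has a supply of one unit and loses whatever enters it.\<close>

lemma excess_restrict:
  assumes p: "p \<in> feasible (Suc n)" and n: "1 \<le> n" and top: "excess (Suc n) p (Suc n) \<noteq> 0"
  shows "\<And>i. (i, Suc n) \<in> pairs (Suc n) \<Longrightarrow> p (i, Suc n) = 0" and "excess (Suc n) p (Suc n) = 1"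
proof -
  have "{e \<in> pairs (Suc n). fst e = Suc n} = {}" by (auto simp: pairs_def)
  then have 1: "excess (Suc n) p (Suc n) = 1 - (\<Sum>e | e \<in> pairs (Suc n) \<and> snd e = Suc n. int (p e))"
    unfolding excess_def by (simp only: sum.empty)
  have nonneg: "excess (Suc n) p (Suc n) \<ge> 0" using p n by (auto simp: feasible_def)
  have "(\<Sum>e | e \<in> pairs (Suc n) \<and> snd e = Suc n. int (p e)) \<ge> 0" by (intro sum_nonneg) auto
  then have 2: "(\<Sum>e | e \<in> pairs (Suc n) \<and> snd e = Suc n. int (p e)) = 0"
    using 1 nonneg top by linarith
  then show "excess (Suc n) p (Suc n) = 1" using 1 by simp
  have fin: "finite {e \<in> pairs (Suc n). snd e = Suc n}" by simp
  show "p (i, Suc n) = 0" if "(i, Suc n) \<in> pairs (Suc n)" for i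
    using 2 that by (subst (asm) sum_nonneg_eq_0_iff[OF fin]) auto
qed

text \<open>In the product of all excesses only those \<open>p\<close> count for which nothing enters the last vertex. They
  are extensions by zero of flows on one vertex fewer, whose supplies are smaller by one; so the
  product becomes that of the \<open>1 + u\<^sub>v\<close>, which is the sum of all elementary symmetric polynomials.\<close>

lemma esum_Suc_top:
  assumes n: "1 \<le> n"
  shows "esum (Suc n) n = (\<Sum>k<n. esum n k)"
proof -
  define ext :: "(nat \<times> nat \<Rightarrow> nat) \<Rightarrow> nat \<times> nat \<Rightarrow> nat" where
    "ext p = (\<lambda>e. if e \<in> pairs (Suc n) \<and> snd e = Suc n then 0 else p e)" for p
  have pairs_Suc: "pairs n \<subseteq> pairs (Suc n)" by (auto simp: pairs_def)
  have old: "e \<in> pairs (Suc n) \<Longrightarrow> snd e \<noteq> Suc n \<Longrightarrow> e \<in> pairs n" for e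
    by (auto simp: pairs_def)
  have new: "e \<in> pairs n \<Longrightarrow> snd e \<noteq> Suc n" for e by (auto simp: pairs_def)
  have ext_excess: "excess (Suc n) (ext p) v = (if v = Suc n then 1 else excess n p v + 1)" if "v \<le> Suc n" for p v
  proof -
    have "(\<Sum>e | e \<in> pairs (Suc n) \<and> f e = v. int (ext p e)) = (\<Sum>e | e \<in> pairs n \<and> f e = v. int (p e))" for f
    proof (rule sum.mono_neutral_cong_right)
      show "{e \<in> pairs n. f e = v} \<subseteq> {e \<in> pairs (Suc n). f e = v}" using pairs_Suc by auto
    qed (auto simp: ext_def dest: old new)
    note * = this
    show ?thesis
    proof (cases "v = Suc n")
      case True
      then have "{e \<in> pairs n. fst e = v} = {}" "{e \<in> pairs n. snd e = v} = {}" by (auto simp: pairs_def)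
      then show ?thesis unfolding excess_def * using True by (simp only: sum.empty) simp
    qed (simp add: excess_def *)
  qed
  have range: "{2..Suc n} = insert (Suc n) {2..n}" using n by auto
  define W where "W = {p \<in> feasible (Suc n). (\<Prod>v\<in>{2..Suc n}. excess (Suc n) p v) \<noteq> 0}"
  \<comment> \<open>A flow for \<open>n + 1\<close> with excess \<open>0\<close> at some \<open>v \<le> n\<close> restricts to one with excess \<open>-1\<close>, which is not
    feasible for \<open>n\<close>; it contributes zero to the sum and does not belong to \<open>W\<close>.\<close>
  have bij: "bij_betw ext (feasible n) W"
  proof (rule bij_betwI[where g = "\<lambda>p. restrict p (pairs n)"])
    show "ext \<in> feasible n \<rightarrow> W"
    proof
      fix p assume p: "p \<in> feasible n"
      then have p_ext: "p \<in> pairs n \<rightarrow>\<^sub>E UNIV" and ge: "\<And>v. v \<in> {2..n} \<Longrightarrow> excess n p v \<ge> 0"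
        by (auto simp: feasible_def)
      have "0 < (\<Prod>v\<in>{2..n}. 1 + excess n p v)" using ge by (intro prod_pos) force
      then have nz: "(\<Prod>v\<in>{2..n}. 1 + excess n p v) \<noteq> 0" by linarith
      have "ext p \<in> pairs (Suc n) \<rightarrow>\<^sub>E UNIV"
        using p_ext old by (auto simp: ext_def PiE_iff extensional_def)
          (use pairs_Suc in blast)
      moreover have "excess (Suc n) (ext p) v \<ge> 0" if "v \<in> {2..Suc n}" for v
        using that ge[of v] by (simp add: ext_excess)
      moreover have "(\<Prod>v\<in>{2..Suc n}. excess (Suc n) (ext p) v) = (\<Prod>v\<in>{2..n}. 1 + excess n p v)"
        unfolding range by (subst prod.insert) (auto simp: ext_excess intro!: prod.cong)
      ultimately show "ext p \<in> W" using nz by (auto simp: W_def feasible_def)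
    qed
  next
    have top: "excess (Suc n) p (Suc n) \<noteq> 0" if "p \<in> W" for p
      using that unfolding W_def range by (simp add: range)
    have ext_restrict: "ext (restrict p (pairs n)) = p" if p: "p \<in> W" for p
    proof
      fix e
      have pf: "p \<in> feasible (Suc n)" using p by (simp add: W_def)
      have ext0: "p e = undefined" if "e \<notin> pairs (Suc n)"
        using pf that by (cases e) (auto simp: feasible_def PiE_iff extensional_def)
      have "p e = 0" if "e \<in> pairs (Suc n)" "snd e = Suc n"
        using excess_restrict(1)[OF pf n top[OF p], of "fst e"] that by (cases e) auto
      then show "ext (restrict p (pairs n)) e = p e"
        using ext0 old[of e] pairs_Suc by (cases "e \<in> pairs (Suc n)") (auto simp: ext_def restrict_def)
    qed
    show "(\<lambda>p. restrict p (pairs n)) \<in> W \<rightarrow> feasible n"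
    proof
      fix p assume p: "p \<in> W"
      let ?r = "restrict p (pairs n)"
      have eq: "excess n ?r v = excess (Suc n) p v - 1" if "v \<in> {2..n}" for v
        using ext_excess[of v ?r] that unfolding ext_restrict[OF p] by simp
      have prod: "(\<Prod>v\<in>{2..n}. excess (Suc n) p v) \<noteq> 0" and ge: "\<And>v. v \<in> {2..n} \<Longrightarrow> excess (Suc n) p v \<ge> 0"
        using p unfolding W_def range by (auto simp: feasible_def)
      then have pos: "excess (Suc n) p v > 0" if "v \<in> {2..n}" for v
        using ge[OF that] that by (force simp: prod_zero_iff)
      have "0 \<le> excess n ?r v" if "v \<in> {2..n}" for v using pos[OF that] eq[OF that] by linarith
      then show "?r \<in> feasible n" by (auto simp: feasible_def)
    qed
    show "restrict (ext p) (pairs n) = p" if "p \<in> feasible n" for p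
    proof
      fix e show "restrict (ext p) (pairs n) e = p e"
        using that new[of e] by (cases e) (auto simp: feasible_def ext_def PiE_iff extensional_def)
    qed
    show "ext (restrict p (pairs n)) = p" if "p \<in> W" for p by (rule ext_restrict[OF that])
  qed
  have "n = card {2..Suc n}" by simp
  then have "esum (Suc n) n = (\<Sum>p\<in>feasible (Suc n). \<Prod>v\<in>{2..Suc n}. excess (Suc n) p v)"
    unfolding esum_def using esym_full[of "{2..Suc n}"] by (metis finite_atLeastAtMost)
  also have "\<dots> = (\<Sum>p\<in>W. \<Prod>v\<in>{2..Suc n}. excess (Suc n) p v)"
    by (rule sum.mono_neutral_right) (auto simp: W_def)
  also have "\<dots> = (\<Sum>p\<in>feasible n. \<Prod>v\<in>{2..Suc n}. excess (Suc n) (ext p) v)"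
    by (rule sum.reindex_bij_betw[OF bij, symmetric])
  also have "\<dots> = (\<Sum>p\<in>feasible n. \<Prod>v\<in>{2..n}. 1 + excess n p v)"
    unfolding range by (intro sum.cong refl, subst prod.insert) (auto simp: ext_excess intro!: prod.cong)
  also have "\<dots> = (\<Sum>p\<in>feasible n. \<Sum>k<n. esym {2..n} (excess n p) k)"
  proof (rule sum.cong[OF refl])
    fix p
    have "{..card {2..n}} = {..<n}" using n by auto
    then show "(\<Prod>v\<in>{2..n}. 1 + excess n p v) = (\<Sum>k<n. esym {2..n} (excess n p) k)"
      using sum_esym_all[of "{2..n}" "excess n p"] by simp
  qed
  also have "\<dots> = (\<Sum>k<n. esum n k)" unfolding esum_def by (rule sum.swap)
  finally show ?thesis .
qed

section \<open>Narayana and Catalan numbers\<close>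

lemma binomial_Suc_real: "(real j + 1) * real (n choose Suc j) = (real n - real j) * real (n choose j)"
proof (cases "j \<le> n")
  case True
  have "Suc j * (n choose Suc j) = (n - j) * (n choose j)"
    using binomial_absorb_comp[of n j] binomial_absorption[of j n] by (simp only:)
  then have "real (Suc j * (n choose Suc j)) = real ((n - j) * (n choose j))" by (simp only:)
  then show ?thesis using True by (simp add: of_nat_diff algebra_simps)
qed (simp add: binomial_eq_0)

lemma narayana_Suc:
  assumes "1 \<le> n"
  shows "(real k + 1) * (real k + 2) * narayana n (k + 2) =
         (real n - 1 - real k) * (real n - real k) * narayana n (k + 1)"
proof -
  have "(real k + 1) * (real k + 2) * narayana n (k + 2) =
    ((real k + 1) * real (n choose Suc k)) * ((real (Suc k) + 1) * real (n choose Suc (Suc k))) / real n"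
    by (simp add: narayana_def)
  also have "\<dots> = ((real n - real k) * real (n choose k)) * ((real n - real (Suc k)) * real (n choose Suc k)) / real n"
    unfolding binomial_Suc_real ..
  also have "\<dots> = (real n - 1 - real k) * (real n - real k) * narayana n (k + 1)"
    by (simp add: narayana_def mult_ac)
  finally show ?thesis .
qed

lemma sum_narayana:
  assumes "1 \<le> n"
  shows "(\<Sum>k<n. narayana n (k + 1)) = catalan n"
proof -
  have "(\<Sum>k\<le>n - 1. (n choose k) * (n choose (n - 1 - k))) = (n + n) choose (n - 1)"
    by (rule vandermonde)
  also have "(\<Sum>k\<le>n - 1. (n choose k) * (n choose (n - 1 - k))) = (\<Sum>k<n. (n choose (k + 1)) * (n choose k))"
  proof (rule sum.cong)
    fix k assume "k \<in> {..<n}"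
    then have "n choose (n - 1 - k) = n choose (k + 1)"
      using binomial_symmetric[of "k + 1" n] by simp
    then show "(n choose k) * (n choose (n - 1 - k)) = (n choose (k + 1)) * (n choose k)" by simp
  qed (use assms in auto)
  finally have 1: "(\<Sum>k<n. (n choose (k + 1)) * (n choose k)) = (2 * n) choose (n - 1)"
    by (simp add: mult_2)
  have "(\<Sum>k<n. narayana n (k + 1)) = 1 / real n * real (\<Sum>k<n. (n choose (k + 1)) * (n choose k))"
    by (simp add: narayana_def sum_distrib_left)
  also have "\<dots> = 1 / real n * real ((2 * n) choose (n - 1))" unfolding 1 ..
  also have "\<dots> = catalan n"
  proof -
    have "real n * real ((2 * n) choose n) = real (n + 1) * real ((2 * n) choose (n - 1))"
      using binomial_Suc_real[of "n - 1" "2 * n"] assms by (simp add: of_nat_diff)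
    then show ?thesis using assms unfolding catalan_def by (simp add: field_simps)
  qed
  finally show ?thesis .
qed

lemma narayana_self: "1 \<le> n \<Longrightarrow> narayana n n = 1"
proof -
  assume "1 \<le> n"
  then have "n choose (n - 1) = n" using binomial_symmetric[of 1 n] by simp
  then show ?thesis using \<open>1 \<le> n\<close> by (simp add: narayana_def)
qed

text \<open>Induction on \<open>n\<close>; for each \<open>n\<close> the top sum comes from the previous \<open>n\<close>, and the others follow
  downwards, because the Narayana numbers satisfy the same recursion in \<open>k\<close>.\<close>

theorem esum_eq_narayana:
  assumes "1 \<le> n" "k < n"
  shows "real_of_int (esum n k) = narayana n (k + 1) * (\<Prod>i = 1..n - 1. catalan i)"
  using assms
proof (induction n arbitrary: k rule: nat_induct_at_least)
  case base
  then have "k = 0" by simp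
  moreover have "pairs 1 = {}" by (auto simp: pairs_def)
  then have "feasible 1 = {\<lambda>_. undefined}" by (simp add: feasible_def)
  ultimately show ?case by (simp add: esum_def narayana_self)
next
  case (Suc n)
  let ?C = "\<Prod>i = 1..n. catalan i"
  have "real_of_int (esum (Suc n) n) = (\<Sum>k<n. narayana n (k + 1) * (\<Prod>i = 1..n - 1. catalan i))"
    unfolding esum_Suc_top[OF Suc.hyps] using Suc.IH by simp
  also have "\<dots> = catalan n * (\<Prod>i = 1..n - 1. catalan i)"
    unfolding sum_distrib_right[symmetric] sum_narayana[OF Suc.hyps] ..
  also have "\<dots> = ?C"
    using Suc.hyps by (cases n) (simp_all add: prod.cl_ivl_Suc mult.commute)
  finally have top: "real_of_int (esum (Suc n) n) = narayana (Suc n) (n + 1) * ?C"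
    by (simp add: narayana_self)
  have "k \<le> n" using Suc.prems by simp
  then have "real_of_int (esum (Suc n) k) = narayana (Suc n) (k + 1) * ?C"
  proof (induction k rule: inc_induct)
    case base show ?case by (rule top)
  next
    case (step k)
    let ?c = "(real n - real k) * (real n + 1 - real k)"
    have "?c * real_of_int (esum (Suc n) k) = (real k + 1) * (real k + 2) * real_of_int (esum (Suc n) (Suc k))"
      using arg_cong[OF esum_Suc[of "Suc n" k], of real_of_int] by simp
    also have "\<dots> = ((real k + 1) * (real k + 2) * narayana (Suc n) (k + 2)) * ?C"
      using step.IH by simp
    also have "(real k + 1) * (real k + 2) * narayana (Suc n) (k + 2) = ?c * narayana (Suc n) (k + 1)"
      using narayana_Suc[of "Suc n" k] by (simp add: add.commute)
    finally have "?c * real_of_int (esum (Suc n) k) = ?c * (narayana (Suc n) (k + 1) * ?C)"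
      by (simp only: mult.assoc)
    moreover have "?c \<noteq> 0" using step.hyps by simp
    ultimately show ?case by (simp only: mult_cancel_left) simp
  qed
  then show ?case by simp
qed

section \<open>Independence of the volume from the lattice chart\<close>

abbreviation lebesgue_on_coords :: "nat \<Rightarrow> (nat \<Rightarrow> real) measure" where
  "lebesgue_on_coords d \<equiv> \<Pi>\<^sub>M i\<in>{..<d}. lborel"

abbreviation coords :: "nat \<Rightarrow> (nat \<Rightarrow> real) set" where
  "coords d \<equiv> {..<d} \<rightarrow>\<^sub>E UNIV"

lemma space_coords [simp]: "space (lebesgue_on_coords d) = coords d"
  by (simp add: space_PiM)

lemma product_sigma_finite_lborel: "product_sigma_finite (\<lambda>_. lborel :: real measure)"
  by unfold_locales

lemma sigma_finite_coords: "sigma_finite_measure (lebesgue_on_coords d)"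
  by (rule product_sigma_finite.sigma_finite[OF product_sigma_finite_lborel]) simp

lemma distr_lborel_isometry:
  assumes "s = 1 \<or> s = (-1 :: real)"
  shows "distr lborel borel (\<lambda>x. c + s * x) = (lborel :: real measure)"
proof -
  have "lborel = density (distr lborel borel (\<lambda>x. c + s * x)) (\<lambda>_. ennreal \<bar>s\<bar>)"
    using assms by (intro lborel_real_affine) auto
  then show ?thesis using assms by (auto simp: density_1)
qed

lemma measurable_isometry [measurable]:
  "(\<lambda>x. \<lambda>i\<in>{..<d}. c i + s * x i) \<in> lebesgue_on_coords d \<rightarrow>\<^sub>M lebesgue_on_coords d"
  by measurable

lemma distr_coords_isometry:
  assumes s: "s = 1 \<or> s = (-1 :: real)"
  shows "distr (lebesgue_on_coords d) (lebesgue_on_coords d) (\<lambda>x. \<lambda>i\<in>{..<d}. c i + s * x i)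
    = lebesgue_on_coords d" (is "distr ?M ?M ?f = ?M")
proof (rule product_sigma_finite.PiM_eqI[OF product_sigma_finite_lborel])
  fix A :: "nat \<Rightarrow> real set" assume A: "\<And>i. i \<in> {..<d} \<Longrightarrow> A i \<in> sets lborel"
  let ?B = "\<lambda>i. (\<lambda>x. c i + s * x) -` A i"
  have B: "?B i \<in> sets lborel" if "i < d" for i
    using measurable_sets[of "\<lambda>x. c i + s * x" borel borel "A i"] A that by auto
  have "?f -` (Pi\<^sub>E {..<d} A) \<inter> space ?M = Pi\<^sub>E {..<d} ?B"
    by (auto simp: space_PiM PiE_iff)
  then have "emeasure (distr ?M ?M ?f) (Pi\<^sub>E {..<d} A) = emeasure ?M (Pi\<^sub>E {..<d} ?B)"
    using A by (subst emeasure_distr) (auto intro!: sets_PiM_I_finite)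
  also have "\<dots> = (\<Prod>i<d. emeasure lborel (?B i))"
    using B by (intro product_sigma_finite.emeasure_PiM[OF product_sigma_finite_lborel]) auto
  also have "\<dots> = (\<Prod>i<d. emeasure lborel (A i))"
  proof (rule prod.cong[OF refl])
    fix i assume "i \<in> {..<d}"
    then have "emeasure (distr lborel borel (\<lambda>x. c i + s * x)) (A i) = emeasure lborel (?B i)"
      using A by (subst emeasure_distr) auto
    then show "emeasure lborel (?B i) = emeasure lborel (A i)" by (simp add: distr_lborel_isometry[OF s])
  qed
  finally show "emeasure (distr ?M ?M ?f) (Pi\<^sub>E {..<d} A) = (\<Prod>i<d. emeasure lborel (A i))" .
qed auto

definition linmap :: "nat \<Rightarrow> nat \<Rightarrow> (nat \<Rightarrow> nat \<Rightarrow> real) \<Rightarrow> (nat \<Rightarrow> real) \<Rightarrow> nat \<Rightarrow> real" where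
  "linmap d' d M y = (\<lambda>j\<in>{..<d}. \<Sum>i<d'. y i * M i j)"

definition shift :: "nat \<Rightarrow> (nat \<Rightarrow> real) \<Rightarrow> (nat \<Rightarrow> real) \<Rightarrow> nat \<Rightarrow> real" where
  "shift d c x = (\<lambda>i\<in>{..<d}. c i + x i)"

lemma shift_in_coords [simp]: "shift d c x \<in> coords d"
  by (simp add: shift_def)

lemma emeasure_shift_vimage:
  assumes "A \<in> sets (lebesgue_on_coords d)"
  shows "emeasure (lebesgue_on_coords d) (shift d c -` A \<inter> coords d) = emeasure (lebesgue_on_coords d) A"
proof -
  have "shift d c = (\<lambda>x. \<lambda>i\<in>{..<d}. c i + 1 * x i)" by (simp add: shift_def fun_eq_iff)
  then show ?thesis
    using emeasure_distr[OF measurable_isometry assms, of c 1] distr_coords_isometry[of 1 d c] by simp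
qed

lemma measurable_linmap [measurable]:
  "linmap d' d M \<in> lebesgue_on_coords d' \<rightarrow>\<^sub>M lebesgue_on_coords d"
  unfolding linmap_def by measurable

lemma linmap_diff:
  "linmap d' d M (\<lambda>i\<in>{..<d'}. y i - z i) = (\<lambda>j\<in>{..<d}. linmap d' d M y j - linmap d' d M z j)"
  by (auto simp: linmap_def fun_eq_iff algebra_simps sum_subtractf)

lemma linmap_add:
  "linmap d' d M (\<lambda>i\<in>{..<d'}. y i + z i) = (\<lambda>j\<in>{..<d}. linmap d' d M y j + linmap d' d M z j)"
  by (auto simp: linmap_def fun_eq_iff algebra_simps sum.distrib)

lemma linmap_in_coords [simp]: "linmap d' d M y \<in> coords d"
  by (simp add: linmap_def)

definition unit_cube :: "nat \<Rightarrow> (nat \<Rightarrow> real) set" where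
  "unit_cube d = {..<d} \<rightarrow>\<^sub>E {0..<1}"

lemma unit_cube_sets [measurable]: "unit_cube d \<in> sets (lebesgue_on_coords d)"
  unfolding unit_cube_def by (intro sets_PiM_I_finite) auto

lemma emeasure_unit_cube: "emeasure (lebesgue_on_coords d) (unit_cube d) = 1"
  unfolding unit_cube_def
  by (subst product_sigma_finite.emeasure_PiM[OF product_sigma_finite_lborel]) auto

lemma ex1_integer_translate_unit_cube:
  "\<exists>!z. z \<in> {..<k} \<rightarrow>\<^sub>E (\<int> :: real set) \<and> (\<lambda>i\<in>{..<k}. x i - z i) \<in> unit_cube k"
proof (rule ex1I[of _ "\<lambda>i\<in>{..<k}. of_int \<lfloor>x i\<rfloor>"])
  have "0 \<le> x i - of_int \<lfloor>x i\<rfloor>" "x i - of_int \<lfloor>x i\<rfloor> < 1" for i by linarith+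
  then show "(\<lambda>i\<in>{..<k}. of_int \<lfloor>x i\<rfloor>) \<in> {..<k} \<rightarrow>\<^sub>E (\<int> :: real set) \<and>
      (\<lambda>i\<in>{..<k}. x i - (\<lambda>i\<in>{..<k}. of_int \<lfloor>x i\<rfloor>) i) \<in> unit_cube k"
    by (simp add: unit_cube_def PiE_iff)
next
  fix z assume z: "z \<in> {..<k} \<rightarrow>\<^sub>E (\<int> :: real set) \<and> (\<lambda>i\<in>{..<k}. x i - z i) \<in> unit_cube k"
  show "z = (\<lambda>i\<in>{..<k}. of_int \<lfloor>x i\<rfloor>)"
  proof
    fix i
    show "z i = (\<lambda>i\<in>{..<k}. of_int \<lfloor>x i\<rfloor>) i"
    proof (cases "i < k")
      case True
      then obtain m where m: "z i = of_int m" using z by (auto simp: PiE_iff Ints_def)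
      have "0 \<le> x i - z i" "x i - z i < 1" using z True by (auto simp: unit_cube_def PiE_iff)
      then have "\<lfloor>x i\<rfloor> = m" using m by (intro floor_unique) auto
      then show ?thesis using m True by simp
    qed (use z in \<open>auto simp: PiE_iff extensional_def\<close>)
  qed
qed

text \<open>The preimage of the unit cube is, like the unit cube itself, a fundamental domain of the integer
  lattice. Two fundamental domains have the same measure: cut each into its intersections with the
  translates of the other; a piece of one is a lattice translate of a piece of the other.\<close>

lemma emeasure_vimage_unit_cube:
  assumes lattice: "bij_betw (linmap d' d M) ({..<d'} \<rightarrow>\<^sub>E \<int>) ({..<d} \<rightarrow>\<^sub>E \<int>)"
  shows "emeasure (lebesgue_on_coords d') (linmap d' d M -` unit_cube d \<inter> coords d') = 1"
proof -
  let ?N = "lebesgue_on_coords d'" and ?L = "linmap d' d M" and ?Z = "{..<d'} \<rightarrow>\<^sub>E (\<int> :: real set)"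
  define E where "E = ?L -` unit_cube d \<inter> coords d'"
  have E [measurable]: "E \<in> sets ?N"
    unfolding E_def using measurable_sets[OF measurable_linmap unit_cube_sets] by simp
  have "countable (\<int> :: real set)" by (simp add: Ints_def)
  then have Z: "countable ?Z" by (intro countable_PiE) auto
  \<comment> \<open>Two tilings of the space: by the unit cube shifted by \<open>z\<close>, and by \<open>E\<close> shifted by \<open>-z\<close>.\<close>
  define cube where "cube z = shift d' (\<lambda>i. - z i) -` unit_cube d' \<inter> coords d'" for z
  define tile where "tile z = shift d' z -` E \<inter> coords d'" for z
  have sets_shift: "shift d' c -` A \<inter> coords d' \<in> sets ?N" if "A \<in> sets ?N" for A c
  proof -
    have "shift d' c \<in> ?N \<rightarrow>\<^sub>M ?N" unfolding shift_def by measurable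
    from measurable_sets[OF this that] show ?thesis by simp
  qed
  have cube_sets [measurable]: "cube z \<in> sets ?N" and tile_sets [measurable]: "tile z \<in> sets ?N" for z
    unfolding cube_def tile_def by (auto intro: sets_shift)
  have tiling: "\<exists>!z. z \<in> ?Z \<and> y \<in> tile z" if y: "y \<in> coords d'" for y
  proof -
    have L_shift: "y \<in> tile z \<longleftrightarrow> (\<lambda>j\<in>{..<d}. ?L y j - (\<lambda>j\<in>{..<d}. - ?L z j) j) \<in> unit_cube d" for z
    proof -
      have "?L (shift d' z y) = (\<lambda>j\<in>{..<d}. ?L y j - (\<lambda>j\<in>{..<d}. - ?L z j) j)"
        unfolding shift_def linmap_add by (auto simp: fun_eq_iff)
      then show ?thesis using y by (simp add: tile_def E_def shift_def)
    qed
    define P where "P w \<longleftrightarrow> w \<in> {..<d} \<rightarrow>\<^sub>E \<int> \<and> (\<lambda>j\<in>{..<d}. ?L y j - w j) \<in> unit_cube d" for w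
    have "\<exists>!w. P w" unfolding P_def by (rule ex1_integer_translate_unit_cube)
    then obtain w where P_w: "P w" and w_unique: "\<And>w'. P w' \<Longrightarrow> w' = w" by auto
    have w: "w \<in> {..<d} \<rightarrow>\<^sub>E \<int>" "(\<lambda>j\<in>{..<d}. ?L y j - w j) \<in> unit_cube d"
      using P_w unfolding P_def by simp_all
    have neg: "(\<lambda>j\<in>{..<d}. - u j) \<in> {..<d} \<rightarrow>\<^sub>E (\<int> :: real set)" if "u \<in> {..<d} \<rightarrow>\<^sub>E \<int>" for u
      using that by (simp add: PiE_iff)
    have L_int: "?L z \<in> {..<d} \<rightarrow>\<^sub>E \<int>" if "z \<in> ?Z" for z
      using bij_betw_apply[OF lattice that] .
    obtain z where z: "z \<in> ?Z" "?L z = (\<lambda>j\<in>{..<d}. - w j)"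
      using bij_betw_imp_surj_on[OF lattice] neg[OF w(1)] by (metis imageE)
    have wz: "(\<lambda>j\<in>{..<d}. - ?L z j) = w"
      unfolding z(2) using w(1) by (auto simp: fun_eq_iff PiE_iff extensional_def)
    show ?thesis
    proof (rule ex1I[of _ z])
      show "z \<in> ?Z \<and> y \<in> tile z" unfolding L_shift wz using z(1) w(2) by blast
      fix z' assume z': "z' \<in> ?Z \<and> y \<in> tile z'"
      have "P (\<lambda>j\<in>{..<d}. - ?L z' j)"
        unfolding P_def using z' neg[OF L_int] unfolding L_shift by blast
      then have "(\<lambda>j\<in>{..<d}. - ?L z' j) = w" by (rule w_unique)
      then have *: "(\<lambda>j\<in>{..<d}. - ?L z' j) = (\<lambda>j\<in>{..<d}. - ?L z j)" by (simp only: wz)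
      have "?L z' = ?L z"
      proof (rule PiE_ext[of _ "{..<d}" "\<lambda>_. UNIV"])
        fix j assume "j \<in> {..<d}"
        then show "?L z' j = ?L z j" using fun_cong[OF *, of j] by simp
      qed simp_all
      then show "z' = z" using bij_betw_imp_inj_on[OF lattice] z(1) z' by (meson inj_onD)
    qed
  qed
  have covering: "\<exists>!z. z \<in> ?Z \<and> y \<in> cube z" if y: "y \<in> coords d'" for y
    using ex1_integer_translate_unit_cube[of d' y] y by (simp add: cube_def shift_def)
  have cube_eq: "emeasure ?N (E \<inter> cube z) = emeasure ?N (tile z \<inter> unit_cube d')" for z
  proof -
    have unshift: "shift d' (\<lambda>i. - z i) (shift d' z y) = y" if "y \<in> coords d'" for y
      using that by (auto simp: shift_def fun_eq_iff PiE_iff extensional_def)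
    have in_cube: "shift d' z y \<in> cube z \<longleftrightarrow> y \<in> unit_cube d'" if "y \<in> coords d'" for y
      using unshift[OF that] unfolding cube_def by (simp only: vimage_eq Int_iff shift_in_coords simp_thms)
    have "unit_cube d' \<subseteq> coords d'" by (auto simp: unit_cube_def PiE_iff)
    then have "shift d' z -` (E \<inter> cube z) \<inter> coords d' = tile z \<inter> unit_cube d'"
      unfolding tile_def using in_cube by blast
    then show ?thesis using emeasure_shift_vimage[of "E \<inter> cube z" d' z] by simp
  qed
  have countable_union: "emeasure ?N A = (\<integral>\<^sup>+z. emeasure ?N (A \<inter> C z) \<partial>count_space ?Z)"
    if A: "A \<in> sets ?N" and C: "\<And>z. C z \<in> sets ?N" "\<And>y. y \<in> coords d' \<Longrightarrow> \<exists>!z. z \<in> ?Z \<and> y \<in> C z" for A C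
  proof -
    have A_coords: "y \<in> coords d'" if "y \<in> A" for y using sets.sets_into_space[OF A] that by auto
    have "\<exists>z\<in>?Z. y \<in> C z" if "y \<in> A" for y
      using ex1_implies_ex[OF C(2)[OF A_coords[OF that]]] by blast
    then have "A = (\<Union>z\<in>?Z. A \<inter> C z)" by blast
    moreover have "(A \<inter> C z) \<inter> (A \<inter> C z') = {}" if "z \<in> ?Z" "z' \<in> ?Z" "z \<noteq> z'" for z z'
    proof (rule ccontr)
      assume "(A \<inter> C z) \<inter> (A \<inter> C z') \<noteq> {}"
      then obtain y where y: "y \<in> A" "y \<in> C z" "y \<in> C z'" by blast
      define Q where "Q z \<longleftrightarrow> z \<in> ?Z \<and> y \<in> C z" for z
      have "\<exists>!z. Q z" unfolding Q_def by (rule C(2)[OF A_coords[OF y(1)]])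
      moreover have "Q z" "Q z'" using that y by (simp_all add: Q_def)
      ultimately show False using \<open>z \<noteq> z'\<close> by blast
    qed
    then have "disjoint_family_on (\<lambda>z. A \<inter> C z) ?Z" unfolding disjoint_family_on_def by blast
    ultimately show ?thesis
      using emeasure_UN_countable[OF _ Z, of "\<lambda>z. A \<inter> C z" ?N] A C(1) by auto
  qed
  have "emeasure ?N E = (\<integral>\<^sup>+z. emeasure ?N (E \<inter> cube z) \<partial>count_space ?Z)"
    using covering by (intro countable_union) auto
  also have "\<dots> = (\<integral>\<^sup>+z. emeasure ?N (unit_cube d' \<inter> tile z) \<partial>count_space ?Z)"
    by (simp only: cube_eq Int_commute)
  also have "\<dots> = emeasure ?N (unit_cube d')"
    using tiling by (intro countable_union[symmetric]) auto
  finally show ?thesis by (simp add: emeasure_unit_cube E_def)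
qed

text \<open>The argument for uniqueness of Haar measure. Integrate \<open>1\<^sub>A(x) 1\<^sub>D(L y - x)\<close> over \<open>x\<close> and \<open>y\<close>,
  where \<open>D\<close> is the unit cube. For fixed \<open>x\<close>, a translation of \<open>y\<close> shows that the integral over \<open>y\<close> is
  the measure of the preimage of \<open>D\<close>, which is \<open>1\<close>; for fixed \<open>y\<close>, the reflection \<open>x \<mapsto> L y - x\<close>
  exchanges the roles of \<open>A\<close> and \<open>D\<close>.\<close>

lemma emeasure_vimage_linmap:
  assumes real: "bij_betw (linmap d' d M) (coords d') (coords d)"
    and lattice: "bij_betw (linmap d' d M) ({..<d'} \<rightarrow>\<^sub>E \<int>) ({..<d} \<rightarrow>\<^sub>E \<int>)"
    and A [measurable]: "A \<in> sets (lebesgue_on_coords d)"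
  shows "emeasure (lebesgue_on_coords d') (linmap d' d M -` A \<inter> coords d') = emeasure (lebesgue_on_coords d) A"
proof -
  let ?N = "lebesgue_on_coords d'" and ?M = "lebesgue_on_coords d" and ?L = "linmap d' d M"
  let ?D = "unit_cube d"
  interpret M: sigma_finite_measure ?M by (rule sigma_finite_coords)
  interpret N: sigma_finite_measure ?N by (rule sigma_finite_coords)
  interpret pair_sigma_finite ?M ?N ..
  have L_meas [measurable]: "?L \<in> ?N \<rightarrow>\<^sub>M ?M" by (rule measurable_linmap)
  have diff_meas [measurable]: "(\<lambda>(x, y). \<lambda>j\<in>{..<d}. ?L y j - x j) \<in> ?M \<Otimes>\<^sub>M ?N \<rightarrow>\<^sub>M ?M"
    unfolding case_prod_unfold
  proof (rule measurable_restrict, goal_cases)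
    case (1 j)
    then have j: "j \<in> {..<d}" .
    have c [measurable]: "(\<lambda>x. x j) \<in> ?M \<rightarrow>\<^sub>M borel"
      using measurable_component_singleton[OF j, of "\<lambda>_. lborel :: real measure"] by simp
    show ?case
      unfolding measurable_lborel1 
      by (intro borel_measurable_diff measurable_compose[OF _ c] measurable_compose[OF measurable_snd L_meas] measurable_fst)
  qed
  have translate: "(\<integral>\<^sup>+y. indicator B (\<lambda>j\<in>{..<d}. ?L y j - x j) \<partial>?N) = emeasure ?N (?L -` B \<inter> coords d')"
    if B: "B \<in> sets ?M" and x: "x \<in> coords d" for B x
  proof -
    obtain y0 where y0: "y0 \<in> coords d'" "?L y0 = x"
      using bij_betw_imp_surj_on[OF real] x by (metis imageE)
    let ?s = "shift d' (\<lambda>i. - y0 i)"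
    have LB: "?L -` B \<inter> coords d' \<in> sets ?N" using measurable_sets[OF L_meas B] by simp
    have s_meas: "?s \<in> ?N \<rightarrow>\<^sub>M ?N" unfolding shift_def by measurable
    have s_sets: "?s -` (?L -` B \<inter> coords d') \<inter> coords d' \<in> sets ?N"
      using measurable_sets[OF s_meas LB] by simp
    have "(\<lambda>j\<in>{..<d}. ?L y j - x j) = ?L (?s y)" for y
      using linmap_diff[of d' d M y y0] y0 by (simp add: shift_def)
    then have "(\<integral>\<^sup>+y. indicator B (\<lambda>j\<in>{..<d}. ?L y j - x j) \<partial>?N) =
      (\<integral>\<^sup>+y. indicator (?s -` (?L -` B \<inter> coords d') \<inter> coords d') y \<partial>?N)"
      by (intro nn_integral_cong) (auto simp: indicator_def shift_def)
    also have "\<dots> = emeasure ?N (?L -` B \<inter> coords d')"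
      using s_sets emeasure_shift_vimage[OF LB, of "\<lambda>i. - y0 i"] by simp
    finally show ?thesis .
  qed
  have D: "emeasure ?N (?L -` ?D \<inter> coords d') = 1"
    by (rule emeasure_vimage_unit_cube[OF lattice])
  have "emeasure ?M A = (\<integral>\<^sup>+x. indicator A x * (\<integral>\<^sup>+y. indicator ?D (\<lambda>j\<in>{..<d}. ?L y j - x j) \<partial>?N) \<partial>?M)"
  proof -
    have "emeasure ?M A = (\<integral>\<^sup>+x. indicator A x \<partial>?M)" by simp
    also have "\<dots> = (\<integral>\<^sup>+x. indicator A x * (\<integral>\<^sup>+y. indicator ?D (\<lambda>j\<in>{..<d}. ?L y j - x j) \<partial>?N) \<partial>?M)"
      by (intro nn_integral_cong) (simp add: translate D)
    finally show ?thesis .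
  qed
  also have "\<dots> = (\<integral>\<^sup>+x. (\<integral>\<^sup>+y. indicator A x * indicator ?D (\<lambda>j\<in>{..<d}. ?L y j - x j) \<partial>?N) \<partial>?M)"
    by (intro nn_integral_cong nn_integral_cmult[symmetric]) measurable
  also have "\<dots> = (\<integral>\<^sup>+y. (\<integral>\<^sup>+x. indicator A x * indicator ?D (\<lambda>j\<in>{..<d}. ?L y j - x j) \<partial>?M) \<partial>?N)"
    by (rule Fubini'[symmetric]) measurable
  also have "\<dots> = (\<integral>\<^sup>+y. (\<integral>\<^sup>+x. indicator ?D x * indicator A (\<lambda>j\<in>{..<d}. ?L y j - x j) \<partial>?M) \<partial>?N)"
  proof (rule nn_integral_cong)
    fix y
    let ?r = "\<lambda>x. \<lambda>j\<in>{..<d}. ?L y j + - 1 * x j"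
    have r: "?r \<in> ?M \<rightarrow>\<^sub>M ?M" by (rule measurable_isometry)
    have "(\<integral>\<^sup>+x. indicator A x * indicator ?D (\<lambda>j\<in>{..<d}. ?L y j - x j) \<partial>?M) =
      (\<integral>\<^sup>+x. indicator A x * indicator ?D (\<lambda>j\<in>{..<d}. ?L y j - x j) \<partial>distr ?M ?M ?r)"
      using distr_coords_isometry[of "-1" d "?L y"] by simp
    also have "\<dots> = (\<integral>\<^sup>+x. indicator A (?r x) * indicator ?D (\<lambda>j\<in>{..<d}. ?L y j - ?r x j) \<partial>?M)"
      by (rule nn_integral_distr[OF r]) measurable
    also have "\<dots> = (\<integral>\<^sup>+x. indicator ?D x * indicator A (\<lambda>j\<in>{..<d}. ?L y j - x j) \<partial>?M)"
    proof (rule nn_integral_cong)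
      fix x assume "x \<in> space ?M"
      then have "(\<lambda>j\<in>{..<d}. ?L y j - ?r x j) = x"
        by (auto simp: fun_eq_iff PiE_iff extensional_def)
      then show "indicator A (?r x) * indicator ?D (\<lambda>j\<in>{..<d}. ?L y j - ?r x j) =
        (indicator ?D x * indicator A (\<lambda>j\<in>{..<d}. ?L y j - x j) :: ennreal)"
        by (simp add: mult.commute)
    qed
    finally show "(\<integral>\<^sup>+x. indicator A x * indicator ?D (\<lambda>j\<in>{..<d}. ?L y j - x j) \<partial>?M) =
      (\<integral>\<^sup>+x. indicator ?D x * indicator A (\<lambda>j\<in>{..<d}. ?L y j - x j) \<partial>?M)" .
  qed
  also have "\<dots> = (\<integral>\<^sup>+x. (\<integral>\<^sup>+y. indicator ?D x * indicator A (\<lambda>j\<in>{..<d}. ?L y j - x j) \<partial>?N) \<partial>?M)"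
    by (rule Fubini') measurable
  also have "\<dots> = (\<integral>\<^sup>+x. indicator ?D x * (\<integral>\<^sup>+y. indicator A (\<lambda>j\<in>{..<d}. ?L y j - x j) \<partial>?N) \<partial>?M)"
    by (intro nn_integral_cong nn_integral_cmult) measurable
  also have "\<dots> = (\<integral>\<^sup>+x. indicator ?D x * emeasure ?N (?L -` A \<inter> coords d') \<partial>?M)"
    by (intro nn_integral_cong) (simp add: translate A)
  also have "\<dots> = emeasure ?N (?L -` A \<inter> coords d')"
    by (simp add: nn_integral_multc emeasure_unit_cube)
  finally show ?thesis ..
qed

text \<open>Reduction modulo 2: if \<open>L y\<close> and \<open>L z\<close> are congruent, then half of their difference is the image of
  a lattice vector, so \<open>y\<close> and \<open>z\<close> are congruent too. Hence \<open>2 ^ d' \<le> 2 ^ d\<close>, without determinants.\<close>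

lemma lattice_bijection_dim_le:
  assumes lattice: "bij_betw (linmap d' d M) ({..<d'} \<rightarrow>\<^sub>E \<int>) ({..<d} \<rightarrow>\<^sub>E \<int>)"
  shows "d' \<le> d"
proof -
  let ?L = "linmap d' d M"
  let ?par = "\<lambda>z. \<lambda>j\<in>{..<d}. \<lfloor>?L z j\<rfloor> mod 2"
  let ?C = "{..<d'} \<rightarrow>\<^sub>E {0, 1 :: real}"
  have C_int: "z \<in> {..<d'} \<rightarrow>\<^sub>E \<int>" if "z \<in> ?C" for z using that by (auto simp: PiE_iff) (metis Ints_0 Ints_1 lessThan_iff)
  have L_int: "?L z j \<in> \<int>" if "z \<in> {..<d'} \<rightarrow>\<^sub>E \<int>" "j < d" for z j
    using bij_betw_apply[OF lattice that(1)] that(2) by (auto simp: PiE_iff)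
  have "inj_on ?par ?C"
  proof (rule inj_onI)
    fix y z assume y: "y \<in> ?C" and z: "z \<in> ?C" and eq: "?par y = ?par z"
    define h where "h = (\<lambda>j\<in>{..<d}. (?L y j - ?L z j) / 2)"
    have "h \<in> {..<d} \<rightarrow>\<^sub>E \<int>"
    proof (rule PiE_I)
      fix j assume j: "j \<in> {..<d}"
      then have "\<lfloor>?L y j\<rfloor> mod 2 = \<lfloor>?L z j\<rfloor> mod 2" using fun_cong[OF eq, of j] by simp
      then obtain q where "\<lfloor>?L y j\<rfloor> - \<lfloor>?L z j\<rfloor> = 2 * q" by (metis mod_eq_dvd_iff dvdE)
      moreover have "?L y j = of_int \<lfloor>?L y j\<rfloor>" "?L z j = of_int \<lfloor>?L z j\<rfloor>"
        using L_int C_int y z j by auto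
      ultimately have "?L y j - ?L z j = of_int (2 * q)" by (metis of_int_diff)
      then show "h j \<in> \<int>" using j by (simp add: h_def)
    qed (simp add: h_def)
    then obtain w where w: "w \<in> {..<d'} \<rightarrow>\<^sub>E \<int>" "?L w = h"
      using bij_betw_imp_surj_on[OF lattice] by (metis imageE)
    let ?w2 = "\<lambda>i\<in>{..<d'}. 2 * w i" and ?yz = "\<lambda>i\<in>{..<d'}. y i - z i"
    have "?L ?w2 = ?L ?yz"
    proof
      fix j
      show "?L ?w2 j = ?L ?yz j"
      proof (cases "j < d")
        case True
        have "?L ?w2 j = 2 * ?L w j"
          using True by (simp add: linmap_def sum_distrib_left mult.assoc)
        then show ?thesis using True unfolding w(2) linmap_diff by (simp add: h_def)
      qed (simp add: linmap_def)
    qed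
    moreover have "?w2 \<in> {..<d'} \<rightarrow>\<^sub>E \<int>" "?yz \<in> {..<d'} \<rightarrow>\<^sub>E \<int>"
      using w(1) C_int[OF y] C_int[OF z] by (auto simp: PiE_iff)
    ultimately have "?w2 = ?yz" using bij_betw_imp_inj_on[OF lattice] by (meson inj_onD)
    then have yz: "y i - z i = 2 * w i" if "i < d'" for i
      using that by (simp add: fun_eq_iff split: if_splits)
    show "y = z"
    proof (rule PiE_ext[OF y z])
      fix i assume i: "i \<in> {..<d'}"
      then obtain m where "w i = of_int m" using w(1) by (auto simp: PiE_iff Ints_def)
      then have "y i - z i = of_int (2 * m)" using yz[of i] i by simp
      moreover have "y i = 0 \<or> y i = 1" "z i = 0 \<or> z i = 1" using y z i by (auto simp: PiE_iff)
      moreover have "real_of_int (2 * m) = 1 \<longleftrightarrow> 2 * m = 1" "real_of_int (2 * m) = -1 \<longleftrightarrow> 2 * m = -1"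
        using of_int_eq_iff[of "2 * m" 1, where ?'a = real] of_int_eq_iff[of "2 * m" "-1", where ?'a = real] by simp_all
      moreover have "2 * m \<noteq> 1" "2 * m \<noteq> -1" by presburger+
      ultimately show "y i = z i" by auto
    qed
  qed
  moreover have "?par ` ?C \<subseteq> {..<d} \<rightarrow>\<^sub>E {0, 1 :: int}"
  proof (rule image_subsetI)
    fix z
    have "a mod 2 = 0 \<or> a mod 2 = 1" for a :: int by presburger
    then show "?par z \<in> {..<d} \<rightarrow>\<^sub>E {0, 1 :: int}" by (simp add: PiE_iff)
  qed
  ultimately have "card ?C \<le> card ({..<d} \<rightarrow>\<^sub>E {0, 1 :: int})"
    by (intro card_inj_on_le[of ?par]) (auto intro: finite_PiE)
  then have "2 ^ d' \<le> (2 ^ d :: nat)" by (simp add: card_PiE)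
  then show ?thesis by simp
qed

lemma shift_bij: "bij_betw (shift d c) (coords d) (coords d)"
  by (rule bij_betwI[where g = "shift d (\<lambda>i. - c i)"])
     (auto simp: shift_def fun_eq_iff PiE_iff extensional_def)

lemma shift_bij_lattice:
  assumes "\<And>i. i < d \<Longrightarrow> c i \<in> \<int>"
  shows "bij_betw (shift d c) ({..<d} \<rightarrow>\<^sub>E \<int>) ({..<d} \<rightarrow>\<^sub>E \<int>)"
proof (rule bij_betwI[where g = "shift d (\<lambda>i. - c i)"])
  show "shift d c \<in> ({..<d} \<rightarrow>\<^sub>E \<int>) \<rightarrow> ({..<d} \<rightarrow>\<^sub>E \<int>)"
    "shift d (\<lambda>i. - c i) \<in> ({..<d} \<rightarrow>\<^sub>E \<int>) \<rightarrow> ({..<d} \<rightarrow>\<^sub>E \<int>)"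
    using assms by (auto simp: shift_def PiE_iff)
qed (auto simp: shift_def fun_eq_iff PiE_iff extensional_def)

text \<open>The matrix is read off from the images of the unit vectors; injectivity of the first chart then
  makes the affine formula hold everywhere.\<close>

lemma chart_change_linear:
  assumes inj: "inj_on (affine_chart d p b) (coords d)"
    and T: "\<And>y. y \<in> coords d' \<Longrightarrow> T y \<in> coords d \<and> affine_chart d p b (T y) = affine_chart d' p' b' y"
  obtains c M where "\<And>y. y \<in> coords d' \<Longrightarrow> T y = shift d c (linmap d' d M y)"
    and "c = T (\<lambda>i\<in>{..<d'}. 0)"
proof -
  define c where "c = T (\<lambda>i\<in>{..<d'}. 0)"
  define unit where "unit k = (\<lambda>i\<in>{..<d'}. if i = k then 1 else 0 :: real)" for k :: nat
  define M where "M k j = T (unit k) j - c j" for k j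
  have chart_c: "p e + (\<Sum>j<d. c j * b j e) = p' e" for e
  proof -
    have "affine_chart d p b c = affine_chart d' p' b' (\<lambda>i\<in>{..<d'}. 0)"
      unfolding c_def using T by (intro conjunct2[OF T]) auto
    from fun_cong[OF this, of e] show ?thesis by (simp add: affine_chart_def)
  qed
  have chart_M: "(\<Sum>j<d. M k j * b j e) = b' k e" if k: "k < d'" for k e
  proof -
    have "affine_chart d p b (T (unit k)) = affine_chart d' p' b' (unit k)"
      by (intro conjunct2[OF T]) (auto simp: unit_def)
    from fun_cong[OF this, of e]
    have "p e + (\<Sum>j<d. T (unit k) j * b j e) = p' e + (\<Sum>i<d'. (if i = k then 1 else 0) * b' i e)"
      by (simp add: affine_chart_def unit_def)
    also have "(\<Sum>i<d'. (if i = k then 1 else 0) * b' i e) = b' k e"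
      using k by (simp add: if_distrib[of "\<lambda>x. x * _"] cong: if_cong)
    finally show ?thesis
      using chart_c[of e] by (simp add: M_def left_diff_distrib sum_subtractf)
  qed
  have "T y = shift d c (linmap d' d M y)" if y: "y \<in> coords d'" for y
  proof (rule inj_onD[OF inj])
    show "T y \<in> coords d" "shift d c (linmap d' d M y) \<in> coords d"
      using T[OF y] by (auto simp: shift_def)
    have "affine_chart d p b (shift d c (linmap d' d M y)) = affine_chart d' p' b' y"
    proof
      fix e
      have "(\<Sum>j<d. (\<Sum>i<d'. y i * M i j) * b j e) = (\<Sum>j<d. \<Sum>i<d'. y i * (M i j * b j e))"
        by (simp add: sum_distrib_right mult.assoc)
      also have "\<dots> = (\<Sum>i<d'. y i * (\<Sum>j<d. M i j * b j e))"
        by (subst sum.swap) (simp add: sum_distrib_left)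
      also have "\<dots> = (\<Sum>i<d'. y i * b' i e)" by (simp add: chart_M)
      finally have "(\<Sum>j<d. (\<Sum>i<d'. y i * M i j) * b j e) = (\<Sum>i<d'. y i * b' i e)" .
      then show "affine_chart d p b (shift d c (linmap d' d M y)) e = affine_chart d' p' b' y e"
        using chart_c[of e] by (simp add: affine_chart_def shift_def linmap_def algebra_simps sum.distrib)
    qed
    then show "affine_chart d p b (T y) = affine_chart d p b (shift d c (linmap d' d M y))"
      using T[OF y] by simp
  qed
  then show thesis using c_def by (rule that)
qed

text \<open>One chart followed by the inverse of the other is an affine bijection that matches the lattices.
  Its value at \<open>0\<close> is a lattice vector; without this translation it is linear.\<close>

lemma lattice_chart_change:
  assumes chart: "lattice_chart P d p b" and chart': "lattice_chart P d' p' b'"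
  shows "d' \<le> d"
    and "{x \<in> coords d. affine_chart d p b x \<in> P} \<in> sets (lebesgue_on_coords d) \<Longrightarrow>
         emeasure (lebesgue_on_coords d') {y \<in> coords d'. affine_chart d' p' b' y \<in> P} =
         emeasure (lebesgue_on_coords d) {x \<in> coords d. affine_chart d p b x \<in> P}"
proof -
  let ?f = "affine_chart d p b" and ?g = "affine_chart d' p' b'"
  let ?A = "{x \<in> coords d. ?f x \<in> P}"
  define T where "T = inv_into (coords d) ?f \<circ> ?g"
  have f: "bij_betw ?f (coords d) (affine_fun hull P)"
    "bij_betw ?f ({..<d} \<rightarrow>\<^sub>E \<int>) (affine_fun hull P \<inter> integer_points)"
    and g: "bij_betw ?g (coords d') (affine_fun hull P)"
    "bij_betw ?g ({..<d'} \<rightarrow>\<^sub>E \<int>) (affine_fun hull P \<inter> integer_points)"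
    using chart chart' by (simp_all add: lattice_chart_def)
  have T: "bij_betw T (coords d') (coords d)"
    unfolding T_def using g(1) f(1) by (blast intro: bij_betw_trans bij_betw_inv_into)
  have T_chart: "T y \<in> coords d \<and> ?f (T y) = ?g y" if "y \<in> coords d'" for y
    using bij_betw_apply[OF T that] bij_betw_inv_into_right[OF f(1), of "?g y"] bij_betw_apply[OF g(1) that]
    by (simp add: T_def)
  have inv_lattice: "inv_into (coords d) ?f v = inv_into ({..<d} \<rightarrow>\<^sub>E \<int>) ?f v"
    if v: "v \<in> affine_fun hull P \<inter> integer_points" for v
  proof -
    obtain z where z: "z \<in> {..<d} \<rightarrow>\<^sub>E \<int>" "v = ?f z"
      using v bij_betw_imp_surj_on[OF f(2)] by auto
    moreover have "z \<in> coords d" using z(1) by (auto simp: PiE_iff)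
    ultimately show ?thesis
      using bij_betw_inv_into_left[OF f(1)] bij_betw_inv_into_left[OF f(2)] by metis
  qed
  have "bij_betw (inv_into ({..<d} \<rightarrow>\<^sub>E \<int>) ?f \<circ> ?g) ({..<d'} \<rightarrow>\<^sub>E \<int>) ({..<d} \<rightarrow>\<^sub>E \<int>)"
    using g(2) f(2) by (blast intro: bij_betw_trans bij_betw_inv_into)
  moreover have "(inv_into ({..<d} \<rightarrow>\<^sub>E \<int>) ?f \<circ> ?g) z = T z" if "z \<in> {..<d'} \<rightarrow>\<^sub>E \<int>" for z
    using inv_lattice[OF bij_betw_apply[OF g(2) that]] by (simp add: T_def)
  ultimately have T_lattice: "bij_betw T ({..<d'} \<rightarrow>\<^sub>E \<int>) ({..<d} \<rightarrow>\<^sub>E \<int>)"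
    by (subst (asm) bij_betw_cong[where g = T]) auto
  obtain c M where cM: "\<And>y. y \<in> coords d' \<Longrightarrow> T y = shift d c (linmap d' d M y)"
    and c0: "c = T (\<lambda>i\<in>{..<d'}. 0)"
    using chart_change_linear[OF bij_betw_imp_inj_on[OF f(1)] T_chart] by blast
  let ?L = "linmap d' d M" and ?s = "shift d (\<lambda>j. - c j)"
  have "(\<lambda>i\<in>{..<d'}. 0) \<in> {..<d'} \<rightarrow>\<^sub>E (\<int> :: real set)" by (simp add: PiE_iff)
  then have "c \<in> {..<d} \<rightarrow>\<^sub>E \<int>" unfolding c0 by (rule bij_betw_apply[OF T_lattice])
  then have c_int: "- c j \<in> \<int>" if "j < d" for j using that by (auto simp: PiE_iff)
  have L: "?L y = (?s \<circ> T) y" if "y \<in> coords d'" for y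
    using that by (auto simp: cM shift_def linmap_def fun_eq_iff)
  have "bij_betw (?s \<circ> T) (coords d') (coords d)"
    by (rule bij_betw_trans[OF T shift_bij])
  then have L_real: "bij_betw ?L (coords d') (coords d)"
    by (subst bij_betw_cong[OF L]) auto
  have "bij_betw (?s \<circ> T) ({..<d'} \<rightarrow>\<^sub>E \<int>) ({..<d} \<rightarrow>\<^sub>E \<int>)"
    by (rule bij_betw_trans[OF T_lattice shift_bij_lattice[OF c_int]])
  then have L_lattice: "bij_betw ?L ({..<d'} \<rightarrow>\<^sub>E \<int>) ({..<d} \<rightarrow>\<^sub>E \<int>)"
    by (subst bij_betw_cong[OF L]) (auto simp: PiE_iff)
  show "d' \<le> d" by (rule lattice_bijection_dim_le[OF L_lattice])
  assume A: "?A \<in> sets (lebesgue_on_coords d)"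
  have "shift d c \<in> lebesgue_on_coords d \<rightarrow>\<^sub>M lebesgue_on_coords d"
    unfolding shift_def by measurable
  from measurable_sets[OF this A]
  have sA: "shift d c -` ?A \<inter> coords d \<in> sets (lebesgue_on_coords d)" by simp
  have "{y \<in> coords d'. ?g y \<in> P} = ?L -` (shift d c -` ?A \<inter> coords d) \<inter> coords d'"
    using T_chart cM by (auto simp: shift_def)
  then show "emeasure (lebesgue_on_coords d') {y \<in> coords d'. ?g y \<in> P} = emeasure (lebesgue_on_coords d) ?A"
    using emeasure_vimage_linmap[OF L_real L_lattice sA] emeasure_shift_vimage[OF A, of c] by simp
qed

theorem normalized_volume_eq:
  assumes chart: "lattice_chart P d p b"
    and A: "{x \<in> coords d. affine_chart d p b x \<in> P} \<in> sets (lebesgue_on_coords d)"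
  shows "normalized_volume P = fact d * measure (lebesgue_on_coords d) {x \<in> coords d. affine_chart d p b x \<in> P}"
  unfolding normalized_volume_def
proof (rule the_equality)
  fix vol assume "\<exists>d p b. lattice_chart P d p b \<and> vol = fact d * measure (lebesgue_on_coords d)
                      {x \<in> {..<d} \<rightarrow>\<^sub>E UNIV. affine_chart d p b x \<in> P}"
  then obtain d' p' b' where chart': "lattice_chart P d' p' b'"
    and vol: "vol = fact d' * measure (lebesgue_on_coords d') {x \<in> coords d'. affine_chart d' p' b' x \<in> P}"
    by blast
  have "d' = d"
    using lattice_chart_change(1)[OF chart chart'] lattice_chart_change(1)[OF chart' chart] by simp
  then show "vol = fact d * measure (lebesgue_on_coords d) {x \<in> coords d. affine_chart d p b x \<in> P}"
    unfolding vol using lattice_chart_change(2)[OF chart chart' A] by (simp add: measure_def)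
qed (use chart in blast)

section \<open>Integration over a region of flows\<close>

text \<open>With the factor \<open>1 / fact n\<close>, convolution of powers has all coefficients equal to one.\<close>

definition divided_power :: "nat \<Rightarrow> real \<Rightarrow> real" where
  "divided_power n x = x ^ n / fact n"

lemma divided_power_0 [simp]: "divided_power 0 x = 1"
  by (simp add: divided_power_def)

lemma divided_power_nonneg: "0 \<le> x \<Longrightarrow> 0 \<le> divided_power n x"
  by (simp add: divided_power_def)

lemma divided_power_Suc_0 [simp]: "divided_power (Suc n) 0 = 0"
  by (simp add: divided_power_def)

lemma measurable_divided_power [measurable]: "divided_power n \<in> borel_measurable borel"
  unfolding divided_power_def by measurable

lemma DERIV_divided_power:
  "(divided_power (Suc n) has_real_derivative divided_power n x) (at x)"
proof -
  have "((\<lambda>x. x ^ Suc n / fact (Suc n)) has_real_derivative real (Suc n) * x ^ (Suc n - Suc 0) / fact (Suc n)) (at x)"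
    by (intro DERIV_cdivide DERIV_pow)
  moreover have "real (Suc n) * x ^ (Suc n - Suc 0) / fact (Suc n) = divided_power n x"
    unfolding divided_power_def fact_Suc by (simp del: of_nat_Suc)
  ultimately show ?thesis by (simp only: divided_power_def[abs_def])
qed

text \<open>The derivative of the sum telescopes, and the boundary term left over is the integrand.\<close>

lemma DERIV_convolution:
  "((\<lambda>y. - (\<Sum>s\<le>k. divided_power (k - s) (b + y) * divided_power (m + s + 1) (a - y)))
     has_real_derivative divided_power k (b + y) * divided_power m (a - y)) (at y)"
proof (induction k arbitrary: m)
  case 0
  have "((\<lambda>y. - divided_power (Suc m) (a - y)) has_real_derivative - (divided_power m (a - y) * (- 1))) (at y)"
    by (intro derivative_intros DERIV_chain'[OF _ DERIV_divided_power]) (auto intro!: derivative_eq_intros)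
  then show ?case by simp
next
  case (Suc k)
  have 1: "((\<lambda>y. divided_power (Suc k) (b + y)) has_real_derivative divided_power k (b + y) * 1) (at y)"
    by (intro DERIV_chain'[OF _ DERIV_divided_power]) (auto intro!: derivative_eq_intros)
  have 2: "((\<lambda>y. divided_power (Suc m) (a - y)) has_real_derivative divided_power m (a - y) * (- 1)) (at y)"
    by (intro DERIV_chain'[OF _ DERIV_divided_power]) (auto intro!: derivative_eq_intros)
  have "(\<lambda>y. - (\<Sum>s\<le>Suc k. divided_power (Suc k - s) (b + y) * divided_power (m + s + 1) (a - y))) =
    (\<lambda>y. - (divided_power (Suc k) (b + y) * divided_power (Suc m) (a - y)) +
       - (\<Sum>s\<le>k. divided_power (k - s) (b + y) * divided_power (Suc m + s + 1) (a - y)))"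
    by (subst sum.atMost_Suc_shift) (simp add: fun_eq_iff)
  then show ?case
    using DERIV_add[OF DERIV_minus[OF DERIV_mult[OF 1 2]] Suc.IH[of "Suc m"]] by (simp add: algebra_simps)
qed

lemma nn_integral_convolution:
  assumes "0 \<le> a" "0 \<le> b"
  shows "(\<integral>\<^sup>+y. ennreal (divided_power k (b + y) * divided_power m (a - y)) * indicator {0..a} y \<partial>lborel) =
    ennreal (\<Sum>s\<le>k. divided_power (k - s) b * divided_power (m + s + 1) a)"
proof -
  let ?F = "\<lambda>y. - (\<Sum>s\<le>k. divided_power (k - s) (b + y) * divided_power (m + s + 1) (a - y))"
  have "(\<integral>\<^sup>+y. ennreal (divided_power k (b + y) * divided_power m (a - y)) * indicator {0..a} y \<partial>lborel) =
      ennreal (?F a - ?F 0)"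
  proof (rule nn_integral_FTC_Icc)
    fix y assume y: "y \<in> {0..a}"
    show "(?F has_real_derivative divided_power k (b + y) * divided_power m (a - y)) (at y)"
      by (rule DERIV_convolution)
    show "0 \<le> divided_power k (b + y) * divided_power m (a - y)"
      using y assms by (intro mult_nonneg_nonneg divided_power_nonneg) auto
  qed (use assms in auto)
  then show ?thesis by simp
qed

text \<open>Edges \<open>0, \<dots>, D - 1\<close> carry a variable flow each. The edge with the largest index is the outermost
  variable of integration. By \<open>head_neq_tail\<close>, edges with smaller indices never lead back to
  its tail, so what it may carry is bounded exactly by the amount present there.\<close>

locale edge_sequence =
  fixes tail head :: "nat \<Rightarrow> nat" and D :: nat and U :: "nat set"
  assumes finite_U [simp]: "finite U"
    and tail_in: "i < D \<Longrightarrow> tail i \<in> U" and head_in: "i < D \<Longrightarrow> head i \<in> U"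
    and head_neq_tail: "i \<le> j \<Longrightarrow> j < D \<Longrightarrow> head i \<noteq> tail j"
begin

definition balance :: "nat \<Rightarrow> (nat \<Rightarrow> real) \<Rightarrow> nat \<Rightarrow> real" where
  "balance d x v = (\<Sum>i<d. x i * (of_bool (head i = v) - of_bool (tail i = v)))"

text \<open>The flows along the first \<open>d\<close> edges that can be realised when \<open>c v\<close> units are present at each
  vertex \<open>v\<close>.\<close>

definition region :: "nat \<Rightarrow> (nat \<Rightarrow> real) \<Rightarrow> (nat \<Rightarrow> real) set" where
  "region d c = {x \<in> coords d. (\<forall>i\<in>{..<d}. 0 \<le> x i) \<and> (\<forall>v\<in>U. 0 \<le> c v + balance d x v)}"

definition outflow :: "nat \<Rightarrow> (nat \<Rightarrow> nat) \<Rightarrow> nat \<Rightarrow> nat" where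
  "outflow d t v = (\<Sum>i | i < d \<and> tail i = v. t i + 1)"

definition inflow :: "nat \<Rightarrow> (nat \<Rightarrow> nat) \<Rightarrow> nat \<Rightarrow> nat" where
  "inflow d t v = (\<Sum>i | i < d \<and> head i = v. t i)"

definition exponents :: "nat \<Rightarrow> (nat \<Rightarrow> nat) set" where
  "exponents d = {t \<in> {..<d} \<rightarrow>\<^sub>E UNIV. \<forall>v\<in>U. inflow d t v \<le> outflow d t v}"

text \<open>The degree in \<open>c v\<close> of the term that belongs to \<open>t\<close> in the polynomial volume of the region.\<close>

definition slack :: "nat \<Rightarrow> (nat \<Rightarrow> nat) \<Rightarrow> nat \<Rightarrow> nat" where
  "slack d t v = outflow d t v - inflow d t v"

definition monomial :: "(nat \<Rightarrow> nat) \<Rightarrow> (nat \<Rightarrow> real) \<Rightarrow> real" where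
  "monomial q c = (\<Prod>v\<in>U. divided_power (q v) (c v))"

definition move :: "nat \<Rightarrow> real \<Rightarrow> (nat \<Rightarrow> real) \<Rightarrow> nat \<Rightarrow> real" where
  "move i y c v = c v + y * (of_bool (head i = v) - of_bool (tail i = v))"

lemma region_sets [measurable]: "region d c \<in> sets (lebesgue_on_coords d)"
proof -
  have c: "(\<lambda>x. x i) \<in> lebesgue_on_coords d \<rightarrow>\<^sub>M borel" if "i < d" for i
    using measurable_component_singleton[of i "{..<d}" "\<lambda>_. lborel :: real measure"] that by simp
  have b: "(\<lambda>x. c v + balance d x v) \<in> borel_measurable (lebesgue_on_coords d)" for v
    unfolding balance_def
    by (intro borel_measurable_add borel_measurable_const borel_measurable_sum borel_measurable_times c) simp
  have "{x \<in> space (lebesgue_on_coords d). 0 \<le> x i} \<in> sets (lebesgue_on_coords d)" if "i \<in> {..<d}" for i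
    by (rule borel_measurable_le[OF borel_measurable_const c]) (use that in simp)
  moreover have "{x \<in> space (lebesgue_on_coords d). 0 \<le> c v + balance d x v} \<in> sets (lebesgue_on_coords d)" for v
    by (rule borel_measurable_le[OF borel_measurable_const b])
  ultimately have "{x \<in> space (lebesgue_on_coords d). (\<forall>i\<in>{..<d}. 0 \<le> x i) \<and> (\<forall>v\<in>U. 0 \<le> c v + balance d x v)}
      \<in> sets (lebesgue_on_coords d)"
    by (intro sets.sets_Collect_conj sets.sets_Collect_finite_All) simp_all
  then show ?thesis unfolding region_def space_coords .
qed

lemma monomial_nonneg: "(\<And>v. v \<in> U \<Longrightarrow> 0 \<le> c v) \<Longrightarrow> 0 \<le> monomial q c"
  unfolding monomial_def by (intro prod_nonneg divided_power_nonneg) auto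

lemma monomial_split:
  assumes "v \<in> U" "w \<in> U" "v \<noteq> w"
  shows "monomial q c = divided_power (q w) (c w) * divided_power (q v) (c v) *
           (\<Prod>u\<in>U - {v, w}. divided_power (q u) (c u))"
proof -
  have "U - {w} - {v} = U - {v, w}" by auto
  then show ?thesis
    unfolding monomial_def using assms
    by (subst prod.remove[of U w], simp, simp, subst prod.remove[of "U - {w}" v]) (auto simp: mult.assoc)
qed

text \<open>Only the factors of the two ends of the edge depend on its flow \<open>y\<close>, and their product is a
  convolution.\<close>

lemma nn_integral_monomial_move:
  assumes c: "\<And>v. v \<in> U \<Longrightarrow> 0 \<le> c v" and i: "i < D"
  shows "(\<integral>\<^sup>+y. ennreal (monomial q (move i y c)) * indicator {0..c (tail i)} y \<partial>lborel) =
    ennreal (\<Sum>s\<le>q (head i). monomial (q(head i := q (head i) - s, tail i := q (tail i) + s + 1)) c)"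
proof -
  let ?v = "tail i" and ?w = "head i"
  have vw: "?v \<in> U" "?w \<in> U" "?v \<noteq> ?w" using tail_in head_in head_neq_tail[of i i] i by auto
  let ?R = "\<Prod>u\<in>U - {?v, ?w}. divided_power (q u) (c u)"
  have R: "0 \<le> ?R" using c by (intro prod_nonneg divided_power_nonneg) auto
  have rest: "(\<Prod>u\<in>U - {?v, ?w}. divided_power (q u) (move i y c u)) = ?R" for y
    by (rule prod.cong) (auto simp: move_def)
  have "monomial q (move i y c) = ?R * (divided_power (q ?w) (c ?w + y) * divided_power (q ?v) (c ?v - y))" for y
    unfolding monomial_split[OF vw, of q "move i y c"] rest using vw by (simp add: move_def)
  then have "(\<integral>\<^sup>+y. ennreal (monomial q (move i y c)) * indicator {0..c ?v} y \<partial>lborel) =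
    (\<integral>\<^sup>+y. ennreal ?R * (ennreal (divided_power (q ?w) (c ?w + y) * divided_power (q ?v) (c ?v - y)) * indicator {0..c ?v} y) \<partial>lborel)"
    using R by (intro nn_integral_cong) (simp add: ennreal_mult' mult.assoc)
  also have "\<dots> = ennreal ?R * ennreal (\<Sum>s\<le>q ?w. divided_power (q ?w - s) (c ?w) * divided_power (q ?v + s + 1) (c ?v))"
    using vw c by (subst nn_integral_cmult) (simp_all add: nn_integral_convolution)
  also have "\<dots> = ennreal (\<Sum>s\<le>q ?w. ?R * (divided_power (q ?w - s) (c ?w) * divided_power (q ?v + s + 1) (c ?v)))"
    using R by (simp add: ennreal_mult'[symmetric] sum_distrib_left)
  also have "(\<Sum>s\<le>q ?w. ?R * (divided_power (q ?w - s) (c ?w) * divided_power (q ?v + s + 1) (c ?v))) =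
    (\<Sum>s\<le>q ?w. monomial (q(?w := q ?w - s, ?v := q ?v + s + 1)) c)"
  proof (rule sum.cong[OF refl])
    fix s
    have "(\<Prod>u\<in>U - {?v, ?w}. divided_power ((q(?w := q ?w - s, ?v := q ?v + s + 1)) u) (c u)) = ?R"
      by (rule prod.cong) auto
    then show "?R * (divided_power (q ?w - s) (c ?w) * divided_power (q ?v + s + 1) (c ?v)) =
      monomial (q(?w := q ?w - s, ?v := q ?v + s + 1)) c"
      unfolding monomial_split[OF vw, of "q(?w := q ?w - s, ?v := q ?v + s + 1)" c] using vw by simp
  qed
  finally show ?thesis .
qed

lemma outflow_upd: "outflow (Suc d) (t(d := s)) v = outflow d t v + (if tail d = v then s + 1 else 0)"
proof -
  have "{i. i < Suc d \<and> tail i = v} = {i. i < d \<and> tail i = v} \<union> (if tail d = v then {d} else {})"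
    by (auto simp: less_Suc_eq)
  then show ?thesis
    unfolding outflow_def by (auto simp: sum.union_disjoint intro!: sum.cong)
qed

lemma inflow_upd: "inflow (Suc d) (t(d := s)) v = inflow d t v + (if head d = v then s else 0)"
proof -
  have "{i. i < Suc d \<and> head i = v} = {i. i < d \<and> head i = v} \<union> (if head d = v then {d} else {})"
    by (auto simp: less_Suc_eq)
  then show ?thesis
    unfolding inflow_def by (auto simp: sum.union_disjoint intro!: sum.cong)
qed

text \<open>This is where the order of the edges enters: no degree is taken away from the tail of an edge
  before the edge itself is processed.\<close>

lemma inflow_tail:
  assumes "d < D" shows "inflow d t (tail d) = 0"
proof -
  have "{i. i < d \<and> head i = tail d} = {}" using head_neq_tail[of _ d] assms by auto
  then show ?thesis unfolding inflow_def by (simp only: sum.empty)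
qed

text \<open>Only the head of the new edge loses degree, so its slack bounds the new exponent.\<close>

lemma exponents_Suc:
  assumes d: "d < D"
  shows "bij_betw (\<lambda>(t, s). t(d := s)) (SIGMA t:exponents d. {..slack d t (head d)}) (exponents (Suc d))"
proof (rule bij_betwI[where g = "\<lambda>t. (restrict t {..<d}, t d)"])
  have neq: "head d \<noteq> tail d" using head_neq_tail[of d d] d by simp
  show "(\<lambda>(t, s). t(d := s)) \<in> (SIGMA t:exponents d. {..slack d t (head d)}) \<rightarrow> exponents (Suc d)"
  proof clarify
    fix t s assume t: "t \<in> exponents d" and s: "s \<le> slack d t (head d)"
    have "t(d := s) \<in> {..<Suc d} \<rightarrow>\<^sub>E UNIV"
      using t by (simp add: exponents_def PiE_iff extensional_def)
    moreover have "inflow (Suc d) (t(d := s)) v \<le> outflow (Suc d) (t(d := s)) v" if "v \<in> U" for v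
    proof -
      have "inflow d t v \<le> outflow d t v" using t that by (simp add: exponents_def)
      then show ?thesis
        using s neq by (cases "v = head d") (auto simp: inflow_upd outflow_upd slack_def)
    qed
    ultimately show "t(d := s) \<in> exponents (Suc d)" by (simp add: exponents_def)
  qed
  have restore: "(restrict t {..<d})(d := t d) = t" if "t \<in> {..<Suc d} \<rightarrow>\<^sub>E UNIV" for t
  proof
    fix i show "((restrict t {..<d})(d := t d)) i = t i"
      using that by (cases "i < d") (auto simp: PiE_iff extensional_def)
  qed
  show "(\<lambda>t. (restrict t {..<d}, t d)) \<in> exponents (Suc d) \<rightarrow> (SIGMA t:exponents d. {..slack d t (head d)})"
  proof
    fix t assume t: "t \<in> exponents (Suc d)"
    let ?r = "restrict t {..<d}"
    have *: "inflow d ?r v + (if head d = v then t d else 0) \<le> outflow d ?r v + (if tail d = v then t d + 1 else 0)"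
      if "v \<in> U" for v
    proof -
      have "t \<in> {..<Suc d} \<rightarrow>\<^sub>E UNIV" and le: "inflow (Suc d) t v \<le> outflow (Suc d) t v"
        using t that unfolding exponents_def by blast+
      then have "?r(d := t d) = t" by (intro restore)
      then show ?thesis
        using le inflow_upd[of d ?r "t d" v] outflow_upd[of d ?r "t d" v] by (simp only:)
    qed
    have "inflow d ?r v \<le> outflow d ?r v" if "v \<in> U" for v
      using *[OF that] inflow_tail[OF d, of ?r] by (cases "tail d = v") auto
    then show "(?r, t d) \<in> (SIGMA t:exponents d. {..slack d t (head d)})"
      using *[OF head_in[OF d]] neq by (auto simp: exponents_def slack_def)
  qed
  show "(\<lambda>t. (restrict t {..<d}, t d)) ((\<lambda>(t, s). t(d := s)) z) = z"
    if z: "z \<in> (SIGMA t:exponents d. {..slack d t (head d)})" for z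
  proof -
    obtain t s where ts: "z = (t, s)" "t \<in> exponents d" using z by blast
    have "restrict (t(d := s)) {..<d} = t"
    proof
      fix i show "restrict (t(d := s)) {..<d} i = t i"
        using ts(2) by (cases "i < d") (simp_all add: exponents_def PiE_iff extensional_def)
    qed
    then show ?thesis using ts(1) by simp
  qed
  show "(\<lambda>(t, s). t(d := s)) (restrict t {..<d}, t d) = t" if t: "t \<in> exponents (Suc d)" for t
  proof -
    have "t \<in> {..<Suc d} \<rightarrow>\<^sub>E UNIV" using t unfolding exponents_def by blast
    then show ?thesis by (simp only: prod.case restore)
  qed
qed

lemma slack_upd:
  assumes "d < D"
  shows "slack (Suc d) (t(d := s)) = (slack d t)(head d := slack d t (head d) - s, tail d := slack d t (tail d) + s + 1)"
proof
  fix v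
  have neq: "head d \<noteq> tail d" using head_neq_tail[of d d] assms by simp
  consider "v = head d" | "v = tail d" | "v \<noteq> head d" "v \<noteq> tail d" by blast
  then show "slack (Suc d) (t(d := s)) v =
      ((slack d t)(head d := slack d t (head d) - s, tail d := slack d t (tail d) + s + 1)) v"
  proof cases
    case 1 then show ?thesis using neq by (simp add: slack_def inflow_upd outflow_upd)
  next
    case 2 then show ?thesis
      using neq inflow_tail[OF assms, of t] by (simp add: slack_def inflow_upd outflow_upd)
  next
    case 3 then show ?thesis by (simp add: slack_def inflow_upd outflow_upd)
  qed
qed

lemma exponents_0: "exponents 0 = {\<lambda>_. undefined}"
  by (simp add: exponents_def inflow_def)

lemma finite_exponents: "d \<le> D \<Longrightarrow> finite (exponents d)"
proof (induction d)
  case (Suc d)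
  then have "finite (SIGMA t:exponents d. {..slack d t (head d)})" by auto
  then show ?case using bij_betw_finite[OF exponents_Suc[of d]] Suc.prems by simp
qed (simp add: exponents_0)

text \<open>Fubini, outermost variable first. Given the flow \<open>y\<close> on edge \<open>d\<close>, the slice is the region for the
  first \<open>d\<close> edges with \<open>y\<close> units moved along edge \<open>d\<close>, and it is empty for \<open>y\<close> greater than the amount
  at the tail. So the formula for \<open>d\<close> edges is integrated over an interval, term by term, and the
  new terms correspond to the choices of one more exponent.\<close>

theorem emeasure_region:
  assumes "d \<le> D" "\<And>v. v \<in> U \<Longrightarrow> 0 \<le> c v"
  shows "emeasure (lebesgue_on_coords d) (region d c) = ennreal (\<Sum>t\<in>exponents d. monomial (slack d t) c)"
  using assms
proof (induction d arbitrary: c)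
  case 0
  have "region 0 c = {\<lambda>_. undefined}" using 0 by (auto simp: region_def balance_def)
  then show ?case
    by (simp add: exponents_0 slack_def[abs_def] inflow_def outflow_def monomial_def PiM_empty)
next
  case (Suc d)
  let ?v = "tail d" and ?w = "head d"
  have d: "d < D" using Suc.prems by simp
  have vU: "?v \<in> U" using tail_in d by simp
  have region_upd: "x(d := y) \<in> region (Suc d) c \<longleftrightarrow> 0 \<le> y \<and> x \<in> region d (move d y c)"
    if x: "x \<in> coords d" for x y
  proof -
    have "x(d := y) \<in> coords (Suc d)" using x by (auto simp: PiE_iff extensional_def)
    moreover have "c v + balance (Suc d) (x(d := y)) v = move d y c v + balance d x v" for v
      unfolding balance_def move_def by (auto intro!: sum.cong)
    moreover have "(\<forall>i\<in>{..<Suc d}. 0 \<le> (x(d := y)) i) \<longleftrightarrow> 0 \<le> y \<and> (\<forall>i\<in>{..<d}. 0 \<le> x i)"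
      by (auto simp: lessThan_Suc)
    ultimately show ?thesis using x unfolding region_def by auto
  qed
  have region_empty: "region d (move d y c) = {}" if y: "c ?v < y" for y
  proof (rule ccontr)
    assume "region d (move d y c) \<noteq> {}"
    then obtain x where x: "x \<in> region d (move d y c)" by blast
    have "balance d x ?v = (\<Sum>i<d. x i * (- of_bool (tail i = ?v)))"
      unfolding balance_def using head_neq_tail[of _ d] d by (intro sum.cong) auto
    also have "\<dots> \<le> 0" using x by (intro sum_nonpos) (auto simp: region_def)
    moreover have "0 \<le> move d y c ?v + balance d x ?v" using x vU by (auto simp: region_def)
    moreover have "move d y c ?v = c ?v - y" using head_neq_tail[of d d] d by (simp add: move_def)
    ultimately show False using y by linarith
  qed
  have inner: "(\<integral>\<^sup>+x. indicator (region (Suc d) c) (x(d := y)) \<partial>lebesgue_on_coords d) =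
     (\<Sum>t\<in>exponents d. ennreal (monomial (slack d t) (move d y c)) * indicator {0..c ?v} y)" for y
  proof -
    have "(\<integral>\<^sup>+x. indicator (region (Suc d) c) (x(d := y)) \<partial>lebesgue_on_coords d) =
       (\<integral>\<^sup>+x. indicator {0..} y * indicator (region d (move d y c)) x \<partial>lebesgue_on_coords d)"
      by (intro nn_integral_cong) (auto simp: region_upd indicator_def)
    also have "\<dots> = indicator {0..} y * emeasure (lebesgue_on_coords d) (region d (move d y c))"
      by (simp add: nn_integral_cmult)
    also have "\<dots> = indicator {0..c ?v} y * ennreal (\<Sum>t\<in>exponents d. monomial (slack d t) (move d y c))"
    proof (cases "y \<in> {0..c ?v}")
      case True
      then have "0 \<le> move d y c v" if "v \<in> U" for v
        using Suc.prems(2)[OF that] head_neq_tail[of d d] d by (auto simp: move_def)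
      then show ?thesis using Suc.IH[of "move d y c"] d True by simp
    next
      case False
      then show ?thesis using region_empty[of y] by (cases "y < 0") auto
    qed
    also have "\<dots> = (\<Sum>t\<in>exponents d. ennreal (monomial (slack d t) (move d y c)) * indicator {0..c ?v} y)"
    proof (cases "y \<in> {0..c ?v}")
      case True
      then have "0 \<le> move d y c v" if "v \<in> U" for v
        using Suc.prems(2)[OF that] head_neq_tail[of d d] d by (auto simp: move_def)
      then show ?thesis using True by (simp add: sum_ennreal monomial_nonneg)
    qed simp
    finally show ?thesis .
  qed
  have mon_meas: "(\<lambda>y. monomial q (move d y c)) \<in> borel_measurable borel" for q
    unfolding monomial_def move_def by measurable
  have "emeasure (lebesgue_on_coords (Suc d)) (region (Suc d) c) =
     (\<integral>\<^sup>+x. indicator (region (Suc d) c) x \<partial>(\<Pi>\<^sub>M i\<in>insert d {..<d}. lborel))"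
    by (simp add: lessThan_Suc[symmetric])
  also have "\<dots> = (\<integral>\<^sup>+y. (\<integral>\<^sup>+x. indicator (region (Suc d) c) (x(d := y)) \<partial>lebesgue_on_coords d) \<partial>lborel)"
    by (subst product_sigma_finite.product_nn_integral_insert_rev[OF product_sigma_finite_lborel])
       (auto simp: lessThan_Suc[symmetric])
  also have "\<dots> = (\<Sum>t\<in>exponents d. \<integral>\<^sup>+y. ennreal (monomial (slack d t) (move d y c)) * indicator {0..c ?v} y \<partial>lborel)"
    unfolding inner using mon_meas by (intro nn_integral_sum) auto
  also have "\<dots> = (\<Sum>t\<in>exponents d. ennreal (\<Sum>s\<le>slack d t ?w. monomial (slack (Suc d) (t(d := s))) c))"
    using Suc.prems(2) d by (intro sum.cong refl) (simp add: nn_integral_monomial_move slack_upd)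
  also have "\<dots> = ennreal (\<Sum>t\<in>exponents d. \<Sum>s\<le>slack d t ?w. monomial (slack (Suc d) (t(d := s))) c)"
    using Suc.prems(2) by (intro sum_ennreal sum_nonneg monomial_nonneg) auto
  also have "(\<Sum>t\<in>exponents d. \<Sum>s\<le>slack d t ?w. monomial (slack (Suc d) (t(d := s))) c) =
     (\<Sum>(t, s)\<in>(SIGMA t:exponents d. {..slack d t ?w}). monomial (slack (Suc d) (t(d := s))) c)"
    using finite_exponents[of d] d by (intro sum.Sigma) auto
  also have "\<dots> = (\<Sum>t\<in>exponents (Suc d). monomial (slack (Suc d) t) c)"
    using sum.reindex_bij_betw[OF exponents_Suc[OF d], of "\<lambda>t. monomial (slack (Suc d) t) c"]
    by (simp add: case_prod_unfold)
  finally show ?case .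
qed

end

section \<open>Volumes of flow polytopes of augmented graphs\<close>

lemma affine_funD:
  assumes "affine_fun S" "f \<in> S" "g \<in> S"
  shows "(\<lambda>e. u * f e + (1 - u) * g e) \<in> S"
proof -
  have "u + (1 - u) = 1" by simp
  then show ?thesis using assms unfolding affine_fun_def by blast
qed

lemma edges_iff: "(e, c) \<in> edges G \<longleftrightarrow> c < count (snd G) e"
  by (auto simp: edges_def simp flip: count_greater_zero_iff)

lemma finite_edges: "finite (edges G)"
  unfolding edges_def by auto

definition source_edge :: "nat \<Rightarrow> nat edge" where
  "source_edge v = ((0, v), 0)"

definition sink_edge :: "nat \<Rightarrow> nat \<Rightarrow> nat edge" where
  "sink_edge n v = ((v, n + 2), 0)"

lemma endpoints [simp]:
  "initial (source_edge v) = 0" "final (source_edge v) = v"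
  "initial (sink_edge n v) = v" "final (sink_edge n v) = n + 2"
  by (simp_all add: source_edge_def sink_edge_def initial_def final_def)

lemma source_edge_inject [simp]: "source_edge v = source_edge w \<longleftrightarrow> v = w"
  by (simp add: source_edge_def)

lemma sink_edge_inject [simp]: "sink_edge n v = sink_edge n w \<longleftrightarrow> v = w"
  by (simp add: sink_edge_def)

locale augmented_graph =
  fixes n :: nat and G :: "nat multigraph"
  assumes ordered: "ordered_multigraph G" and vertices: "fst G = {1..n + 1}"
begin

abbreviation "E \<equiv> edges G"

lemma edge_bounds: "e \<in> E \<Longrightarrow> 1 \<le> initial e \<and> initial e < final e \<and> final e \<le> n + 1"
  using ordered unfolding ordered_multigraph_def vertices
  by (cases e) (auto simp: edges_def initial_def final_def)

lemma source_notin_E [simp]: "source_edge v \<notin> E" and sink_notin_E [simp]: "sink_edge n v \<notin> E"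
  using edge_bounds[of "source_edge v"] edge_bounds[of "sink_edge n v"] by auto

lemma edges_augment:
  "edges (augment n G) = E \<union> source_edge ` {1..n + 1} \<union> sink_edge n ` {1..n + 1}"
proof (rule set_eqI)
  fix e :: "nat edge"
  obtain i j c where e: "e = ((i, j), c)" by (cases e) auto
  have G: "count (snd G) (i, j) > 0 \<Longrightarrow> 1 \<le> i \<and> j \<le> n + 1"
    using edge_bounds[of "((i, j), 0)"] by (auto simp: edges_iff initial_def final_def)
  have "count (snd (augment n G)) (i, j) = count (snd G) (i, j) +
     of_bool (i = 0 \<and> j \<in> {1..n + 1}) + of_bool (j = n + 2 \<and> i \<in> {1..n + 1})"
    by (auto simp: augment_def count_mset_set' image_iff)
  moreover have "((i, j), c) \<in> source_edge ` A \<longleftrightarrow> i = 0 \<and> c = 0 \<and> j \<in> A"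
    "((i, j), c) \<in> sink_edge n ` A \<longleftrightarrow> j = n + 2 \<and> c = 0 \<and> i \<in> A" for A
    by (auto simp: source_edge_def sink_edge_def)
  moreover have "count (snd G) (i, j) = 0" if "i = 0 \<or> j = n + 2"
    using G that by (cases "count (snd G) (i, j)") auto
  ultimately show "e \<in> edges (augment n G) \<longleftrightarrow> e \<in> E \<union> source_edge ` {1..n + 1} \<union> sink_edge n ` {1..n + 1}"
    unfolding e edges_iff Un_iff by (cases "i = 0"; cases "j = n + 2") auto
qed

text \<open>Each conservation law is solved for the flow on the edge to the sink. Summed over all vertices,
  these laws imply the condition at the sink.\<close>

definition flow_space :: "(nat edge \<Rightarrow> real) set" where
  "flow_space = {f. (\<forall>e. e \<notin> edges (augment n G) \<longrightarrow> f e = 0) \<and>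
     (\<Sum>v=1..n + 1. f (source_edge v)) = 1 \<and>
     (\<forall>v\<in>{1..n + 1}. f (sink_edge n v) = f (source_edge v) +
        (\<Sum>e | e \<in> E \<and> final e = v. f e) - (\<Sum>e | e \<in> E \<and> initial e = v. f e))}"

lemma sum_over_vertices:
  fixes g :: "nat edge \<Rightarrow> 'a :: comm_monoid_add"
  shows "(\<Sum>v=1..n + 1. \<Sum>e | e \<in> E \<and> final e = v. g e) = (\<Sum>e\<in>E. g e)"
    "(\<Sum>v=1..n + 1. \<Sum>e | e \<in> E \<and> initial e = v. g e) = (\<Sum>e\<in>E. g e)"
proof -
  have "final ` E \<subseteq> {1..n + 1}" "initial ` E \<subseteq> {1..n + 1}" using edge_bounds by fastforce+
  note bounds = this
  show "(\<Sum>v=1..n + 1. \<Sum>e | e \<in> E \<and> final e = v. g e) = (\<Sum>e\<in>E. g e)"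
    by (rule sum.group[OF finite_edges finite_atLeastAtMost bounds(1)])
  show "(\<Sum>v=1..n + 1. \<Sum>e | e \<in> E \<and> initial e = v. g e) = (\<Sum>e\<in>E. g e)"
    by (rule sum.group[OF finite_edges finite_atLeastAtMost bounds(2)])
qed

lemma flow_polytope_augment:
  "flow_polytope (augment n G) = {f \<in> flow_space. \<forall>e\<in>edges (augment n G). 0 \<le> f e}"
proof (rule set_eqI)
  fix f :: "nat edge \<Rightarrow> real"
  let ?H = "edges (augment n G)"
  have ends: "Min (fst (augment n G)) = 0" "Max (fst (augment n G)) = n + 2"
    and inner: "fst (augment n G) - {0, n + 2} = {1..n + 1}"
    by (auto simp: augment_def intro!: Max_eqI Min_eqI)
  have "{e \<in> ?H. initial e = 0} = source_edge ` {1..n + 1}"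
    using edge_bounds by (fastforce simp: edges_augment)
  then have out_s: "(\<Sum>e | e \<in> ?H \<and> initial e = 0. f e) = (\<Sum>v=1..n + 1. f (source_edge v))"
    by (simp add: sum.reindex inj_on_def)
  have "{e \<in> ?H. final e = n + 2} = sink_edge n ` {1..n + 1}"
    using edge_bounds by (fastforce simp: edges_augment)
  then have in_t: "(\<Sum>e | e \<in> ?H \<and> final e = n + 2. f e) = (\<Sum>v=1..n + 1. f (sink_edge n v))"
    by (simp add: sum.reindex inj_on_def)
  have in_v: "(\<Sum>e | e \<in> ?H \<and> final e = v. f e) = f (source_edge v) + (\<Sum>e | e \<in> E \<and> final e = v. f e)"
    if v: "v \<in> {1..n + 1}" for v
  proof -
    have "{e \<in> ?H. final e = v} = insert (source_edge v) {e \<in> E. final e = v}"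
      using v by (auto simp: edges_augment)
    then show ?thesis using finite_edges[of G] by simp
  qed
  have out_v: "(\<Sum>e | e \<in> ?H \<and> initial e = v. f e) = f (sink_edge n v) + (\<Sum>e | e \<in> E \<and> initial e = v. f e)"
    if v: "v \<in> {1..n + 1}" for v
  proof -
    have "{e \<in> ?H. initial e = v} = insert (sink_edge n v) {e \<in> E. initial e = v}"
      using v by (auto simp: edges_augment)
    then show ?thesis using finite_edges[of G] by simp
  qed
  have conservation: "(\<forall>v\<in>{1..n + 1}. (\<Sum>e | e \<in> ?H \<and> final e = v. f e) = (\<Sum>e | e \<in> ?H \<and> initial e = v. f e))
    \<longleftrightarrow> (\<forall>v\<in>{1..n + 1}. f (sink_edge n v) = f (source_edge v) +
        (\<Sum>e | e \<in> E \<and> final e = v. f e) - (\<Sum>e | e \<in> E \<and> initial e = v. f e))"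
    by (intro ball_cong refl) (auto simp: in_v out_v)
  have total: "(\<Sum>v=1..n + 1. f (sink_edge n v)) = (\<Sum>v=1..n + 1. f (source_edge v))" if "f \<in> flow_space"
  proof -
    have "(\<Sum>v=1..n + 1. f (sink_edge n v)) = (\<Sum>v=1..n + 1. f (source_edge v) +
        (\<Sum>e | e \<in> E \<and> final e = v. f e) - (\<Sum>e | e \<in> E \<and> initial e = v. f e))"
      using that by (intro sum.cong refl) (simp add: flow_space_def)
    then show ?thesis by (simp only: sum.distrib sum_subtractf sum_over_vertices)
  qed
  show "f \<in> flow_polytope (augment n G) \<longleftrightarrow> f \<in> {f \<in> flow_space. \<forall>e\<in>?H. 0 \<le> f e}"
    using total unfolding flow_polytope_def ends inner out_s in_t mem_Collect_eq conservation
    by (auto simp: flow_space_def)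
qed

lemma affine_flow_space: "affine_fun flow_space"
  unfolding affine_fun_def
proof (intro ballI allI impI)
  fix f g :: "nat edge \<Rightarrow> real" and u w :: real
  assume f: "f \<in> flow_space" and g: "g \<in> flow_space" and uw: "u + w = 1"
  have "(\<Sum>v=1..n + 1. u * f (source_edge v) + w * g (source_edge v)) = 1"
    using f g uw unfolding sum.distrib sum_distrib_left[symmetric] by (simp add: flow_space_def)
  moreover have "u * f (sink_edge n v) + w * g (sink_edge n v) =
     (u * f (source_edge v) + w * g (source_edge v)) + (\<Sum>e | e \<in> E \<and> final e = v. u * f e + w * g e) -
     (\<Sum>e | e \<in> E \<and> initial e = v. u * f e + w * g e)" if "v \<in> {1..n + 1}" for v
  proof -
    have fv: "f (sink_edge n v) = f (source_edge v) +
        (\<Sum>e | e \<in> E \<and> final e = v. f e) - (\<Sum>e | e \<in> E \<and> initial e = v. f e)"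
      and gv: "g (sink_edge n v) = g (source_edge v) +
        (\<Sum>e | e \<in> E \<and> final e = v. g e) - (\<Sum>e | e \<in> E \<and> initial e = v. g e)"
      using f g that by (simp_all add: flow_space_def)
    show ?thesis
      unfolding sum.distrib sum_distrib_left[symmetric] fv gv by (simp add: algebra_simps)
  qed
  ultimately show "(\<lambda>e. u * f e + w * g e) \<in> flow_space"
    using f g by (auto simp: flow_space_def)
qed

lemma ex_positive_flow: "\<exists>f\<in>flow_space. \<forall>e\<in>edges (augment n G). 0 < f e"
proof -
  \<comment> \<open>The flow out of a vertex on edges of \<open>G\<close> stays below the \<open>1 / (n + 1)\<close> that it receives from the
    source.\<close>
  define \<delta> :: real where "\<delta> = 1 / ((real n + 1) * (real (card E) + 1))"
  have \<delta>: "\<delta> > 0" by (simp add: \<delta>_def)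
  define f where "f e = (if e \<in> E then \<delta>
      else if e \<in> source_edge ` {1..n + 1} then 1 / (real n + 1)
      else if e \<in> sink_edge n ` {1..n + 1} then 1 / (real n + 1) +
        (\<Sum>e' | e' \<in> E \<and> final e' = initial e. \<delta>) - (\<Sum>e' | e' \<in> E \<and> initial e' = initial e. \<delta>)
      else 0)" for e
  have source: "f (source_edge v) = 1 / (real n + 1)" if "v \<in> {1..n + 1}" for v
    using that by (auto simp: f_def)
  have "sink_edge n v \<notin> source_edge ` {1..n + 1}" for v
    by (auto simp: source_edge_def sink_edge_def)
  then have sink: "f (sink_edge n v) = 1 / (real n + 1) +
        (\<Sum>e | e \<in> E \<and> final e = v. \<delta>) - (\<Sum>e | e \<in> E \<and> initial e = v. \<delta>)" if "v \<in> {1..n + 1}" for v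
    using that by (auto simp: f_def)
  have "f \<in> flow_space"
    unfolding flow_space_def mem_Collect_eq
  proof (intro conjI allI impI ballI)
    fix e assume "e \<notin> edges (augment n G)"
    then show "f e = 0" by (auto simp: f_def edges_augment)
  next
    show "(\<Sum>v=1..n + 1. f (source_edge v)) = 1" by (simp add: source add.commute)
  next
    fix v assume v: "v \<in> {1..n + 1}"
    have "(\<Sum>e | e \<in> E \<and> P e. f e) = (\<Sum>e | e \<in> E \<and> P e. \<delta>)" for P
      by (rule sum.cong) (auto simp: f_def)
    then show "f (sink_edge n v) = f (source_edge v) +
        (\<Sum>e | e \<in> E \<and> final e = v. f e) - (\<Sum>e | e \<in> E \<and> initial e = v. f e)"
      using v by (simp only: source sink)
  qed
  moreover have "0 < f e" if e: "e \<in> edges (augment n G)" for e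
  proof -
    consider "e \<in> E" | v where "e = source_edge v" "v \<in> {1..n + 1}" | v where "e = sink_edge n v" "v \<in> {1..n + 1}"
      using e unfolding edges_augment by blast
    then show ?thesis
    proof cases
      case 1 then show ?thesis using \<delta> by (simp add: f_def)
    next
      case 2 then show ?thesis by (simp add: source)
    next
      case 3
      have "(\<Sum>e | e \<in> E \<and> initial e = v. \<delta>) \<le> real (card E) * \<delta>"
        using \<delta> finite_edges[of G] by (simp add: card_mono mult_right_mono)
      also have "\<dots> < 1 / (real n + 1)" by (simp add: \<delta>_def divide_simps)
      moreover have "0 \<le> (\<Sum>e | e \<in> E \<and> final e = v. \<delta>)" using \<delta> by (simp add: sum_nonneg)
      ultimately show ?thesis using 3 sink by simp
    qed
  qed
  ultimately show ?thesis by blast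
qed

text \<open>From a flow that is positive on all edges one can move a little in the direction of any other
  point of the flow space without leaving the polytope.\<close>

lemma affine_hull_flow_polytope: "affine_fun hull (flow_polytope (augment n G)) = flow_space"
proof
  let ?P = "flow_polytope (augment n G)" and ?H = "edges (augment n G)"
  show "affine_fun hull ?P \<subseteq> flow_space"
    using affine_flow_space by (intro hull_minimal) (auto simp: flow_polytope_augment)
  have affine_hull: "affine_fun (affine_fun hull ?P)"
    by (rule hull_in) (auto simp: affine_fun_def)
  show "flow_space \<subseteq> affine_fun hull ?P"
  proof
    fix f assume f: "f \<in> flow_space"
    obtain g where g: "g \<in> flow_space" "\<And>e. e \<in> ?H \<Longrightarrow> 0 < g e" using ex_positive_flow by blast
    \<comment> \<open>The fraction of the way from \<open>g\<close> to \<open>f\<close> for which no coordinate can become negative.\<close>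
    define r where "r = Min (insert 1 ((\<lambda>e. g e / (\<bar>f e - g e\<bar> + 1)) ` ?H))"
    have fin: "finite ?H" by (rule finite_edges)
    have r: "0 < r" unfolding r_def using fin g(2) by (subst Min_gr_iff) (auto intro!: divide_pos_pos)
    define h where "h = (\<lambda>e. r * f e + (1 - r) * g e)"
    have "h \<in> flow_space"
      unfolding h_def by (rule affine_funD[OF affine_flow_space f g(1)])
    moreover have "0 \<le> h e" if e: "e \<in> ?H" for e
    proof -
      have "r \<le> g e / (\<bar>f e - g e\<bar> + 1)" unfolding r_def using fin e by (intro Min_le) auto
      then have "r * (\<bar>f e - g e\<bar> + 1) \<le> g e" by (simp add: field_simps)
      moreover have "r * - (f e - g e) \<le> r * \<bar>f e - g e\<bar>" using r by (intro mult_left_mono) auto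
      ultimately show ?thesis using r by (simp add: h_def algebra_simps)
    qed
    ultimately have h: "h \<in> affine_fun hull ?P"
      by (intro hull_inc) (simp add: flow_polytope_augment)
    have g': "g \<in> affine_fun hull ?P"
      using g by (intro hull_inc) (auto simp: flow_polytope_augment intro: less_imp_le)
    have "(\<lambda>e. (1 / r) * h e + (1 - 1 / r) * g e) \<in> affine_fun hull ?P"
      by (rule affine_funD[OF affine_hull h g'])
    moreover have "(\<lambda>e. (1 / r) * h e + (1 - 1 / r) * g e) = f"
      using r by (simp add: h_def fun_eq_iff field_simps)
    ultimately show "f \<in> affine_fun hull ?P" by simp
  qed
qed

text \<open>The coordinates. The reserved edges are \<open>(v, t)\<close> for every inner vertex \<open>v\<close>, and \<open>(s, n + 1)\<close> for
  the source.\<close>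

definition free_edges :: "nat edge set" where
  "free_edges = E \<union> source_edge ` {1..n}"

definition integer_flows :: "(nat edge \<Rightarrow> nat) set" where
  "integer_flows = {a \<in> E \<rightarrow>\<^sub>E UNIV. \<forall>v\<in>{1..n + 1}.
     (\<Sum>e | e \<in> E \<and> final e = v. a e) \<le> (\<Sum>e | e \<in> E \<and> initial e = v. a e + 1)}"

lemma ex_enumeration:
  "\<exists>es. distinct es \<and> set es = free_edges \<and> sorted_wrt (\<lambda>e e'. initial e' \<le> initial e) es"
proof -
  have "finite free_edges" by (simp add: free_edges_def finite_edges)
  then obtain xs where xs: "set xs = free_edges" "distinct xs" using finite_distinct_list by blast
  let ?ys = "rev (sort_key initial xs)"
  have "sorted (map initial (sort_key initial xs))" by (rule sorted_sort_key)
  then have "sorted_wrt (\<lambda>e e'. initial e' \<le> initial e) ?ys"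
    by (simp add: sorted_wrt_rev sorted_wrt_map)
  then show ?thesis using xs by (intro exI[of _ ?ys]) simp
qed

end

text \<open>Edges are listed by decreasing initial vertex, so that those out of the source come last and are
  integrated outermost.\<close>

locale enumerated_graph = augmented_graph +
  fixes es :: "nat edge list"
  assumes distinct: "distinct es" and set_es: "set es = free_edges"
    and sorted: "sorted_wrt (\<lambda>e e'. initial e' \<le> initial e) es"
begin

abbreviation "d \<equiv> length es"

lemma free_edge_bounds: "e \<in> free_edges \<Longrightarrow> initial e < final e \<and> final e \<le> n + 1"
  using edge_bounds by (fastforce simp: free_edges_def)

lemma nth_in: "i < d \<Longrightarrow> es ! i \<in> free_edges"
  using set_es nth_mem by blast

lemma bij_es: "bij_betw ((!) es) {..<d} free_edges"
  using bij_betw_nth[OF distinct refl] set_es by simp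

sublocale edge_sequence "\<lambda>i. initial (es ! i)" "\<lambda>i. final (es ! i)" d "{0..Suc n}"
proof
  fix i j assume ij: "i \<le> j" "j < d"
  have "initial (es ! j) \<le> initial (es ! i)"
    using sorted ij by (cases "i = j") (auto simp: sorted_wrt_iff_nth_less)
  also have "\<dots> < final (es ! i)" using free_edge_bounds nth_in ij by simp
  finally show "final (es ! i) \<noteq> initial (es ! j)" by simp
next
  fix i assume "i < d"
  then have "initial (es ! i) < final (es ! i)" "final (es ! i) \<le> n + 1"
    using free_edge_bounds nth_in by blast+
  then show "initial (es ! i) \<in> {0..Suc n}" "final (es ! i) \<in> {0..Suc n}" by simp_all
qed simp

lemma sum_es: "(\<Sum>i | i < d \<and> P (es ! i). g (es ! i)) = (\<Sum>e | e \<in> free_edges \<and> P e. g e)"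
proof -
  have "bij_betw ((!) es) {i. i < d \<and> P (es ! i)} {e \<in> free_edges. P e}"
    unfolding bij_betw_def
  proof
    show "inj_on ((!) es) {i. i < d \<and> P (es ! i)}"
      by (rule inj_on_subset[OF bij_betw_imp_inj_on[OF bij_es]]) auto
    show "(!) es ` {i. i < d \<and> P (es ! i)} = {e \<in> free_edges. P e}"
      unfolding bij_betw_imp_surj_on[OF bij_es, symmetric] by blast
  qed
  then show ?thesis by (rule sum.reindex_bij_betw)
qed

lemma sum_free_initial_0:
  "(\<Sum>e | e \<in> free_edges \<and> initial e = 0. g e) = (\<Sum>v=1..n. g (source_edge v))"
proof -
  have "{e \<in> free_edges. initial e = 0} = source_edge ` {1..n}"
    using edge_bounds by (fastforce simp: free_edges_def)
  then show ?thesis by (simp add: sum.reindex inj_on_def)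
qed

lemma sum_free_initial:
  "v \<noteq> 0 \<Longrightarrow> (\<Sum>e | e \<in> free_edges \<and> initial e = v. g e) = (\<Sum>e | e \<in> E \<and> initial e = v. g e)"
  by (rule arg_cong[of _ _ "sum g"]) (auto simp: free_edges_def)

lemma sum_free_final_0: "(\<Sum>e | e \<in> free_edges \<and> final e = 0. g e) = 0"
proof -
  have "{e \<in> free_edges. final e = 0} = {}" using free_edge_bounds by force
  then show ?thesis by (simp only: sum.empty)
qed

lemma sum_free_final:
  assumes "1 \<le> v"
  shows "(\<Sum>e | e \<in> free_edges \<and> final e = v. g e) =
     (if v \<le> n then g (source_edge v) else 0) + (\<Sum>e | e \<in> E \<and> final e = v. g e)"
proof (cases "v \<le> n")
  case True
  then have "{e \<in> free_edges. final e = v} = insert (source_edge v) {e \<in> E. final e = v}"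
    using assms by (auto simp: free_edges_def)
  then show ?thesis using True finite_edges[of G] by simp
next
  case False
  then have "{e \<in> free_edges. final e = v} = {e \<in> E. final e = v}"
    by (auto simp: free_edges_def)
  then show ?thesis using False by simp
qed

lemma balance_free:
  "balance d (\<lambda>i\<in>{..<d}. f (es ! i)) v =
     (\<Sum>e | e \<in> free_edges \<and> final e = v. f e) - (\<Sum>e | e \<in> free_edges \<and> initial e = v. f e)"
proof -
  have "balance d (\<lambda>i\<in>{..<d}. f (es ! i)) v =
     (\<Sum>i<d. if final (es ! i) = v then f (es ! i) else 0) - (\<Sum>i<d. if initial (es ! i) = v then f (es ! i) else 0)"
    unfolding balance_def sum_subtractf[symmetric] by (rule sum.cong) auto
  also have "\<dots> = (\<Sum>i | i < d \<and> final (es ! i) = v. f (es ! i)) - (\<Sum>i | i < d \<and> initial (es ! i) = v. f (es ! i))"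
    by (simp add: sum.inter_filter[symmetric] lessThan_def)
  finally show ?thesis
    unfolding sum_es[of f "\<lambda>e. final e = v"] sum_es[of f "\<lambda>e. initial e = v"] .
qed

lemma no_edge_from_last: "(\<Sum>e | e \<in> E \<and> initial e = Suc n. g e) = 0"
proof -
  have "{e \<in> E. initial e = Suc n} = {}" using edge_bounds by force
  then show ?thesis by (simp only: sum.empty)
qed

lemma balance_0: "balance d (\<lambda>i\<in>{..<d}. f (es ! i)) 0 = - (\<Sum>v=1..n. f (source_edge v))"
  unfolding balance_free sum_free_final_0 sum_free_initial_0 by simp

lemma balance_pos:
  "1 \<le> v \<Longrightarrow> balance d (\<lambda>i\<in>{..<d}. f (es ! i)) v = (if v \<le> n then f (source_edge v) else 0) +
      (\<Sum>e | e \<in> E \<and> final e = v. f e) - (\<Sum>e | e \<in> E \<and> initial e = v. f e)"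
  unfolding balance_free by (simp add: sum_free_final sum_free_initial)

definition origin :: "nat edge \<Rightarrow> real" where
  "origin e = of_bool (e = source_edge (n + 1) \<or> e = sink_edge n (n + 1))"

definition jump :: "nat \<Rightarrow> nat \<Rightarrow> real" where
  "jump i v = of_bool (final (es ! i) = v) - of_bool (initial (es ! i) = v)"

text \<open>The unit of flow on the free edge \<open>i\<close>, rerouted through the reserved edges at its two ends. A
  change of the flow on \<open>(s, n + 1)\<close> is passed on from \<open>n + 1\<close> to the sink, which gives the extra
  term there.\<close>

definition direction :: "nat \<Rightarrow> nat edge \<Rightarrow> real" where
  "direction i e =
     (if e \<in> free_edges then of_bool (e = es ! i)
      else if e = source_edge (n + 1) then jump i 0
      else if e \<in> sink_edge n ` {1..n + 1} then jump i (initial e) + of_bool (initial e = n + 1) * jump i 0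
      else 0)"

abbreviation "chart \<equiv> affine_chart d origin direction"

lemma not_free [simp]:
  "source_edge (Suc n) \<notin> free_edges" "sink_edge n v \<notin> free_edges"
  "sink_edge n v \<noteq> source_edge (Suc n)" "source_edge (Suc n) \<noteq> sink_edge n v"
  by (auto simp: free_edges_def) (auto simp: source_edge_def sink_edge_def)

lemma balance_jump: "balance d x v = (\<Sum>i<d. x i * jump i v)"
  by (simp add: balance_def jump_def)

lemma chart_free: "j < d \<Longrightarrow> chart x (es ! j) = x j"
proof -
  assume j: "j < d"
  have "origin (es ! j) = 0" using nth_in[OF j] not_free by (auto simp: origin_def)
  moreover have "x i * direction i (es ! j) = (if i = j then x j else 0)" if "i < d" for i
    using nth_in[OF j] nth_eq_iff_index_eq[OF distinct j that] by (auto simp: direction_def)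
  ultimately show ?thesis using j by (simp add: affine_chart_def)
qed

lemma chart_source: "chart x (source_edge (n + 1)) = 1 + balance d x 0"
  using not_free(1) unfolding affine_chart_def balance_jump by (simp add: origin_def direction_def)

lemma chart_sink:
  assumes "v \<in> {1..n + 1}"
  shows "chart x (sink_edge n v) = balance d x v + of_bool (v = n + 1) * (1 + balance d x 0)"
proof -
  have "direction i (sink_edge n v) = jump i v + of_bool (v = n + 1) * jump i 0" for i
    using assms unfolding direction_def by simp
  then show ?thesis
    unfolding affine_chart_def balance_jump
    by (simp add: origin_def algebra_simps sum.distrib)
qed

lemma chart_other:
  assumes "e \<notin> edges (augment n G)"
  shows "chart x e = 0"
proof -
  have "e \<notin> free_edges" "e \<noteq> source_edge (n + 1)" "e \<notin> sink_edge n ` {1..n + 1}"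
    using assms unfolding edges_augment free_edges_def by auto
  moreover from this have "origin e = 0" by (auto simp: origin_def)
  ultimately show ?thesis by (simp add: affine_chart_def direction_def)
qed

lemma edges_augment_free:
  "edges (augment n G) = free_edges \<union> {source_edge (n + 1)} \<union> sink_edge n ` {1..n + 1}"
proof -
  have "{1..n + 1} = insert (n + 1) {1..n}" by auto
  then show ?thesis unfolding edges_augment free_edges_def by auto
qed

text \<open>A flow is determined by its free coordinates: the reserved edges carry what conservation demands.\<close>

lemma flow_space_iff_chart:
  "f \<in> flow_space \<longleftrightarrow> f = chart (\<lambda>i\<in>{..<d}. f (es ! i))"
proof -
  let ?x = "\<lambda>i\<in>{..<d}. f (es ! i)"
  have free: "chart ?x e = f e" if "e \<in> free_edges" for e
  proof -
    have "e \<in> (!) es ` {..<d}" using that unfolding bij_betw_imp_surj_on[OF bij_es] .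
    then obtain j where "j < d" "e = es ! j" by blast
    then show ?thesis by (simp add: chart_free)
  qed
  have "f = chart ?x \<longleftrightarrow> (\<forall>e. e \<notin> edges (augment n G) \<longrightarrow> f e = 0) \<and>
      f (source_edge (n + 1)) = 1 + balance d ?x 0 \<and>
      (\<forall>v\<in>{1..n + 1}. f (sink_edge n v) = balance d ?x v + of_bool (v = n + 1) * (1 + balance d ?x 0))"
    (is "_ \<longleftrightarrow> ?R")
  proof
    assume eq: "f = chart ?x"
    have "f e = 0" if "e \<notin> edges (augment n G)" for e
      using fun_cong[OF eq, of e] chart_other[OF that, of ?x] by simp
    moreover have "f (source_edge (n + 1)) = 1 + balance d ?x 0"
      using fun_cong[OF eq, of "source_edge (n + 1)"] chart_source[of ?x] by simp
    moreover have "f (sink_edge n v) = balance d ?x v + of_bool (v = n + 1) * (1 + balance d ?x 0)"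
      if "v \<in> {1..n + 1}" for v
      using fun_cong[OF eq, of "sink_edge n v"] chart_sink[OF that, of ?x] by simp
    ultimately show ?R by blast
  next
    assume R: ?R
    show "f = chart ?x"
    proof
      fix e
      consider "e \<in> free_edges" | "e = source_edge (n + 1)" | v where "v \<in> {1..n + 1}" "e = sink_edge n v"
        | "e \<notin> edges (augment n G)"
        unfolding edges_augment_free by blast
      then show "f e = chart ?x e"
      proof cases
        case 1 then show ?thesis by (simp add: free)
      next
        case 2 then show ?thesis using R chart_source[of ?x] by simp
      next
        case 3 then show ?thesis using R chart_sink[of v ?x] by simp
      next
        case 4
        then have "f e = 0" using R by blast
        then show ?thesis using chart_other[OF 4, of ?x] by simp
      qed
    qed
  qed
  also have "\<dots> \<longleftrightarrow> f \<in> flow_space"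
  proof -
    have s: "(\<Sum>v=1..n + 1. f (source_edge v)) = (\<Sum>v=1..n. f (source_edge v)) + f (source_edge (n + 1))"
      by simp
    have "(\<forall>v\<in>{1..n + 1}. f (sink_edge n v) = balance d ?x v + of_bool (v = n + 1) * (1 + balance d ?x 0)) \<longleftrightarrow>
      (\<forall>v\<in>{1..n + 1}. f (sink_edge n v) = f (source_edge v) +
        (\<Sum>e | e \<in> E \<and> final e = v. f e) - (\<Sum>e | e \<in> E \<and> initial e = v. f e))"
      if "f (source_edge (n + 1)) = 1 + balance d ?x 0"
    proof (rule ball_cong[OF refl])
      fix v assume "v \<in> {1..n + 1}"
      then show "(f (sink_edge n v) = balance d ?x v + of_bool (v = n + 1) * (1 + balance d ?x 0)) =
        (f (sink_edge n v) = f (source_edge v) +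
          (\<Sum>e | e \<in> E \<and> final e = v. f e) - (\<Sum>e | e \<in> E \<and> initial e = v. f e))"
        using that balance_pos[of v f] by (cases "v = n + 1") auto
    qed
    moreover have "f (source_edge (n + 1)) = 1 + balance d ?x 0 \<longleftrightarrow> (\<Sum>v=1..n + 1. f (source_edge v)) = 1"
      unfolding s balance_0 by auto
    ultimately show ?thesis unfolding flow_space_def mem_Collect_eq by blast
  qed
  finally show ?thesis ..
qed

lemma restrict_chart: "x \<in> coords d \<Longrightarrow> (\<lambda>i\<in>{..<d}. chart x (es ! i)) = x"
proof
  fix i assume "x \<in> coords d"
  then show "(\<lambda>i\<in>{..<d}. chart x (es ! i)) i = x i"
    by (cases "i < d") (auto simp: chart_free PiE_iff extensional_def)
qed

lemma chart_in_flow_space: "x \<in> coords d \<Longrightarrow> chart x \<in> flow_space"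
  using flow_space_iff_chart[of "chart x"] restrict_chart[of x] by simp

lemma lattice_chart_flow_polytope:
  "lattice_chart (flow_polytope (augment n G)) d origin direction"
  unfolding lattice_chart_def affine_hull_flow_polytope
proof
  let ?g = "\<lambda>f. \<lambda>i\<in>{..<d}. f (es ! i)"
  show "bij_betw chart (coords d) flow_space"
  proof (rule bij_betwI[where g = ?g])
    show "chart \<in> coords d \<rightarrow> flow_space" using chart_in_flow_space by blast
    show "?g \<in> flow_space \<rightarrow> coords d" by auto
    show "?g (chart x) = x" if "x \<in> coords d" for x using restrict_chart[OF that] .
    show "chart (?g f) = f" if "f \<in> flow_space" for f using that flow_space_iff_chart by metis
  qed
  show "bij_betw chart ({..<d} \<rightarrow>\<^sub>E \<int>) (flow_space \<inter> integer_points)"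
  proof (rule bij_betwI[where g = ?g])
    have sub: "x \<in> coords d" if "x \<in> {..<d} \<rightarrow>\<^sub>E \<int>" for x :: "nat \<Rightarrow> real"
      using that by (simp add: PiE_iff)
    have "jump i v \<in> \<int>" for i v by (simp add: jump_def)
    then have dir: "direction i e \<in> \<int>" for i e by (simp add: direction_def)
    have "chart x e \<in> \<int>" if "x \<in> {..<d} \<rightarrow>\<^sub>E \<int>" for x e
      unfolding affine_chart_def using that dir
      by (intro Ints_add Ints_sum Ints_mult) (simp_all add: origin_def PiE_iff)
    then show "chart \<in> ({..<d} \<rightarrow>\<^sub>E \<int>) \<rightarrow> flow_space \<inter> integer_points"
      using chart_in_flow_space sub by (simp add: integer_points_def)
    show "?g \<in> flow_space \<inter> integer_points \<rightarrow> ({..<d} \<rightarrow>\<^sub>E \<int>)"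
    proof (rule funcsetI, rule PiE_I)
      fix f i assume "f \<in> flow_space \<inter> integer_points" "i \<in> {..<d}"
      then have "\<forall>e. f e \<in> \<int>" "i < d" unfolding integer_points_def by blast+
      then show "?g f i \<in> \<int>" by (simp del: split_paired_All)
    qed simp
    show "?g (chart x) = x" if "x \<in> {..<d} \<rightarrow>\<^sub>E \<int>" for x using restrict_chart[OF sub[OF that]] .
    show "chart (?g f) = f" if "f \<in> flow_space \<inter> integer_points" for f
      using that flow_space_iff_chart by (metis IntD1)
  qed
qed

text \<open>The vertex \<open>0\<close> stands for the reserved edge \<open>(s, n + 1)\<close>. At \<open>n + 1\<close> the flow to the sink and the
  balance differ by the flow on that edge, but both are nonnegative anyway, because no free edge
  leaves \<open>n + 1\<close>.\<close>

lemma chart_in_polytope_iff: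
  assumes x: "x \<in> coords d"
  shows "chart x \<in> flow_polytope (augment n G) \<longleftrightarrow> x \<in> region d (\<lambda>v. of_bool (v = 0))"
proof -
  have last: "0 \<le> balance d x (n + 1)" if "\<forall>i\<in>{..<d}. 0 \<le> x i"
    unfolding balance_def
  proof (rule sum_nonneg)
    fix i assume i: "i \<in> {..<d}"
    then have "initial (es ! i) < n + 1" using free_edge_bounds[OF nth_in[of i]] by simp
    then show "0 \<le> x i * (of_bool (final (es ! i) = n + 1) - of_bool (initial (es ! i) = n + 1))"
      using that i by simp
  qed
  have free: "(\<forall>e\<in>free_edges. 0 \<le> chart x e) \<longleftrightarrow> (\<forall>i\<in>{..<d}. 0 \<le> x i)"
  proof -
    have "(\<forall>e\<in>free_edges. 0 \<le> chart x e) \<longleftrightarrow> (\<forall>i\<in>{..<d}. 0 \<le> chart x (es ! i))"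
      unfolding bij_betw_imp_surj_on[OF bij_es, symmetric] by blast
    then show ?thesis by (simp add: chart_free)
  qed
  have "chart x \<in> flow_polytope (augment n G) \<longleftrightarrow> (\<forall>e\<in>edges (augment n G). 0 \<le> chart x e)"
    using chart_in_flow_space[OF x] by (simp add: flow_polytope_augment)
  also have "\<dots> \<longleftrightarrow> (\<forall>e\<in>free_edges. 0 \<le> chart x e) \<and> 0 \<le> chart x (source_edge (n + 1)) \<and>
      (\<forall>v\<in>{1..n + 1}. 0 \<le> chart x (sink_edge n v))"
    unfolding edges_augment_free by blast
  also have "\<dots> \<longleftrightarrow> (\<forall>i\<in>{..<d}. 0 \<le> x i) \<and> 0 \<le> 1 + balance d x 0 \<and>
      (\<forall>v\<in>{1..n + 1}. 0 \<le> balance d x v + of_bool (v = n + 1) * (1 + balance d x 0))"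
    unfolding free chart_source by (simp only: chart_sink cong: ball_cong)
  also have "\<dots> \<longleftrightarrow> (\<forall>i\<in>{..<d}. 0 \<le> x i) \<and> (\<forall>v\<in>{0..Suc n}. 0 \<le> of_bool (v = 0) + balance d x v)"
    (is "?L \<longleftrightarrow> ?R")
  proof
    assume L: ?L
    have "0 \<le> of_bool (v = 0) + balance d x v" if v: "v \<in> {0..Suc n}" for v
    proof -
      consider "v = 0" | "v = n + 1" | "v \<in> {1..n}" using v by fastforce
      then show ?thesis
      proof cases
        case 3
        then have "v \<in> {1..n + 1}" by simp
        then have "0 \<le> balance d x v + of_bool (v = n + 1) * (1 + balance d x 0)" using L by blast
        then show ?thesis using 3 by simp
      qed (use L last in simp_all)
    qed
    then show ?R using L by blast
  next
    assume R: ?R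
    have 0: "0 \<le> 1 + balance d x 0" using bspec[OF conjunct2[OF R], of 0] by simp
    have "0 \<le> balance d x v + of_bool (v = n + 1) * (1 + balance d x 0)" if "v \<in> {1..n + 1}" for v
      using bspec[OF conjunct2[OF R], of v] 0 that by (cases "v = n + 1") auto
    then show ?L using R 0 by blast
  qed
  finally show ?thesis using x by (simp add: region_def)
qed

text \<open>Every edge adds \<open>t i + 1\<close> to one degree and subtracts \<open>t i\<close> from another.\<close>

lemma sum_slack:
  assumes "t \<in> exponents d"
  shows "(\<Sum>v\<in>{0..Suc n}. slack d t v) = d"
proof -
  have sub: "(\<lambda>i. initial (es ! i)) ` {..<d} \<subseteq> {0..Suc n}" "(\<lambda>i. final (es ! i)) ` {..<d} \<subseteq> {0..Suc n}"
    using tail_in head_in by blast+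
  have "(\<Sum>v\<in>{0..Suc n}. outflow d t v) = (\<Sum>i<d. t i + 1)"
    using sum.group[OF finite_lessThan finite_atLeastAtMost sub(1), of "\<lambda>i. t i + 1"] by (simp add: outflow_def)
  moreover have "(\<Sum>v\<in>{0..Suc n}. inflow d t v) = (\<Sum>i<d. t i)"
    using sum.group[OF finite_lessThan finite_atLeastAtMost sub(2), of t] by (simp add: inflow_def)
  moreover have "(\<Sum>v\<in>{0..Suc n}. slack d t v) = (\<Sum>v\<in>{0..Suc n}. outflow d t v) - (\<Sum>v\<in>{0..Suc n}. inflow d t v)"
    unfolding slack_def using assms by (intro sum_subtractf_nat) (auto simp: exponents_def)
  moreover have "(\<Sum>i<d. t i + 1) = (\<Sum>i<d. t i) + d" by (simp only: sum.distrib) simp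
  ultimately show ?thesis by linarith
qed

text \<open>The terms that survive when one unit is present in the source and nothing elsewhere.\<close>

definition tight_exponents :: "(nat \<Rightarrow> nat) set" where
  "tight_exponents = {t \<in> exponents d. \<forall>v\<in>{1..n + 1}. slack d t v = 0}"

lemma monomial_unit_source:
  assumes "t \<in> exponents d"
  shows "monomial (slack d t) (\<lambda>v. of_bool (v = 0)) = of_bool (t \<in> tight_exponents) / fact d"
proof -
  have range: "{0..Suc n} = insert 0 {1..n + 1}" by auto
  have dp0: "divided_power k 0 = of_bool (k = 0)" for k by (cases k) auto
  have "monomial (slack d t) (\<lambda>v. of_bool (v = 0)) =
      divided_power (slack d t 0) 1 * (\<Prod>v\<in>{1..n + 1}. divided_power (slack d t v) 0)"
  proof -
    have "monomial (slack d t) (\<lambda>v. of_bool (v = 0)) =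
        (\<Prod>v\<in>insert 0 {1..n + 1}. divided_power (slack d t v) (of_bool (v = 0)))"
      unfolding monomial_def by (rule prod.cong[OF range refl])
    also have "\<dots> = divided_power (slack d t 0) (of_bool (0 = (0 :: nat))) *
        (\<Prod>v\<in>{1..n + 1}. divided_power (slack d t v) (of_bool (v = 0)))"
      by (rule prod.insert) auto
    also have "(\<Prod>v\<in>{1..n + 1}. divided_power (slack d t v) (of_bool (v = 0))) =
        (\<Prod>v\<in>{1..n + 1}. divided_power (slack d t v) 0)"
      by (rule prod.cong) auto
    finally show ?thesis by simp
  qed
  also have "(\<Prod>v\<in>{1..n + 1}. divided_power (slack d t v) 0) = of_bool (t \<in> tight_exponents)"
  proof (cases "t \<in> tight_exponents")
    case True
    then show ?thesis unfolding dp0 by (intro trans[OF prod.neutral]) (simp_all add: tight_exponents_def)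
  next
    case False
    then obtain v where "v \<in> {1..n + 1}" "slack d t v \<noteq> 0" using assms by (auto simp: tight_exponents_def)
    then have "(\<Prod>v\<in>{1..n + 1}. divided_power (slack d t v) 0) = 0"
      unfolding dp0 by (intro prod_zero) auto
    then show ?thesis using False by simp
  qed
  also have "divided_power (slack d t 0) 1 * of_bool (t \<in> tight_exponents) = of_bool (t \<in> tight_exponents) / fact d"
  proof (cases "t \<in> tight_exponents")
    case True
    then have "(\<Sum>v\<in>{1..n + 1}. slack d t v) = 0" by (simp add: tight_exponents_def)
    moreover have "(\<Sum>v\<in>{0..Suc n}. slack d t v) = (\<Sum>v\<in>insert 0 {1..n + 1}. slack d t v)"
      by (rule sum.cong[OF range refl])
    moreover have "\<dots> = slack d t 0 + (\<Sum>v\<in>{1..n + 1}. slack d t v)" by (rule sum.insert) auto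
    ultimately have "slack d t 0 = d" using sum_slack[OF assms] by simp
    then show ?thesis by (simp add: divided_power_def)
  qed simp
  finally show ?thesis .
qed

lemma normalized_volume_eq_tight:
  "normalized_volume (flow_polytope (augment n G)) = real (card tight_exponents)"
proof -
  let ?c = "\<lambda>v :: nat. of_bool (v = 0) :: real"
  have "x \<in> coords d" if "x \<in> region d ?c" for x using that by (simp add: region_def)
  then have region: "{x \<in> coords d. chart x \<in> flow_polytope (augment n G)} = region d ?c"
    using chart_in_polytope_iff by blast
  have "normalized_volume (flow_polytope (augment n G)) = fact d * measure (lebesgue_on_coords d) (region d ?c)"
    using normalized_volume_eq[OF lattice_chart_flow_polytope] unfolding region by simp
  also have "measure (lebesgue_on_coords d) (region d ?c) = (\<Sum>t\<in>exponents d. monomial (slack d t) ?c)"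
    unfolding measure_def by (subst emeasure_region) (auto intro!: enn2real_ennreal sum_nonneg monomial_nonneg)
  also have "\<dots> = (\<Sum>t\<in>exponents d. of_bool (t \<in> tight_exponents)) / fact d"
    unfolding sum_divide_distrib by (rule sum.cong[OF refl monomial_unit_source])
  also have "(\<Sum>t\<in>exponents d. of_bool (t \<in> tight_exponents)) = (\<Sum>t\<in>tight_exponents. 1 :: real)"
    using finite_exponents[of d] by (intro sum.mono_neutral_cong_right) (auto simp: tight_exponents_def)
  finally show ?thesis by simp
qed

lemma outflow_es: "outflow d (\<lambda>i\<in>{..<d}. g (es ! i)) v = (\<Sum>e | e \<in> free_edges \<and> initial e = v. g e + 1)"
proof -
  have "outflow d (\<lambda>i\<in>{..<d}. g (es ! i)) v = (\<Sum>i | i < d \<and> initial (es ! i) = v. g (es ! i) + 1)"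
    unfolding outflow_def by (rule sum.cong) auto
  then show ?thesis using sum_es[of "\<lambda>e. g e + 1" "\<lambda>e. initial e = v"] by simp
qed

lemma inflow_es: "inflow d (\<lambda>i\<in>{..<d}. g (es ! i)) v = (\<Sum>e | e \<in> free_edges \<and> final e = v. g e)"
proof -
  have "inflow d (\<lambda>i\<in>{..<d}. g (es ! i)) v = (\<Sum>i | i < d \<and> final (es ! i) = v. g (es ! i))"
    unfolding inflow_def by (rule sum.cong) auto
  then show ?thesis using sum_es[of g "\<lambda>e. final e = v"] by simp
qed

lemma tight_iff:
  "(\<lambda>i\<in>{..<d}. g (es ! i)) \<in> tight_exponents \<longleftrightarrow>
    (\<forall>v\<in>{1..n + 1}. (if v \<le> n then g (source_edge v) else 0) + (\<Sum>e | e \<in> E \<and> final e = v. g e) =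
       (\<Sum>e | e \<in> E \<and> initial e = v. g e + 1))"
proof -
  let ?t = "\<lambda>i\<in>{..<d}. g (es ! i)"
  have "?t \<in> tight_exponents \<longleftrightarrow> (\<forall>v\<in>{1..n + 1}. inflow d ?t v = outflow d ?t v)"
  proof -
    have zero: "inflow d ?t 0 = 0" unfolding inflow_es by (rule sum_free_final_0)
    have "?t \<in> tight_exponents \<longleftrightarrow> (\<forall>v\<in>{0..Suc n}. inflow d ?t v \<le> outflow d ?t v) \<and>
        (\<forall>v\<in>{1..n + 1}. slack d ?t v = 0)"
      unfolding tight_exponents_def exponents_def by simp
    also have "\<dots> \<longleftrightarrow> (\<forall>v\<in>{1..n + 1}. inflow d ?t v = outflow d ?t v)" (is "?L \<longleftrightarrow> ?R")
    proof
      assume L: ?L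
      show ?R
      proof
        fix v assume "v \<in> {1..n + 1}"
        then have "inflow d ?t v \<le> outflow d ?t v" "slack d ?t v = 0" using L by simp_all
        then show "inflow d ?t v = outflow d ?t v" unfolding slack_def by linarith
      qed
    next
      assume R: ?R
      have "inflow d ?t v \<le> outflow d ?t v" if "v \<in> {0..Suc n}" for v
        using bspec[OF R, of v] zero that by (cases "v = 0") simp_all
      moreover have "slack d ?t v = 0" if "v \<in> {1..n + 1}" for v
        using bspec[OF R that] unfolding slack_def by linarith
      ultimately show ?L by blast
    qed
    finally show ?thesis .
  qed
  also have "\<dots> \<longleftrightarrow> (\<forall>v\<in>{1..n + 1}. (if v \<le> n then g (source_edge v) else 0) + (\<Sum>e | e \<in> E \<and> final e = v. g e) =
       (\<Sum>e | e \<in> E \<and> initial e = v. g e + 1))"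
    unfolding inflow_es outflow_es by (intro ball_cong refl) (simp add: sum_free_final sum_free_initial)
  finally show ?thesis .
qed

text \<open>The exponent of an edge from the source takes up exactly what is missing at its final vertex, so
  it is determined by the exponents on the edges of \<open>G\<close>. Only the vertex \<open>n + 1\<close> has no free edge
  from the source; but nothing leaves it, so the inequality there is already an equality.\<close>

lemma card_tight: "card tight_exponents = card integer_flows"
proof -
  define ext where "ext a e = (if e \<in> E then a e
     else (\<Sum>e' | e' \<in> E \<and> initial e' = final e. a e' + 1) - (\<Sum>e' | e' \<in> E \<and> final e' = final e. a e'))"
    for a :: "nat edge \<Rightarrow> nat" and e
  define \<Phi> where "\<Phi> a = (\<lambda>i\<in>{..<d}. ext a (es ! i))" for a
  have cong: "(\<Sum>e | e \<in> E \<and> P e. h e) = (\<Sum>e | e \<in> E \<and> P e. h' e)"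
    if "\<And>e. e \<in> E \<Longrightarrow> h e = h' e" for P and h h' :: "nat edge \<Rightarrow> nat"
    using that by (intro sum.cong) auto
  have "bij_betw \<Phi> integer_flows tight_exponents"
    unfolding bij_betw_def
  proof
    show "inj_on \<Phi> integer_flows"
    proof (rule inj_onI)
      fix a b assume a: "a \<in> integer_flows" and b: "b \<in> integer_flows" and eq: "\<Phi> a = \<Phi> b"
      show "a = b"
      proof (rule PiE_ext)
        show "a \<in> E \<rightarrow>\<^sub>E UNIV" "b \<in> E \<rightarrow>\<^sub>E UNIV" using a b by (simp_all add: integer_flows_def)
        fix e assume e: "e \<in> E"
        then have "e \<in> (!) es ` {..<d}"
          unfolding bij_betw_imp_surj_on[OF bij_es] by (simp add: free_edges_def)
        then obtain i where "i < d" "e = es ! i" by blast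
        then show "a e = b e" using fun_cong[OF eq, of i] e by (simp add: \<Phi>_def ext_def)
      qed
    qed
    show "\<Phi> ` integer_flows = tight_exponents"
    proof
      show "\<Phi> ` integer_flows \<subseteq> tight_exponents"
      proof (rule image_subsetI)
        fix a assume a: "a \<in> integer_flows"
        have sums: "(\<Sum>e | e \<in> E \<and> P e. ext a e) = (\<Sum>e | e \<in> E \<and> P e. a e)"
          "(\<Sum>e | e \<in> E \<and> P e. ext a e + 1) = (\<Sum>e | e \<in> E \<and> P e. a e + 1)" for P
          by (rule cong; simp add: ext_def)+
        have "(if v \<le> n then ext a (source_edge v) else 0) + (\<Sum>e | e \<in> E \<and> final e = v. a e) =
            (\<Sum>e | e \<in> E \<and> initial e = v. a e + 1)" if v: "v \<in> {1..n + 1}" for v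
        proof -
          have le: "(\<Sum>e | e \<in> E \<and> final e = v. a e) \<le> (\<Sum>e | e \<in> E \<and> initial e = v. a e + 1)"
            using a v by (simp add: integer_flows_def)
          show ?thesis
          proof (cases "v \<le> n")
            case True then show ?thesis using le by (simp add: ext_def)
          next
            case False
            then have "v = Suc n" using v by simp
            then show ?thesis using le no_edge_from_last[of "\<lambda>e. a e + 1"] by simp
          qed
        qed
        then show "\<Phi> a \<in> tight_exponents" unfolding \<Phi>_def tight_iff sums by blast
      qed
      show "tight_exponents \<subseteq> \<Phi> ` integer_flows"
      proof
        fix t assume t: "t \<in> tight_exponents"
        define g where "g e = t (inv_into {..<d} ((!) es) e)" for e
        have "g (es ! i) = t i" if "i < d" for i
          using that bij_betw_inv_into_left[OF bij_es, of i] by (simp add: g_def)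
        moreover have "t \<in> {..<d} \<rightarrow>\<^sub>E UNIV" using t unfolding tight_exponents_def exponents_def by blast
        ultimately have tg: "t = (\<lambda>i\<in>{..<d}. g (es ! i))"
          by (auto simp: fun_eq_iff PiE_iff extensional_def)
        have bal: "(if v \<le> n then g (source_edge v) else 0) + (\<Sum>e | e \<in> E \<and> final e = v. g e) =
            (\<Sum>e | e \<in> E \<and> initial e = v. g e + 1)" if "v \<in> {1..n + 1}" for v
          using t that unfolding tg tight_iff by blast
        define a where "a = restrict g E"
        have sums: "(\<Sum>e | e \<in> E \<and> P e. a e) = (\<Sum>e | e \<in> E \<and> P e. g e)"
          "(\<Sum>e | e \<in> E \<and> P e. a e + 1) = (\<Sum>e | e \<in> E \<and> P e. g e + 1)" for P
          by (rule cong; simp add: a_def)+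
        have "a \<in> E \<rightarrow>\<^sub>E UNIV" by (simp add: a_def)
        moreover have "(\<Sum>e | e \<in> E \<and> final e = v. a e) \<le> (\<Sum>e | e \<in> E \<and> initial e = v. a e + 1)"
          if "v \<in> {1..n + 1}" for v
          using bal[OF that] unfolding sums by linarith
        ultimately have "a \<in> integer_flows" unfolding integer_flows_def by blast
        moreover have "t = \<Phi> a"
          unfolding tg \<Phi>_def
        proof (rule restrict_ext)
          fix i assume "i \<in> {..<d}"
          then have "es ! i \<in> free_edges" using nth_in by simp
          then consider "es ! i \<in> E" | v where "es ! i = source_edge v" "v \<in> {1..n}"
            unfolding free_edges_def by blast
          then show "g (es ! i) = ext a (es ! i)"
          proof cases
            case 1 then show ?thesis by (simp add: ext_def a_def)
          next
            case 2
            then show ?thesis using bal[of v] unfolding ext_def sums by simp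
          qed
        qed
        ultimately show "t \<in> \<Phi> ` integer_flows" by blast
      qed
    qed
  qed
  then show ?thesis by (simp add: bij_betw_same_card)
qed

end

text \<open>The outdegree form of the theorem of Postnikov and Stanley and of Baldoni and Vergne, by which
  volumes of flow polytopes are values of Kostant's partition function.\<close>

theorem (in augmented_graph) normalized_volume_flow_polytope:
  "normalized_volume (flow_polytope (augment n G)) = real (card integer_flows)"
proof -
  obtain es where "distinct es" "set es = free_edges" "sorted_wrt (\<lambda>e e'. initial e' \<le> initial e) es"
    using ex_enumeration by blast
  then interpret enumerated_graph n G es by unfold_locales
  show ?thesis unfolding normalized_volume_eq_tight card_tight ..
qed

section \<open>The graphs of the family\<close>

definition family_graph :: "nat \<Rightarrow> nat set \<Rightarrow> nat multigraph" where
  "family_graph n S = ({1..n + 1}, replicate_mset n (1, n + 1) + mset_set (pairs n) +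
     mset_set ((\<lambda>l. (1, l)) ` S) + mset_set ((\<lambda>l. (l, n + 1)) ` ({2..n} - S)))"

lemma count_family_graph:
  assumes S: "S \<subseteq> {2..n}"
  shows "count (snd (family_graph n S)) (i, j) =
    (if i = 1 \<and> j = n + 1 then n
     else if (i, j) \<in> pairs n \<or> i = 1 \<and> j \<in> S \<or> j = n + 1 \<and> i \<in> {2..n} - S then 1 else 0)"
proof -
  have fin: "finite S" using S finite_subset by blast
  have "(i, j) \<in> (\<lambda>l. (1, l)) ` S \<longleftrightarrow> i = 1 \<and> j \<in> S" by auto
  moreover have "(i, j) \<in> (\<lambda>l. (l, n + 1)) ` ({2..n} - S) \<longleftrightarrow> j = n + 1 \<and> i \<in> {2..n} - S" by auto
  moreover have "(i, j) \<in> pairs n \<longleftrightarrow> 2 \<le> i \<and> i < j \<and> j \<le> n" by (simp add: pairs_def)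
  moreover have "j \<in> S \<Longrightarrow> 2 \<le> j \<and> j \<le> n" using S by auto
  ultimately show ?thesis
    using fin by (auto simp: family_graph_def count_mset_set')
qed

lemma card_pairs: "1 \<le> n \<Longrightarrow> n + card (pairs n) + (n - 1) = (n + 1) choose 2"
proof -
  assume n: "1 \<le> n"
  have "2 * int (card (pairs n)) = (\<Sum>i\<in>{2..n}. \<Sum>j\<in>{2..n} - {i}. 1)"
    using sum_pairs_symmetric[of "\<lambda>_ _. 1" n] by (simp add: case_prod_unfold)
  also have "\<dots> = (\<Sum>i\<in>{2..n}. int n - 2)"
    by (intro sum.cong refl) (auto simp: of_nat_diff)
  also have "\<dots> = (int n - 1) * (int n - 2)" using n by (simp add: of_nat_diff)
  finally have "2 * int (card (pairs n)) = (int n - 1) * (int n - 2)" .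
  moreover have "2 * ((n + 1) choose 2) = (n + 1) * n"
    using choose_two[of "n + 1"] by simp
  then have "2 * int ((n + 1) choose 2) = (int n + 1) * int n"
    by (metis of_nat_Suc of_nat_mult of_nat_numeral Suc_eq_plus1 add.commute)
  ultimately have "2 * int (n + card (pairs n) + (n - 1)) = 2 * int ((n + 1) choose 2)"
    using n by (simp add: of_nat_diff algebra_simps)
  then show ?thesis by (metis mult_cancel_left of_nat_eq_iff zero_neq_numeral)
qed

lemma size_family_graph:
  assumes n: "1 \<le> n" and S: "S \<subseteq> {2..n}"
  shows "size (snd (family_graph n S)) = (n + 1) choose 2"
proof -
  have fin: "finite S" using S finite_subset by blast
  have "card S + card ({2..n} - S) = n - 1"
    using S fin card_mono[OF _ S] by (simp add: card_Diff_subset)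
  moreover have "size (snd (family_graph n S)) = n + card (pairs n) + card S + card ({2..n} - S)"
    unfolding family_graph_def by (simp add: card_image inj_on_def)
  ultimately show ?thesis using card_pairs[OF n] by simp
qed

lemma ordered_family_graph:
  assumes n: "1 \<le> n" and S: "S \<subseteq> {2..n}"
  shows "ordered_multigraph (family_graph n S)"
proof -
  have bounds: "1 \<le> i \<and> i < j \<and> j \<le> n + 1" if "(i, j) \<in># snd (family_graph n S)" for i j
  proof -
    have "count (snd (family_graph n S)) (i, j) \<noteq> 0" using that by simp
    then have "i = 1 \<and> j = n + 1 \<or> (i, j) \<in> pairs n \<or> i = 1 \<and> j \<in> S \<or> j = n + 1 \<and> i \<in> {2..n} - S"
      unfolding count_family_graph[OF S] by presburger
    moreover have "2 \<le> j \<and> j \<le> n" if "j \<in> S" using subsetD[OF S that] by simp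
    ultimately show ?thesis using n by (auto simp: pairs_def)
  qed
  have fst: "fst (family_graph n S) = {1..n + 1}" by (simp add: family_graph_def)
  show ?thesis
    unfolding ordered_multigraph_def fst
  proof (intro conjI ballI)
    fix e assume "e \<in># snd (family_graph n S)"
    then show "case e of (i, j) \<Rightarrow> i \<in> {1..n + 1} \<and> j \<in> {1..n + 1} \<and> i < j"
      using bounds[of "fst e" "snd e"] by (simp add: case_prod_unfold)
  qed simp
qed

lemma family_graph_filter:
  assumes S: "S \<subseteq> {2..n}"
  shows "{#e \<in># snd (family_graph n S). \<exists>l\<in>{2..n}. e = (1, l)#} = mset_set ((\<lambda>l. (1, l)) ` S)"
proof (rule multiset_eqI, clarify)
  fix i j :: nat
  have "finite S" using S finite_subset by blast
  then have rhs: "count (mset_set ((\<lambda>l. (1, l)) ` S)) (i, j) = (if i = 1 \<and> j \<in> S then 1 else 0)"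
    by (auto simp: count_mset_set')
  have j: "2 \<le> j \<and> j \<le> n" if "j \<in> S" using subsetD[OF S that] by simp
  have lhs: "(\<exists>l\<in>{2..n}. (i, j) = (1, l)) \<longleftrightarrow> i = 1 \<and> 2 \<le> j \<and> j \<le> n" by auto
  show "count {#e \<in># snd (family_graph n S). \<exists>l\<in>{2..n}. e = (1, l)#} (i, j) = count (mset_set ((\<lambda>l. (1, l)) ` S)) (i, j)"
    unfolding count_filter_mset lhs rhs count_family_graph[OF S] using j by (auto simp: pairs_def)
qed

lemma family_graph_in_family:
  assumes n: "1 \<le> n" and S: "S \<subseteq> {2..n}" "card S = k - 1"
  shows "family_graph n S \<in> graph_family n k"
proof -
  let ?G = "family_graph n S"
  have mem: "e \<in># snd ?G \<longleftrightarrow> 0 < count (snd ?G) e" for e by simp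
  have "count (snd ?G) e \<le> 1" if "e \<noteq> (1, n + 1)" for e
    using that by (cases e) (auto simp: count_family_graph[OF S(1)])
  moreover have "(l, n + 1) \<notin># snd ?G" if "l \<in> {2..n}" "(1, l) \<in># snd ?G" for l
    using that unfolding mem count_family_graph[OF S(1)] by (auto simp: pairs_def split: if_splits)
  moreover have "size {#e \<in># snd ?G. \<exists>l\<in>{2..n}. e = (1, l)#} = k - 1"
    unfolding family_graph_filter[OF S(1)] using S by (simp add: card_image inj_on_def)
  moreover have "fst ?G = {1..n + 1}" by (simp add: family_graph_def)
  moreover have "count (snd ?G) (1, n + 1) = n" by (simp add: count_family_graph[OF S(1)])
  ultimately show ?thesis
    using ordered_family_graph[OF n S(1)] size_family_graph[OF n S(1)]
    unfolding graph_family_def by blast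
qed

text \<open>The conditions bound every multiplicity of \<open>G\<close> by that in the graph of \<open>S\<close>, and both graphs have
  the same number of edges.\<close>

lemma in_family_imp_family_graph:
  assumes n: "1 \<le> n" and G: "G \<in> graph_family n k"
  shows "\<exists>S. S \<subseteq> {2..n} \<and> card S = k - 1 \<and> G = family_graph n S"
proof -
  define S where "S = {l \<in> {2..n}. (1, l) \<in># snd G}"
  have S: "S \<subseteq> {2..n}" by (auto simp: S_def)
  have ordered: "\<And>i j. (i, j) \<in># snd G \<Longrightarrow> 1 \<le> i \<and> i < j \<and> j \<le> n + 1"
    using G unfolding graph_family_def ordered_multigraph_def by fastforce
  have one: "count (snd G) e \<le> 1" if "e \<noteq> (1, n + 1)" for e
    using G that unfolding graph_family_def by blast
  have excl: "(l, n + 1) \<notin># snd G" if "l \<in> S" for l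
    using G that unfolding graph_family_def S_def by blast
  have size: "size (snd G) = (n + 1) choose 2" and top: "count (snd G) (1, n + 1) = n"
    and verts: "fst G = {1..n + 1}" and filt: "size {#e \<in># snd G. \<exists>l\<in>{2..n}. e = (1, l)#} = k - 1"
    using G unfolding graph_family_def by blast+
  have "snd G \<subseteq># snd (family_graph n S)"
  proof (rule mset_subset_eqI)
    fix e :: "nat \<times> nat"
    obtain i j where e: "e = (i, j)" by (cases e)
    show "count (snd G) e \<le> count (snd (family_graph n S)) e"
    proof (cases "e = (1, n + 1)")
      case True then show ?thesis unfolding e using count_family_graph[OF S, of i j] top e by simp
    next
      case False
      show ?thesis
      proof (cases "e \<in># snd G")
        case True
        have ij: "1 \<le> i" "i < j" "j \<le> n + 1" using ordered[of i j] True e by auto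
        have "(i, j) \<in> pairs n \<or> i = 1 \<and> j \<in> S \<or> j = n + 1 \<and> i \<in> {2..n} - S"
          using ij False True excl[of i] unfolding e by (cases "i = 1"; cases "j = n + 1") (auto simp: pairs_def S_def)
        then show ?thesis
          using one[OF False] count_family_graph[OF S, of i j] False unfolding e by auto
      qed (simp add: not_in_iff)
    qed
  qed
  moreover have "size (snd G) = size (snd (family_graph n S))"
    using size size_family_graph[OF n S] by simp
  ultimately have eq: "snd G = snd (family_graph n S)"
    by (metis mset_subset_size nless_le subset_mset.less_le)
  then have "G = family_graph n S" using verts by (simp add: prod_eq_iff family_graph_def)
  moreover have "card S = k - 1"
    using filt unfolding eq family_graph_filter[OF S] by (simp add: card_image inj_on_def)
  ultimately show ?thesis using S by blast
qed

lemma inj_family_graph: "inj_on (family_graph n) {S. S \<subseteq> {2..n} \<and> card S = k - 1}"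
proof (rule inj_onI)
  fix S T assume S: "S \<in> {S. S \<subseteq> {2..n} \<and> card S = k - 1}" and T: "T \<in> {S. S \<subseteq> {2..n} \<and> card S = k - 1}"
    and eq: "family_graph n S = family_graph n T"
  have "l \<in> S \<longleftrightarrow> l \<in> T" if "l \<in> {2..n}" for l
  proof -
    have S': "count (snd (family_graph n S)) (1, l) = (if l \<in> S then 1 else 0)"
      and T': "count (snd (family_graph n T)) (1, l) = (if l \<in> T then 1 else 0)"
      using S T that by (auto simp: count_family_graph pairs_def)
    have "(if l \<in> S then 1 else 0) = (if l \<in> T then 1 else (0 :: nat))"
      unfolding S'[symmetric] T'[symmetric] eq ..
    then show ?thesis by (simp split: if_splits)
  qed
  then show "S = T" using S T by blast
qed

lemma graph_family_eq:
  "1 \<le> n \<Longrightarrow> graph_family n k = family_graph n ` {S. S \<subseteq> {2..n} \<and> card S = k - 1}"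
  using in_family_imp_family_graph family_graph_in_family by blast

lemma edges_family_graph:
  assumes S: "S \<subseteq> {2..n}"
  shows "((i, j), c) \<in> edges (family_graph n S) \<longleftrightarrow>
    i = 1 \<and> j = n + 1 \<and> c < n \<or> c = 0 \<and> ((i, j) \<in> pairs n \<or> i = 1 \<and> j \<in> S \<or> j = n + 1 \<and> i \<in> {2..n} - S)"
  using S unfolding edges_iff count_family_graph[OF S] by (auto simp: pairs_def split: if_splits)

lemma sum_final_family:
  assumes S: "S \<subseteq> {2..n}" and l: "l \<in> {2..n}"
  shows "(\<Sum>e | e \<in> edges (family_graph n S) \<and> final e = l. g e) =
    (\<Sum>e | e \<in> pairs n \<and> snd e = l. g (e, 0)) + (if l \<in> S then g ((1, l), 0) else (0 :: nat))"
proof -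
  have "{e \<in> edges (family_graph n S). final e = l} =
      (\<lambda>e. (e, 0)) ` {e \<in> pairs n. snd e = l} \<union> (if l \<in> S then {((1, l), 0)} else {})"
    using l by (auto simp: edges_family_graph[OF S] final_def)
  note edges = this
  have notin: "((1, l), 0) \<notin> (\<lambda>e. (e, 0)) ` {e \<in> pairs n. snd e = l}" by (auto simp: pairs_def)
  have fin: "finite ((\<lambda>e. (e, 0 :: nat)) ` {e \<in> pairs n. snd e = l})" by simp
  have "(\<Sum>e\<in>(\<lambda>e. (e, 0)) ` {e \<in> pairs n. snd e = l}. g e) = (\<Sum>e | e \<in> pairs n \<and> snd e = l. g (e, 0))"
    by (subst sum.reindex) (auto simp: inj_on_def)
  then show ?thesis
    using sum.insert[OF fin notin, of g] unfolding edges by (cases "l \<in> S") auto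
qed

lemma sum_initial_family:
  assumes S: "S \<subseteq> {2..n}" and l: "l \<in> {2..n}"
  shows "(\<Sum>e | e \<in> edges (family_graph n S) \<and> initial e = l. g e) =
    (\<Sum>e | e \<in> pairs n \<and> fst e = l. g (e, 0)) + (if l \<in> S then (0 :: nat) else g ((l, n + 1), 0))"
proof -
  have "{e \<in> edges (family_graph n S). initial e = l} =
      (\<lambda>e. (e, 0)) ` {e \<in> pairs n. fst e = l} \<union> (if l \<in> S then {} else {((l, n + 1), 0)})"
    using l by (auto simp: edges_family_graph[OF S] initial_def)
  note edges = this
  have notin: "((l, n + 1), 0) \<notin> (\<lambda>e. (e, 0)) ` {e \<in> pairs n. fst e = l}" by (auto simp: pairs_def)
  have fin: "finite ((\<lambda>e. (e, 0 :: nat)) ` {e \<in> pairs n. fst e = l})" by simp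
  have "(\<Sum>e\<in>(\<lambda>e. (e, 0)) ` {e \<in> pairs n. fst e = l}. g e) = (\<Sum>e | e \<in> pairs n \<and> fst e = l. g (e, 0))"
    by (subst sum.reindex) (auto simp: inj_on_def)
  then show ?thesis
    using sum.insert[OF fin notin, of g] unfolding edges by (cases "l \<in> S") auto
qed

lemma card_pairs_fst: "l \<in> {2..n} \<Longrightarrow> card {e \<in> pairs n. fst e = l} = n - l"
proof -
  assume "l \<in> {2..n}"
  then have "{e \<in> pairs n. fst e = l} = (\<lambda>j. (l, j)) ` {l<..n}" by (auto simp: pairs_def)
  then show ?thesis by (simp add: card_image inj_on_def)
qed

text \<open>Nothing leaves \<open>n + 1\<close> and nothing enters \<open>1\<close>. At the other vertices the summand \<open>a e + 1\<close> turns
  the outdegree within \<open>{2..n}\<close> into the supply in \<open>excess\<close>, up to the one unit that an edge to \<open>n + 1\<close>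
  contributes when \<open>l \<notin> S\<close>; for \<open>l \<in> S\<close> this unit is missing and appears on the left-hand side.\<close>

lemma flow_condition_family:
  assumes n: "1 \<le> n" and S: "S \<subseteq> {2..n}"
  shows "(\<forall>v\<in>{1..n + 1}. (\<Sum>e | e \<in> edges (family_graph n S) \<and> final e = v. a e)
        \<le> (\<Sum>e | e \<in> edges (family_graph n S) \<and> initial e = v. a e + 1)) \<longleftrightarrow>
    (\<forall>e\<in>edges (family_graph n S). final e = n + 1 \<longrightarrow> a e = 0) \<and>
    (\<forall>l\<in>{2..n}. (if l \<in> S then int (a ((1, l), 0)) + 1 else 0) \<le> excess n (\<lambda>e. a (e, 0)) l)"
proof -
  let ?E = "edges (family_graph n S)"
  let ?in = "\<lambda>v. \<Sum>e | e \<in> ?E \<and> final e = v. a e" and ?out = "\<lambda>v. \<Sum>e | e \<in> ?E \<and> initial e = v. a e + 1"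
  interpret augmented_graph n "family_graph n S"
    by unfold_locales (use ordered_family_graph[OF n S] in \<open>simp_all add: family_graph_def\<close>)
  have "{e \<in> ?E. final e = 1} = {}" using edge_bounds by fastforce
  then have "?in 1 = 0" by (simp only: sum.empty)
  then have first: "?in 1 \<le> ?out 1" by (simp only: zero_le)
  have "{e \<in> ?E. initial e = n + 1} = {}" using edge_bounds by fastforce
  then have "?out (n + 1) = 0" by (simp only: sum.empty)
  then have "?in (n + 1) \<le> ?out (n + 1) \<longleftrightarrow> ?in (n + 1) = 0" by (simp only: le_zero_eq)
  also have "\<dots> \<longleftrightarrow> (\<forall>e\<in>?E. final e = n + 1 \<longrightarrow> a e = 0)"
    using finite_edges by (subst sum_eq_0_iff) (auto intro: finite_subset[OF _ finite_edges])
  finally have last: "?in (n + 1) \<le> ?out (n + 1) \<longleftrightarrow> (\<forall>e\<in>?E. final e = n + 1 \<longrightarrow> a e = 0)" .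
  have middle: "?in l \<le> ?out l \<longleftrightarrow> (if l \<in> S then int (a ((1, l), 0)) + 1 else 0) \<le> excess n (\<lambda>e. a (e, 0)) l"
    if l: "l \<in> {2..n}" and zero: "\<forall>e\<in>?E. final e = n + 1 \<longrightarrow> a e = 0" for l
  proof -
    have "a ((l, n + 1), 0) = 0" if "l \<notin> S"
      using bspec[OF zero, of "((l, n + 1), 0)"] that l by (auto simp: edges_family_graph[OF S] final_def)
    then have out: "?out l = (\<Sum>e | e \<in> pairs n \<and> fst e = l. a (e, 0)) + (n - l) + (if l \<in> S then 0 else 1)"
    proof -
      have "(\<Sum>e | e \<in> pairs n \<and> fst e = l. a (e, 0) + 1) = (\<Sum>e | e \<in> pairs n \<and> fst e = l. a (e, 0)) + (n - l)"
        using card_pairs_fst[OF l] by (simp only: sum.distrib) simp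
      then show ?thesis
        unfolding sum_initial_family[OF S l] using \<open>l \<notin> S \<Longrightarrow> a ((l, n + 1), 0) = 0\<close> by simp
    qed
    have "?in l \<le> ?out l \<longleftrightarrow> int (?in l) \<le> int (?out l)" by (simp only: of_nat_le_iff)
    also have "\<dots> \<longleftrightarrow> (if l \<in> S then int (a ((1, l), 0)) + 1 else 0) \<le> excess n (\<lambda>e. a (e, 0)) l"
      unfolding out sum_final_family[OF S l] excess_def using l by (simp add: of_nat_diff) linarith
    finally show ?thesis .
  qed
  show ?thesis (is "?L \<longleftrightarrow> ?Z \<and> ?M")
  proof
    assume L: ?L
    have "?in (n + 1) \<le> ?out (n + 1)" by (rule bspec[OF L]) simp
    then have Z: ?Z unfolding last .
    have ?M
    proof
      fix l assume l: "l \<in> {2..n}"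
      have "?in l \<le> ?out l" by (rule bspec[OF L]) (use l in simp)
      then show "(if l \<in> S then int (a ((1, l), 0)) + 1 else 0) \<le> excess n (\<lambda>e. a (e, 0)) l"
        unfolding middle[OF l Z] .
    qed
    then show "?Z \<and> ?M" using Z by (rule conjI[rotated])
  next
    assume ZM: "?Z \<and> ?M"
    note Z = conjunct1[OF ZM] and M = conjunct2[OF ZM]
    show ?L
    proof
      fix v assume "v \<in> {1..n + 1}"
      then consider "v = 1" | "v = n + 1" | "v \<in> {2..n}" by fastforce
      then show "?in v \<le> ?out v"
      proof cases
        case 1 then show ?thesis using first by (simp only:)
      next
        case 2 then show ?thesis using Z last by (simp only:)
      next
        case 3 show ?thesis unfolding middle[OF 3 Z] by (rule bspec[OF M 3])
      qed
    qed
  qed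
qed

text \<open>Given the flow \<open>p\<close> inside \<open>{2..n}\<close>, the flow on the edge \<open>(1, l)\<close> may be any natural number smaller
  than the excess of \<open>l\<close>; the other edges carry nothing.\<close>

lemma card_integer_flows_family:
  assumes n: "1 \<le> n" and S: "S \<subseteq> {2..n}"
  shows "int (card (augmented_graph.integer_flows n (family_graph n S))) =
    (\<Sum>p\<in>feasible n. \<Prod>l\<in>S. excess n p l)"
proof -
  let ?E = "edges (family_graph n S)"
  interpret augmented_graph n "family_graph n S"
    by unfold_locales (use ordered_family_graph[OF n S] in \<open>simp_all add: family_graph_def\<close>)
  have finS: "finite S" using S finite_subset by blast
  let ?X = "SIGMA p:feasible n. \<Pi>\<^sub>E l\<in>S. {..<nat (excess n p l)}"
  define to_flow where "to_flow = (\<lambda>(p, x). \<lambda>e\<in>?E. if fst e \<in> pairs n then p (fst e)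
      else if final e \<in> S then x (final e) else 0 :: nat)"
  define from_flow where "from_flow a = (\<lambda>e\<in>pairs n. a (e, 0 :: nat), \<lambda>l\<in>S. a ((1 :: nat, l), 0 :: nat))"
    for a :: "nat edge \<Rightarrow> nat"
  have pair_edge: "(e, 0) \<in> ?E" if "e \<in> pairs n" for e
    using that by (cases e) (simp add: edges_family_graph[OF S])
  have S_edge: "((1, l), 0) \<in> ?E" if "l \<in> S" for l using that by (simp add: edges_family_graph[OF S])
  have excess_cong: "excess n p l = excess n q l" if "\<And>e. e \<in> pairs n \<Longrightarrow> p e = q e" for p q l
    unfolding excess_def using that by (auto intro!: arg_cong2[of _ _ _ _ "(-)"] arg_cong2[of _ _ _ _ "(+)"] sum.cong)
  have flow_iff: "a \<in> integer_flows \<longleftrightarrow> a \<in> ?E \<rightarrow>\<^sub>E UNIV \<and> (\<forall>e\<in>?E. final e = n + 1 \<longrightarrow> a e = 0) \<and>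
    (\<forall>l\<in>{2..n}. (if l \<in> S then int (a ((1, l), 0)) + 1 else 0) \<le> excess n (\<lambda>e. a (e, 0)) l)" for a
    unfolding integer_flows_def mem_Collect_eq flow_condition_family[OF n S] by blast
  have "bij_betw to_flow ?X integer_flows"
  proof (rule bij_betwI[where g = from_flow])
    show "to_flow \<in> ?X \<rightarrow> integer_flows"
    proof clarify
      fix p x assume p: "p \<in> feasible n" and x: "x \<in> (\<Pi>\<^sub>E l\<in>S. {..<nat (excess n p l)})"
      let ?a = "to_flow (p, x)"
      have a_pair: "?a (e, 0) = p e" if "e \<in> pairs n" for e
        using that pair_edge[OF that] by (simp add: to_flow_def)
      have a_S: "?a ((1, l), 0) = x l" if "l \<in> S" for l
        using that S_edge[OF that] by (simp add: to_flow_def pairs_def final_def)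
      have "?a \<in> ?E \<rightarrow>\<^sub>E UNIV" by (simp add: to_flow_def)
      moreover have "?a e = 0" if "e \<in> ?E" "final e = n + 1" for e
      proof -
        have "fst e \<notin> pairs n" "final e \<notin> S" using that S by (auto simp: pairs_def final_def)
        then show ?thesis using that by (simp add: to_flow_def)
      qed
      moreover have "(if l \<in> S then int (?a ((1, l), 0)) + 1 else 0) \<le> excess n (\<lambda>e. ?a (e, 0)) l"
        if l: "l \<in> {2..n}" for l
      proof -
        have "excess n (\<lambda>e. ?a (e, 0)) l = excess n p l" by (rule excess_cong) (simp add: a_pair)
        moreover have "0 \<le> excess n p l" using p l by (simp add: feasible_def)
        moreover have "x l < nat (excess n p l)" if "l \<in> S" using PiE_mem[OF x that] by simp
        ultimately show ?thesis using a_S[of l] by auto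
      qed
      ultimately show "?a \<in> integer_flows" unfolding flow_iff by blast
    qed
    show "from_flow \<in> integer_flows \<rightarrow> ?X"
    proof
      fix a assume a: "a \<in> integer_flows"
      let ?p = "\<lambda>e\<in>pairs n. a (e, 0)"
      have eq: "excess n ?p l = excess n (\<lambda>e. a (e, 0)) l" for l by (rule excess_cong) simp
      have ge: "(if l \<in> S then int (a ((1, l), 0)) + 1 else 0) \<le> excess n ?p l" if "l \<in> {2..n}" for l
        using a that unfolding flow_iff eq by blast
      have "0 \<le> excess n ?p l" if "l \<in> {2..n}" for l using ge[OF that] by (simp split: if_splits)
      then have "?p \<in> feasible n" by (simp add: feasible_def)
      moreover have "a ((1, l), 0) < nat (excess n ?p l)" if "l \<in> S" for l
        using ge[of l] that S by auto
      ultimately show "from_flow a \<in> ?X" by (simp add: from_flow_def PiE_iff)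
    qed
    show "from_flow (to_flow z) = z" if z: "z \<in> ?X" for z
    proof -
      obtain p x where px: "z = (p, x)" "p \<in> feasible n" "x \<in> (\<Pi>\<^sub>E l\<in>S. {..<nat (excess n p l)})" using z by blast
      have "p \<in> pairs n \<rightarrow>\<^sub>E UNIV" using px(2) by (simp add: feasible_def)
      then have "(\<lambda>e\<in>pairs n. to_flow (p, x) (e, 0)) = p"
      proof (intro PiE_ext[of _ "pairs n" "\<lambda>_. UNIV"])
        fix e assume "e \<in> pairs n"
        then show "(\<lambda>e\<in>pairs n. to_flow (p, x) (e, 0)) e = p e" using pair_edge by (simp add: to_flow_def)
      qed simp_all
      moreover have "(\<lambda>l\<in>S. to_flow (p, x) ((1, l), 0)) = x"
      proof (rule PiE_ext[OF _ px(3)])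
        show "(\<lambda>l\<in>S. to_flow (p, x) ((1, l), 0)) \<in> (\<Pi>\<^sub>E l\<in>S. {..<nat (excess n p l)})"
          using px(3) S_edge by (simp add: to_flow_def pairs_def final_def PiE_iff)
        fix l assume "l \<in> S"
        then show "(\<lambda>l\<in>S. to_flow (p, x) ((1, l), 0)) l = x l"
          using S_edge by (simp add: to_flow_def pairs_def final_def)
      qed
      ultimately show ?thesis unfolding px(1) from_flow_def by simp
    qed
    show "to_flow (from_flow a) = a" if a: "a \<in> integer_flows" for a
    proof (rule PiE_ext[of _ ?E "\<lambda>_. UNIV"])
      show "to_flow (from_flow a) \<in> ?E \<rightarrow>\<^sub>E UNIV" by (simp add: to_flow_def from_flow_def)
      show "a \<in> ?E \<rightarrow>\<^sub>E UNIV" using a unfolding flow_iff by blast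
      fix e assume e: "e \<in> ?E"
      obtain i j c where ijc: "e = ((i, j), c)" by (cases e) auto
      have zero: "a e = 0" if "j = n + 1" using a e that unfolding flow_iff ijc final_def by auto
      show "to_flow (from_flow a) e = a e"
        using e zero S unfolding ijc edges_family_graph[OF S]
        by (auto simp: to_flow_def from_flow_def edges_family_graph[OF S] final_def pairs_def)
    qed
  qed
  then have "card integer_flows = card ?X" by (simp add: bij_betw_same_card)
  also have "\<dots> = (\<Sum>p\<in>feasible n. card (\<Pi>\<^sub>E l\<in>S. {..<nat (excess n p l)}))"
    using finS by (intro card_SigmaI) (auto intro: finite_PiE)
  also have "\<dots> = (\<Sum>p\<in>feasible n. \<Prod>l\<in>S. nat (excess n p l))"
    using finS by (simp add: card_PiE)
  also have "int \<dots> = (\<Sum>p\<in>feasible n. \<Prod>l\<in>S. excess n p l)"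
    unfolding of_nat_sum of_nat_prod
    by (intro sum.cong prod.cong refl) (use S in \<open>auto simp: feasible_def\<close>)
  finally show ?thesis .
qed

theorem theorem13:
  fixes n k :: nat
  assumes "1 \<le> k" and "k \<le> n"
  shows "(\<Sum>G\<in>graph_family n k. normalized_volume (flow_polytope (augment n G))) =
           narayana n k * (\<Prod>i = 1..n - 1. catalan i)"
proof -
  have n: "1 \<le> n" using assms by simp
  let ?\<S> = "{S. S \<subseteq> {2..n} \<and> card S = k - 1}"
  have volume: "normalized_volume (flow_polytope (augment n (family_graph n S))) =
      real_of_int (\<Sum>p\<in>feasible n. \<Prod>l\<in>S. excess n p l)" if S: "S \<subseteq> {2..n}" for S
  proof -
    interpret augmented_graph n "family_graph n S"
      by unfold_locales (use ordered_family_graph[OF n S] in \<open>simp_all add: family_graph_def\<close>)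
    have "normalized_volume (flow_polytope (augment n (family_graph n S))) = real_of_int (int (card integer_flows))"
      by (simp add: normalized_volume_flow_polytope)
    then show ?thesis unfolding card_integer_flows_family[OF n S] .
  qed
  have "(\<Sum>G\<in>graph_family n k. normalized_volume (flow_polytope (augment n G))) =
      (\<Sum>S\<in>?\<S>. normalized_volume (flow_polytope (augment n (family_graph n S))))"
    unfolding graph_family_eq[OF n] by (rule sum.reindex[OF inj_family_graph, unfolded o_def])
  also have "\<dots> = real_of_int (\<Sum>S\<in>?\<S>. \<Sum>p\<in>feasible n. \<Prod>l\<in>S. excess n p l)"
    using volume by simp
  also have "(\<Sum>S\<in>?\<S>. \<Sum>p\<in>feasible n. \<Prod>l\<in>S. excess n p l) = esum n (k - 1)"
    unfolding esum_def esym_def by (rule sum.swap)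
  also have "real_of_int (esum n (k - 1)) = narayana n k * (\<Prod>i = 1..n - 1. catalan i)"
    using esum_eq_narayana[OF n, of "k - 1"] assms by simp
  finally show ?thesis .
qed

end
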